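(* Let $d\geq 1$ and $t\geq 1$ be integers and let $r\geq 2$ be a prime. Then \[ M'(rt,r,d)\;\geq\;\Big\lceil \tfrac{td(r-1)+t}{r-1}-1 \Big\rceil . \] Moreover, this bound is optimal (i.e. holds with equality) for $M'(r,r,d)$ (the case $t=1$, where it reads $M'(r,r,d)=d$) and for $M'(n,2,1)$ (the case $r=2$, $d=1$, where it reads $M'(2t,2,1)=2t-1$).
   Context: All measures are probability measures on $\mathbb{R}^d$ absolutely continuous with respect to Lebesgue measure. A convex partition of $\mathbb{R}^d$ into $n$ parts is an ordered tuple $\mathcal{K}=(K_1,\dots,K_n)$ of closed convex sets with $K_1\cup\dots\cup K_n=\mathbb{R}^d$ and pairwise disjoint interiors (some $K_i$ may be empty). An $r$-labeled convex partition is a pair $(\mathcal{K},\ell)$ with $\ell\colon[n]\to[r]$ arbitrary, where $[n]=\{1,\dots,n\}$. Oriented hyperplanes: for a unit vector $v\in S^{d-1}$ and $a\in\mathbb{R}\cup\{-\infty,+\infty\}$, let $H^+_{(v,a)}=\{x:\langle x,v\rangle\ge a\}$ and $H^-_{(v,a)}=\{x:\langle x,v\rangle\le a\}$ for $a\in\mathbb{R}$; $H^+_{(v,+\infty)}=\emptyset$, $H^-_{(v,+\infty)}=\mathbb{R}^d$; $H^+_{(v,-\infty)}=\mathbb{R}^d$, $H^-_{(v,-\infty)}=\emptyset$. For $r$-labeled convex partitions $((K_1,\dots,K_n),\ell)$ and $((K'_1,\dots,K'_m),\ell')$ define $\mathcal{K}*_{(v,a)}\mathcal{K}'$ to be the $r$-labeled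 partition $((H^+_{(v,a)}\cap K_1,\dots,H^+_{(v,a)}\cap K_n,H^-_{(v,a)}\cap K'_1,\dots,H^-_{(v,a)}\cap K'_m),\ell'')$ where $\ell''(k)=\ell(k)$ for $k\le n$ and $\ell''(k)=\ell'(k-n)$ for $n<k\le n+m$. Power diagrams: for pairwise distinct affine functionals $a_1,\dots,a_r\colon\mathbb{R}^d\to\mathbb{R}$ let $K_i=\{x: a_i(x)=\max_j a_j(x)\}$; the $r$-labeled partition $((K_1,\dots,K_r),\mathrm{id}_{[r]})$ is a power diagram, and $\mathcal{X}_{1,r}$ is the space of all of these. A space of $t$-iterated $r$-labeled convex partitions is defined recursively: for $t=1$ it is $\mathcal{X}_{1,r}$; for $t\ge 2$ it is any set of the form $\{\mathcal{K}'*_{(v,a)}\mathcal{K}'':\mathcal{K}'\in\mathcal{X}',\mathcal{K}''\in\mathcal{X}'',a\in\mathbb{R}\cup\{\pm\infty\}\}$ where $v\in S^{d-1}$ is a fixed unit vector, $\mathcal{X}'$ is a space of $t'$-iterated and $\mathcal{X}''$ a space of $t''$-iterated $r$-labeled convex partitions, with $t'+t''=t$. Elements of such spaces have exactly $rt$ (possibly empty) parts and are called iterated $r$-labeled convex partitions. For $n$ a multiple of $r$, $M'(n,r,d)$ is the largest integer $M'$ such that for any $M'$ measures $\mu_1,\dots,\mu_{M'}$ on $\mathbb{R}^d$ there is an iterated $r$-labeled convex partition $((K_1,\dots,K_n),\ell)$ of $\mathbb{R}^d$ into $n$ parts with $\mu_j\big(\bigcup_{i\in\ell^{-1}(s)}K_i\big)=\tfrac1r$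 for all $1\le j\le M'$ and $1\le s\le r$. *)

theory Defs
  imports "HOL-Probability.Probability" "HOL-Computational_Algebra.Primes"
begin

text \<open>An r-labeled (convex) partition is represented as a list of pairs (K_i, l(i)),
  i.e. the ordered tuple of parts together with their labels in {1..r}.\<close>

type_synonym 'a labeled_partition = "('a set \<times> nat) list"

definition halfplus :: "'a::euclidean_space \<Rightarrow> ereal \<Rightarrow> 'a set" where
  "halfplus v a = {x. ereal (x \<bullet> v) \<ge> a}"

definition halfminus :: "'a::euclidean_space \<Rightarrow> ereal \<Rightarrow> 'a set" where
  "halfminus v a = {x. ereal (x \<bullet> v) \<le> a}"

definition glue :: "'a::euclidean_space \<Rightarrow> ereal \<Rightarrow> 'a labeled_partition \<Rightarrow> 'a labeled_partition
    \<Rightarrow> 'a labeled_partition" where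
  "glue v a P Q = map (\<lambda>(K, l). (halfplus v a \<inter> K, l)) P @ map (\<lambda>(K, l). (halfminus v a \<inter> K, l)) Q"

text \<open>Power diagrams: an affine functional x \<mapsto> c \<bullet> x + b is represented by the pair (c, b);
  the list A = [a_1,...,a_r] of pairwise distinct affine functionals gives the partition
  ((K_1,...,K_r), id) with K_i = {x. a_i(x) = max_j a_j(x)} (labels 1..r).\<close>
definition power_diagrams :: "nat \<Rightarrow> 'a::euclidean_space labeled_partition set" where
  "power_diagrams r =
     {map (\<lambda>i. ({x. fst (A!i) \<bullet> x + snd (A!i) = (MAX j\<in>{..<r}. fst (A!j) \<bullet> x + snd (A!j))}, i + 1)) [0..<r]
      | A :: ('a \<times> real) list. length A = r \<and> distinct A}"

inductive iter_space :: "nat \<Rightarrow> nat \<Rightarrow> 'a::euclidean_space labeled_partition set \<Rightarrow> bool"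
  for r :: nat where
  base: "iter_space r 1 (power_diagrams r)"
| step: "iter_space r t1 X1 \<Longrightarrow> iter_space r t2 X2 \<Longrightarrow> norm v = 1 \<Longrightarrow>
         iter_space r (t1 + t2) {glue v a P1 P2 | P1 P2 a. P1 \<in> X1 \<and> P2 \<in> X2}"

definition iterated_partition :: "nat \<Rightarrow> 'a::euclidean_space labeled_partition \<Rightarrow> bool" where
  "iterated_partition r P \<longleftrightarrow> (\<exists>t X. iter_space r t X \<and> P \<in> X)"

definition admissible_measure :: "'a::euclidean_space measure \<Rightarrow> bool" where
  "admissible_measure mu \<longleftrightarrow> prob_space mu \<and> sets mu = sets lborel \<and> absolutely_continuous lborel mu"

definition label_union :: "'a labeled_partition \<Rightarrow> nat \<Rightarrow> 'a set" where
  "label_union P s = \<Union>{fst (P!i) | i. i < length P \<and> snd (P!i) = s}"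

text \<open>equip_ok TYPE('a) n r M: any M measures on 'a (= R^d, d = DIM('a)) can be simultaneously
  equipartitioned (each label class gets measure 1/r) by an iterated r-labeled convex partition
  into n parts. M'(n,r,d) is the largest M with this property.\<close>
definition equip_ok :: "'a::euclidean_space itself \<Rightarrow> nat \<Rightarrow> nat \<Rightarrow> nat \<Rightarrow> bool" where
  "equip_ok _ n r M \<longleftrightarrow>
     (\<forall>mu :: nat \<Rightarrow> 'a measure. (\<forall>j<M. admissible_measure (mu j)) \<longrightarrow>
        (\<exists>P. iterated_partition r P \<and> length P = n \<and>
             (\<forall>j<M. \<forall>s\<in>{1..r}. measure (mu j) (label_union P s) = 1 / real r)))"

end

theory Submission
  imports Defs "HOL-Combinatorics.Multiset_Permutations" "HOL-Number_Theory.Cong"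
begin

text \<open>
  Write \<open>p\<close> for the prime number of labels. A point of the join of \<open>t (d (p - 1) + 1)\<close> copies of \<open>\<int>/p\<close>
  consists of weights \<open>x\<close> and labels \<open>g\<close>; it is split into \<open>t\<close> blocks, one for each slab of an iterated partition.
  The weights of a block determine \<open>p\<close> sites in \<open>\<real>\<^sup>d\<close>, and the power diagram needs heights
  as well where sites come close together. The heights are chosen according to a linear order of the labels,
  and all orders are used at once, with integer weights that depend on the label of one further vertex of the
  block (the cone vertex). When the weight of that vertex vanishes, the sites fall into two separated groups, only the
  restrictions of the order to the groups matter, and the sum of the weights over all shuffles of two given orders
  does not depend on the cone label. This yields an equivariant chain map although the space of
  power diagrams itself is not highly connected.

  If no partition of the family were an equipartition, then choosing a measure and a label that receives too much would
  give an equivariant map to a free complex of dimension \<open>M (p - 1) - 1\<close>. Comparing the periodic resolution of \<open>\<int>/p\<close>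
  in the join with dual cochains on this complex shows that \<open>p\<close> would divide a power of \<open>(p - 1)!\<close>.

  Optimality: small balls around affinely independent points are not met by a common hyperplane, and
  \<open>2 t - 1\<close> cut points miss one of \<open>2 t\<close> disjoint intervals.
\<close>


section \<open>Cochains on lists\<close>

text \<open>The obstacle is divisibility. Coinciding sites have to be separated by heights, and no
  single order of the labels is invariant under rotation. Giving each of the \<open>p!\<close>
  orders the multiplicity 1 would be equivariant, but then the count at a vertex is
  \<open>p!\<close>, which is 0 modulo \<open>p\<close>, and nothing follows. The multiplicity 1 is
  therefore divided by \<open>p\<close>, after subtracting a term that is congruent to 1 modulo
  \<open>p\<close> and whose sum over the shuffles of two nonempty words vanishes. The count becomes
  \<open>(p - 1)!\<close> for each block, which is prime to \<open>p\<close>. The price is a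
  dependence on the label of the cone vertex, which must disappear where this vertex has weight 0.
  Here the number d (p - 1) enters: each of the d coordinate directions carries only
  \<open>p - 1\<close> vertices, so some label is absent from it and its site has coordinate 0
  there, while in a heavy block some site has a large coordinate in some direction. The
  \<open>p\<close> sites then leave a gap in that direction. With the cone vertex a block has d (p -
  1) + 1 vertices.\<close>

fun cobd :: "('v list \<Rightarrow> int) \<Rightarrow> 'v list \<Rightarrow> int" where
  "cobd f [] = 0"
| "cobd f (x # xs) = f xs - cobd (\<lambda>ys. f (x # ys)) xs"

lemma cobd_cong:
  assumes "\<And>ys. Suc (length ys) = length xs \<Longrightarrow> subseq ys xs \<Longrightarrow> f ys = g ys"
  shows "cobd f xs = cobd g xs"
  using assms
proof (induction xs arbitrary: f g)
  case (Cons x xs)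
  have "f xs = g xs" by (rule Cons.prems) auto
  moreover have "cobd (\<lambda>ys. f (x # ys)) xs = cobd (\<lambda>ys. g (x # ys)) xs"
    by (rule Cons.IH) (auto intro: Cons.prems)
  ultimately show ?case by simp
qed simp

lemma cobd_diff: "cobd (\<lambda>ys. f ys - g ys) xs = cobd f xs - cobd g xs"
  by (induction xs arbitrary: f g) auto

lemma cobd_minus: "cobd (\<lambda>ys. - f ys) xs = - cobd f xs"
  by (induction xs arbitrary: f) auto

lemma cobd_zero: "cobd (\<lambda>ys. 0) xs = 0"
  by (induction xs) auto

lemma cobd_sum: "cobd (\<lambda>ys. \<Sum>i\<in>I. f i ys) xs = (\<Sum>i\<in>I. cobd (f i) xs)"
  by (induction xs arbitrary: f) (auto simp: sum_subtractf)

lemma cobd_cmult: "cobd (\<lambda>ys. c * f ys) xs = c * cobd f xs"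
  by (induction xs arbitrary: f) (auto simp: algebra_simps)

lemma cobd_map: "cobd f (map h xs) = cobd (\<lambda>ys. f (map h ys)) xs"
  by (induction xs arbitrary: f) auto

lemma cobd_cobd: "cobd (cobd f) xs = 0"
proof (induction xs arbitrary: f)
  case (Cons x xs)
  show ?case by (simp add: cobd_diff Cons.IH)
qed simp

text \<open>Appending \<open>y\<close> is the join with a point: its faces are the joins of the
  faces of \<open>xs\<close> with \<open>y\<close>, and \<open>xs\<close> itself, which comes last
  in the alternating sum.\<close>

lemma cobd_snoc: "cobd f (xs @ [y]) = cobd (\<lambda>ys. f (ys @ [y])) xs + (-1) ^ length xs * f xs"
  by (induction xs arbitrary: f) auto

text \<open>The number of faces is even, so the signs cancel.\<close>

lemma cobd_const:
  assumes "even (length xs)" "\<And>ys. Suc (length ys) = length xs \<Longrightarrow> subseq ys xs \<Longrightarrow> f ys = c"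
  shows "cobd f xs = 0"
proof -
  have "cobd f xs = cobd (\<lambda>_. c) xs" by (rule cobd_cong) (use assms(2) in auto)
  moreover have "cobd (\<lambda>_. c) ys = (if even (length ys) then 0 else c)" for ys :: "'a list"
    by (induction ys) auto
  ultimately show ?thesis using assms(1) by simp
qed

section \<open>Alternating cochains\<close>

definition alternating :: "('v list \<Rightarrow> int) \<Rightarrow> bool" where
  "alternating f \<longleftrightarrow> (\<forall>us a b vs. f (us @ a # b # vs) = - f (us @ b # a # vs)) \<and>
     (\<forall>us a vs. f (us @ a # a # vs) = 0)"

lemma alternating_Cons: "alternating f \<Longrightarrow> alternating (\<lambda>ys. f (x # ys))"
  unfolding alternating_def by (metis append_Cons)

lemma alternating_cobd:
  assumes "alternating f" shows "alternating (cobd f)"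
proof -
  have 1: "cobd f (us @ a # b # vs) = - cobd f (us @ b # a # vs)" if "alternating f" for f :: "'a list \<Rightarrow> int" and us a b vs
    using that
  proof (induction us arbitrary: f)
    case Nil
    have "f (a # b # ys) = - f (b # a # ys)" for ys
      using Nil unfolding alternating_def by (metis append_Nil)
    then show ?case by (simp add: cobd_minus)
  next
    case (Cons u us)
    have "f (us @ a # b # vs) = - f (us @ b # a # vs)"
      using Cons.prems unfolding alternating_def by blast
    then show ?case using Cons.IH[OF alternating_Cons[OF Cons.prems, of u]] by simp
  qed
  have 2: "cobd f (us @ a # a # vs) = 0" if "alternating f" for f :: "'a list \<Rightarrow> int" and us a vs
    using that
  proof (induction us arbitrary: f)
    case Nil
    have "f (a # a # ys) = 0" for ys
      using Nil unfolding alternating_def by (metis append_Nil)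
    then show ?case by (simp add: cobd_zero)
  next
    case (Cons u us)
    have "f (us @ a # a # vs) = 0"
      using Cons.prems unfolding alternating_def by blast
    then show ?case using Cons.IH[OF alternating_Cons[OF Cons.prems, of u]] by simp
  qed
  show ?thesis unfolding alternating_def using 1 2 assms by blast
qed

text \<open>Transpositions of neighbours bring two equal entries together. This is how dimension
  enters later: a list longer than the number of its possible entries gets the value 0.\<close>

lemma alternating_not_distinct:
  assumes "alternating f" "\<not> distinct l" shows "f l = 0"
proof -
  have "f (us @ a # vs @ a # ws) = 0" for us a vs ws
  proof (induction vs arbitrary: us)
    case Nil
    have "f (us @ a # a # ws) = 0" using assms(1) unfolding alternating_def by blast
    then show ?case by simp
  next
    case (Cons v vs)
    have "f (us @ a # v # (vs @ a # ws)) = - f (us @ v # a # (vs @ a # ws))"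
      using assms(1) unfolding alternating_def by blast
    also have "\<dots> = - f ((us @ [v]) @ a # vs @ a # ws)" by simp
    finally show ?case using Cons.IH[of "us @ [v]"] by simp
  qed
  moreover obtain us a vs ws where "l = us @ [a] @ vs @ [a] @ ws"
    using not_distinct_decomp[OF assms(2)] by blast
  ultimately show ?thesis by simp
qed

section \<open>Barycentric subdivision and mesh size\<close>

definition barycenter :: "('q \<Rightarrow> real) list \<Rightarrow> 'q \<Rightarrow> real" where
  "barycenter xs q = (\<Sum>x\<leftarrow>xs. x q) / real (length xs)"

text \<open>The transpose of barycentric subdivision, acting on cochains instead of chains.\<close>

primrec subdiv_at :: "nat \<Rightarrow> (('q \<Rightarrow> real) list \<Rightarrow> int) \<Rightarrow> ('q \<Rightarrow> real) list \<Rightarrow> int" where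
  "subdiv_at 0 f xs = f xs"
| "subdiv_at (Suc n) f xs = cobd (subdiv_at n (\<lambda>ys. f (barycenter xs # ys))) xs"

definition subdiv :: "(('q \<Rightarrow> real) list \<Rightarrow> int) \<Rightarrow> ('q \<Rightarrow> real) list \<Rightarrow> int" where
  "subdiv f xs = subdiv_at (length xs) f xs"

lemma subdiv_at_diff: "subdiv_at n (\<lambda>ys. f ys - g ys) = (\<lambda>xs. subdiv_at n f xs - subdiv_at n g xs)"
proof (induction n arbitrary: f g)
  case (Suc n)
  show ?case by (rule ext) (simp add: Suc cobd_diff)
qed auto

lemma subdiv_at_sum: "subdiv_at n (\<lambda>ys. \<Sum>i\<in>I. f i ys) = (\<lambda>xs. \<Sum>i\<in>I. subdiv_at n (f i) xs)"
proof (induction n arbitrary: f)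
  case (Suc n)
  show ?case by (rule ext) (simp add: Suc cobd_sum)
qed auto

lemma subdiv_at_length_cong:
  "length xs = n \<Longrightarrow> (\<And>ys. length ys = n \<Longrightarrow> f ys = g ys) \<Longrightarrow> subdiv_at n f xs = subdiv_at n g xs"
proof (induction n arbitrary: f g xs)
  case (Suc n)
  show ?case by (auto intro!: cobd_cong Suc.IH Suc.prems(2) simp: Suc.prems(1))
qed auto

text \<open>Subdivision is a chain map. On a list that starts with the barycenter,
  \<open>cobd f\<close> is the term of the base minus that of the cone over its boundary; the
  induction hypothesis turns the latter into \<open>cobd\<close> of \<open>cobd\<close>.\<close>

lemma subdiv_at_cobd:
  "length xs = Suc n \<Longrightarrow> subdiv_at (Suc n) (cobd f) xs = cobd (subdiv_at n f) xs"
proof (induction n arbitrary: f xs)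
  case 0
  then obtain x where "xs = [x]" by (auto simp: length_Suc_conv)
  then show ?case by simp
next
  case (Suc n)
  let ?b = "barycenter xs"
  have "subdiv_at (Suc (Suc n)) (cobd f) xs =
     cobd (\<lambda>ys. subdiv_at (Suc n) f ys - subdiv_at (Suc n) (cobd (\<lambda>zs. f (?b # zs))) ys) xs"
    by (simp only: subdiv_at.simps(2)[of "Suc n"] cobd.simps subdiv_at_diff)
  also have "\<dots> = cobd (\<lambda>ys. subdiv_at (Suc n) f ys - cobd (subdiv_at n (\<lambda>zs. f (?b # zs))) ys) xs"
    by (rule cobd_cong) (use Suc in \<open>auto simp del: subdiv_at.simps\<close>)
  also have "\<dots> = cobd (subdiv_at (Suc n) f) xs"
    by (simp add: cobd_diff cobd_cobd del: subdiv_at.simps)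
  finally show ?case .
qed

lemma subdiv_cobd: "xs \<noteq> [] \<Longrightarrow> subdiv (cobd f) xs = cobd (subdiv f) xs"
proof -
  assume "xs \<noteq> []"
  then obtain n where n: "length xs = Suc n" by (cases xs) auto
  have "cobd (subdiv_at n f) xs = cobd (subdiv f) xs"
    by (rule cobd_cong) (auto simp: subdiv_def n)
  then show ?thesis using subdiv_at_cobd[OF n, of f] by (simp add: subdiv_def n del: subdiv_at.simps)
qed

lemma subdiv_diff: "subdiv (\<lambda>ys. f ys - g ys) xs = subdiv f xs - subdiv g xs"
  by (simp add: subdiv_def subdiv_at_diff)

lemma subdiv_sum: "subdiv (\<lambda>ys. \<Sum>i\<in>I. f i ys) xs = (\<Sum>i\<in>I. subdiv (f i) xs)"
  by (simp add: subdiv_def subdiv_at_sum)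

definition mesh_le :: "real \<Rightarrow> ('q \<Rightarrow> real) list \<Rightarrow> bool" where
  "mesh_le D xs \<longleftrightarrow> (\<forall>x\<in>set xs. \<forall>y\<in>set xs. \<forall>q. \<bar>x q - y q\<bar> \<le> D)"

definition barycenter_closed :: "('q \<Rightarrow> real) set \<Rightarrow> bool" where
  "barycenter_closed C \<longleftrightarrow> (\<forall>xs. xs \<noteq> [] \<longrightarrow> set xs \<subseteq> C \<longrightarrow> barycenter xs \<in> C)"

text \<open>Among the averaged differences \<open>y q - x q\<close>, that of \<open>x\<close> itself
  is 0; this gives the factor below 1.\<close>

lemma barycenter_le:
  assumes "x \<in> set xs" "\<And>y. y \<in> set xs \<Longrightarrow> y q - x q \<le> D" "D \<ge> 0"
  shows "barycenter xs q - x q \<le> (real (length xs) - 1) / real (length xs) * D"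
proof -
  let ?n = "length xs"
  obtain us vs where xs: "xs = us @ x # vs" using assms(1) by (meson split_list)
  have n: "?n > 0" using xs by simp
  have "(\<Sum>y\<leftarrow>xs. y q) - real ?n * x q = (\<Sum>y\<leftarrow>us@vs. y q - x q)"
    by (simp add: xs sum_list_subtractf algebra_simps sum_list_triv)
  also have "\<dots> \<le> (\<Sum>y\<leftarrow>us@vs. D)" by (rule sum_list_mono) (use assms(2) xs in auto)
  also have "\<dots> = (real ?n - 1) * D" by (simp add: sum_list_triv xs algebra_simps)
  finally have "((\<Sum>y\<leftarrow>xs. y q) - real ?n * x q) / real ?n \<le> (real ?n - 1) * D / real ?n"
    by (rule divide_right_mono) simp
  then show ?thesis unfolding barycenter_def using n by (simp add: diff_divide_distrib left_diff_distrib)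
qed

lemma barycenter_ge:
  assumes "x \<in> set xs" "\<And>y. y \<in> set xs \<Longrightarrow> x q - y q \<le> D" "D \<ge> 0"
  shows "x q - barycenter xs q \<le> (real (length xs) - 1) / real (length xs) * D"
proof -
  have e: "barycenter (map (\<lambda>x q. - x q) xs) q = - barycenter xs q"
    unfolding barycenter_def using uminus_sum_list_map[of "\<lambda>x. x q" xs] by (simp add: o_def divide_minus_left[symmetric])
  have "barycenter (map (\<lambda>x q. - x q) xs) q - (- x q) \<le>
      (real (length (map (\<lambda>x q. - x q) xs)) - 1) / real (length (map (\<lambda>x q. - x q) xs)) * D"
    by (rule barycenter_le[where x="\<lambda>q. - x q"]) (use assms in auto)
  then show ?thesis by (simp add: e)
qed

text \<open>Subdivision evaluates a cochain on small lists in \<open>C\<close> only. The bound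
  \<open>K\<close> on the length provides one contraction factor for all dimensions. The clause that
  coordinates of \<open>ys\<close> lie between coordinates of \<open>xs\<close> carries the
  induction: the barycenter of \<open>xs\<close> must be close to the points of a subdivided face,
  which need not be vertices of \<open>xs\<close>.\<close>

lemma subdiv_at_cong:
  assumes C: "barycenter_closed C" and K: "n \<le> K" "K > 0" and D: "D \<ge> 0"
    and "length xs = n" "set xs \<subseteq> C" "mesh_le D xs"
    and "\<And>ys. length ys = n \<Longrightarrow> set ys \<subseteq> C \<Longrightarrow>
       (\<And>y q. y \<in> set ys \<Longrightarrow> (\<exists>x\<in>set xs. x q \<le> y q) \<and> (\<exists>x\<in>set xs. y q \<le> x q)) \<Longrightarrow>
       mesh_le ((real K - 1) / real K * D) ys \<Longrightarrow> f ys = g ys"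
  shows "subdiv_at n f xs = subdiv_at n g xs"
  using assms(5-8) K(1)
proof (induction n arbitrary: f g xs)
  case 0
  show ?case using 0(4)[of "[]"] 0(1) by (simp add: mesh_le_def)
next
  case (Suc n)
  let ?b = "barycenter xs"
  let ?k = "(real K - 1) / real K"
  have k0: "?k \<ge> 0" using K(2) by simp
  have kD0: "0 \<le> ?k * D" using k0 D by (rule mult_nonneg_nonneg)
  have xne: "xs \<noteq> []" using Suc.prems(1) by auto
  have bC: "?b \<in> C" using C Suc.prems(2) xne by (auto simp: barycenter_closed_def)
  have kn: "(real (length xs) - 1) / real (length xs) * D \<le> ?k * D"
  proof (rule mult_right_mono[OF _ D])
    have "1 / real K \<le> 1 / real (length xs)"
      using Suc.prems(1,5) by (simp add: field_simps)
    then show "(real (length xs) - 1) / real (length xs) \<le> ?k"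
      using K(2) xne by (simp add: diff_divide_distrib)
  qed
  have bup: "?b q - y q \<le> ?k * D" if "\<exists>x\<in>set xs. x q \<le> y q" for y q
  proof -
    from that obtain x where x: "x \<in> set xs" "x q \<le> y q" by blast
    have "?b q - x q \<le> (real (length xs) - 1) / real (length xs) * D"
      by (rule barycenter_le[OF x(1) _ D]) (use Suc.prems(3) x in \<open>auto simp: mesh_le_def abs_le_iff\<close>)
    then show ?thesis using x kn by simp
  qed
  have blo: "y q - ?b q \<le> ?k * D" if "\<exists>x\<in>set xs. y q \<le> x q" for y q
  proof -
    from that obtain x where x: "x \<in> set xs" "y q \<le> x q" by blast
    have "x q - ?b q \<le> (real (length xs) - 1) / real (length xs) * D"
      by (rule barycenter_ge[OF x(1) _ D]) (use Suc.prems(3) x in \<open>auto simp: mesh_le_def abs_le_iff\<close>)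
    then show ?thesis using x kn by simp
  qed
  have n0: "real (length xs) > 0" using xne by simp
  have bbetween: "(\<exists>x\<in>set xs. x q \<le> ?b q) \<and> (\<exists>x\<in>set xs. ?b q \<le> x q)" for q
  proof (intro conjI; rule ccontr)
    assume "\<not> (\<exists>x\<in>set xs. x q \<le> ?b q)"
    then have l: "\<And>x. x \<in> set xs \<Longrightarrow> ?b q < x q" by force
    have "(\<Sum>x\<leftarrow>xs. ?b q) < (\<Sum>x\<leftarrow>xs. x q)"
      using xne l by (intro sum_list_strict_mono) auto
    then show False using n0 by (simp add: sum_list_triv barycenter_def)
  next
    assume "\<not> (\<exists>x\<in>set xs. ?b q \<le> x q)"
    then have l: "\<And>x. x \<in> set xs \<Longrightarrow> x q < ?b q" by force
    have "(\<Sum>x\<leftarrow>xs. x q) < (\<Sum>x\<leftarrow>xs. ?b q)"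
      using xne l by (intro sum_list_strict_mono) auto
    then show False using n0 by (simp add: sum_list_triv barycenter_def)
  qed
  have "cobd (subdiv_at n (\<lambda>ys. f (?b # ys))) xs = cobd (subdiv_at n (\<lambda>ys. g (?b # ys))) xs"
  proof (rule cobd_cong)
    fix zs assume zs: "Suc (length zs) = length xs" "subseq zs xs"
    then have sub: "set zs \<subseteq> set xs" by (auto elim!: list_emb_set)
    show "subdiv_at n (\<lambda>ys. f (?b # ys)) zs = subdiv_at n (\<lambda>ys. g (?b # ys)) zs"
    proof (rule Suc.IH)
      show "length zs = n" using zs Suc.prems(1) by simp
      show "set zs \<subseteq> C" using sub Suc.prems(2) by blast
      show "mesh_le D zs" using sub Suc.prems(3) unfolding mesh_le_def by blast
      show "n \<le> K" using Suc.prems(5) by simp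
      fix ys assume ys: "length ys = n" "set ys \<subseteq> C"
        "\<And>y q. y \<in> set ys \<Longrightarrow> (\<exists>x\<in>set zs. x q \<le> y q) \<and> (\<exists>x\<in>set zs. y q \<le> x q)"
        "mesh_le (?k * D) ys"
      have bt: "(\<exists>x\<in>set xs. x q \<le> y q) \<and> (\<exists>x\<in>set xs. y q \<le> x q)" if "y \<in> set ys" for y q
        using ys(3)[OF that] sub by blast
      show "f (?b # ys) = g (?b # ys)"
      proof (rule Suc.prems(4))
        show "length (?b # ys) = Suc n" using ys by simp
        show "set (?b # ys) \<subseteq> C" using ys bC by simp
        show "(\<exists>x\<in>set xs. x q \<le> y q) \<and> (\<exists>x\<in>set xs. y q \<le> x q)" if "y \<in> set (?b # ys)" for y q
          using that bt bbetween by auto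
        have "\<bar>?b q - y q\<bar> \<le> ?k * D" if "y \<in> set ys" for y q
          using bup[of q y] blo[of y q] bt[OF that, of q] by (auto simp: abs_le_iff)
        then show "mesh_le (?k * D) (?b # ys)"
          using ys(4) kD0 unfolding mesh_le_def by (auto simp: abs_minus_commute simp del: times_divide_eq_left times_divide_eq_right)
      qed
    qed
  qed
  then show ?case by simp
qed

lemma subdiv_iterate_cong:
  assumes C: "barycenter_closed C" and K: "length xs \<le> K" "K > 0" and D: "D \<ge> 0"
    and "set xs \<subseteq> C" "mesh_le D xs"
    and "\<And>ys. length ys = length xs \<Longrightarrow> set ys \<subseteq> C \<Longrightarrow>
       mesh_le (((real K - 1) / real K) ^ m * D) ys \<Longrightarrow> f ys = g ys"
  shows "(subdiv ^^ m) f xs = (subdiv ^^ m) g xs"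
  using K(1) D assms(5-7)
proof (induction m arbitrary: xs D)
  case (Suc m)
  have "subdiv ((subdiv ^^ m) f) xs = subdiv ((subdiv ^^ m) g) xs"
    unfolding subdiv_def[of "(subdiv ^^ m) f"] subdiv_def[of "(subdiv ^^ m) g"]
  proof (rule subdiv_at_cong[OF C Suc.prems(1) K(2) Suc.prems(2) refl Suc.prems(3,4)])
    fix ys assume ys: "length ys = length xs" "set ys \<subseteq> C" "mesh_le ((real K - 1) / real K * D) ys"
    show "(subdiv ^^ m) f ys = (subdiv ^^ m) g ys"
    proof (rule Suc.IH[OF _ _ ys(2,3)])
      show "length ys \<le> K" using ys Suc.prems(1) by simp
      show "0 \<le> (real K - 1) / real K * D" using K(2) Suc.prems(2) by simp
      fix zs assume "length zs = length ys" "set zs \<subseteq> C" "mesh_le (((real K - 1) / real K) ^ m * ((real K - 1) / real K * D)) zs"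
      then show "f zs = g zs" using ys by (intro Suc.prems(5)) (simp_all only: power_Suc2 mult.assoc)
    qed
  qed
  then show ?case by simp
qed simp

lemma subdiv_iterate_cobd: "xs \<noteq> [] \<Longrightarrow> (subdiv ^^ m) (cobd f) xs = cobd ((subdiv ^^ m) f) xs"
proof (induction m arbitrary: xs)
  case (Suc m)
  have "subdiv ((subdiv ^^ m) (cobd f)) xs = subdiv (cobd ((subdiv ^^ m) f)) xs"
    unfolding subdiv_def[of "(subdiv ^^ m) (cobd f)"] subdiv_def[of "cobd ((subdiv ^^ m) f)"]
  proof (rule subdiv_at_length_cong)
    fix ys :: "('a \<Rightarrow> real) list" assume "length ys = length xs"
    then show "(subdiv ^^ m) (cobd f) ys = cobd ((subdiv ^^ m) f) ys"
      using Suc.prems by (intro Suc.IH) auto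
  qed simp
  then show ?case using subdiv_cobd[OF Suc.prems] by simp
qed simp

section \<open>Cyclic rotation and chains on joins\<close>

definition rot :: "nat \<Rightarrow> nat \<Rightarrow> nat" where
  "rot p s = Suc s mod p"

definition rotv :: "nat \<Rightarrow> nat \<times> nat \<Rightarrow> nat \<times> nat" where
  "rotv p v = (fst v, rot p (snd v))"

lemma rot_less [simp]: "p > 0 \<Longrightarrow> rot p s < p"
  by (simp add: rot_def)

lemma rot_funpow_eq: "p > 0 \<Longrightarrow> s < p \<Longrightarrow> (rot p ^^ i) s = (s + i) mod p"
proof (induction i)
  case (Suc i)
  then show ?case by (simp add: rot_def mod_Suc_eq)
qed simp

lemma rotv_funpow: "(rotv p ^^ i) v = (fst v, (rot p ^^ i) (snd v))"
  by (induction i) (auto simp: rotv_def)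

lemma rotv_funpow_period: "p > 0 \<Longrightarrow> snd v < p \<Longrightarrow> (rotv p ^^ p) v = v"
  by (simp add: rotv_funpow rot_funpow_eq)

lemma fst_rotv_funpow [simp]: "fst ((rotv p ^^ i) v) = fst v" "fst (rotv p v) = fst v"
  by (simp_all add: rotv_funpow rotv_def)

lemma snd_rotv_less [simp]: "p > 0 \<Longrightarrow> snd (rotv p v) < p"
  by (simp add: rotv_def)

lemma snd_rotv_funpow_less: "p > 0 \<Longrightarrow> snd v < p \<Longrightarrow> snd ((rotv p ^^ i) v) < p"
  by (simp add: rotv_funpow rot_funpow_eq)

lemma map_rotv_funpow_Suc: "map (rotv p) (map (rotv p ^^ i) vs) = map (rotv p ^^ Suc i) vs"
  "map (rotv p ^^ i) (map (rotv p) vs) = map (rotv p ^^ Suc i) vs"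
  by (simp_all add: funpow_swap1)

lemma map_rotv_period: "p > 0 \<Longrightarrow> (\<And>v. v \<in> set vs \<Longrightarrow> snd v < p) \<Longrightarrow> map (rotv p ^^ p) vs = vs"
  by (simp add: map_idI rotv_funpow_period)

lemma inj_on_rot: "p > 0 \<Longrightarrow> inj_on (rot p) {..<p}"
  by (rule inj_on_inverseI[where g="rot p ^^ (p - 1)"])
     (metis Suc_pred' funpow_0 funpow_swap1 funpow.simps(2) lessThan_iff mod_add_self2 mod_less o_apply rot_funpow_eq)

lemma bij_betw_rot: "p > 0 \<Longrightarrow> bij_betw (rot p) {..<p} {..<p}"
  by (simp add: bij_betw_def inj_on_rot endo_inj_surj image_subset_iff)

text \<open>Chains on the \<open>N\<close>-fold join of \<open>\<int>/p\<close>, given as functionals on cochains. The boundary of the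
  \<open>k+1\<close>-st is alternately \<open>\<rho> - 1\<close> and \<open>1 + \<rho> + \<dots> + \<rho>\<^sup>p\<^sup>-\<^sup>1\<close> applied to the \<open>k\<close>-th, as in the periodic
  resolution of \<open>\<int>/p\<close>.\<close>

definition twist :: "nat \<Rightarrow> nat \<Rightarrow> (((nat \<times> nat) list \<Rightarrow> int) \<Rightarrow> int) \<Rightarrow> ((nat \<times> nat) list \<Rightarrow> int) \<Rightarrow> int" where
  "twist p k E h = (if even k then E (\<lambda>vs. h (map (rotv p) vs)) - E h
                    else (\<Sum>i<p. E (\<lambda>vs. h (map (rotv p ^^ i) vs))))"

primrec join_chain :: "nat \<Rightarrow> nat \<Rightarrow> ((nat \<times> nat) list \<Rightarrow> int) \<Rightarrow> int" where
  "join_chain p 0 h = h [(0, 0)]"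
| "join_chain p (Suc k) h = (-1) ^ Suc k * twist p k (join_chain p k) (\<lambda>vs. h (vs @ [(Suc k, 0)]))"

text \<open>The simplices on which \<open>join_chain p k\<close> is supported: one vertex from each
  of the first \<open>k + 1\<close> copies of \<int>/p.\<close>

definition join_simplex :: "nat \<Rightarrow> nat \<Rightarrow> (nat \<times> nat) list \<Rightarrow> bool" where
  "join_simplex p k vs \<longleftrightarrow> map fst vs = [0..<Suc k] \<and> (\<forall>v\<in>set vs. snd v < p)"

lemma join_simplex_rotv:
  "p > 0 \<Longrightarrow> join_simplex p k vs \<Longrightarrow> join_simplex p k (map (rotv p) vs)"
  "p > 0 \<Longrightarrow> join_simplex p k vs \<Longrightarrow> join_simplex p k (map (rotv p ^^ i) vs)"
  by (auto simp: join_simplex_def o_def snd_rotv_funpow_less)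

lemma twist_diff:
  assumes "\<And>f g. E (\<lambda>vs. f vs - g vs) = E f - E g"
  shows "twist p k E (\<lambda>vs. f vs - g vs) = twist p k E f - twist p k E g"
  by (simp add: twist_def assms sum_subtractf)

lemma join_chain_diff: "join_chain p k (\<lambda>vs. f vs - g vs) = join_chain p k f - join_chain p k g"
proof (induction k arbitrary: f g)
  case (Suc k)
  show ?case
    using twist_diff[where E="join_chain p k", OF Suc, of p k "\<lambda>vs. f (vs @ [(Suc k, 0)])" "\<lambda>vs. g (vs @ [(Suc k, 0)])"]
    by (simp add: right_diff_distrib)
qed simp

lemma join_chain_zero: "join_chain p k (\<lambda>vs. 0) = 0"
  using join_chain_diff[of p k "\<lambda>_. 0" "\<lambda>_. 0"] by simp

lemma join_chain_add: "join_chain p k (\<lambda>vs. f vs + g vs) = join_chain p k f + join_chain p k g"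
proof -
  have "join_chain p k (\<lambda>vs. f vs - (0 - g vs)) = join_chain p k f + join_chain p k g"
    by (simp only: join_chain_diff join_chain_zero)
  then show ?thesis by simp
qed

lemma join_chain_sum:
  "finite I \<Longrightarrow> join_chain p k (\<lambda>vs. \<Sum>i\<in>I. f i vs) = (\<Sum>i\<in>I. join_chain p k (f i))"
  by (induction I rule: finite_induct) (simp_all add: join_chain_zero join_chain_add)

lemma twist_cong:
  assumes "\<And>f g. (\<And>vs. P vs \<Longrightarrow> f vs = g vs) \<Longrightarrow> E f = E g"
    and "\<And>vs. P vs \<Longrightarrow> P (map (rotv p) vs)" "\<And>vs i. P vs \<Longrightarrow> P (map (rotv p ^^ i) vs)"
    and "\<And>vs. P vs \<Longrightarrow> f vs = g vs"
  shows "twist p k E f = twist p k E g"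
proof -
  have "E (\<lambda>vs. f (map (rotv p) vs)) = E (\<lambda>vs. g (map (rotv p) vs))" "E f = E g"
    "E (\<lambda>vs. f (map (rotv p ^^ i) vs)) = E (\<lambda>vs. g (map (rotv p ^^ i) vs))" for i
    by (intro assms(1) assms(4) assms(2,3); assumption)+
  then show ?thesis by (simp add: twist_def)
qed

lemma join_chain_cong:
  assumes p: "p > 0" and "\<And>vs. join_simplex p k vs \<Longrightarrow> f vs = g vs"
  shows "join_chain p k f = join_chain p k g"
  using assms(2)
proof (induction k arbitrary: f g)
  case 0
  then show ?case using p by (simp add: join_simplex_def)
next
  case (Suc k)
  have "twist p k (join_chain p k) (\<lambda>vs. f (vs @ [(Suc k, 0)])) = twist p k (join_chain p k) (\<lambda>vs. g (vs @ [(Suc k, 0)]))"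
  proof (rule twist_cong[where P="join_simplex p k"])
    show "join_chain p k f = join_chain p k g" if "\<And>vs. join_simplex p k vs \<Longrightarrow> f vs = g vs" for f g
      using that by (rule Suc.IH)
    show "f (vs @ [(Suc k, 0)]) = g (vs @ [(Suc k, 0)])" if "join_simplex p k vs" for vs
      using that p by (intro Suc.prems) (auto simp: join_simplex_def)
  qed (use join_simplex_rotv[OF p] in auto)
  then show ?case by simp
qed

lemma twist_join_chain_add: "twist p k (join_chain p k) (\<lambda>vs. f vs + g vs) =
    twist p k (join_chain p k) f + twist p k (join_chain p k) g"
  by (simp add: twist_def join_chain_add sum.distrib)

lemma join_chain_minus: "join_chain p k (\<lambda>vs. - f vs) = - join_chain p k f"
  using join_chain_diff[of p k "\<lambda>_. 0" f] by (simp add: join_chain_zero)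

text \<open>The boundary of the join of a cycle with a point is the cycle up to sign, and the
  twisted chain is a cycle because \<rho> - 1 and the norm 1 + \<rho> + ... annihilate each
  other.\<close>

lemma join_chain_cobd:
  assumes p: "p > 0"
  shows "join_chain p (Suc k) (cobd h) = twist p k (join_chain p k) h"
proof (induction k arbitrary: h)
  case 0
  show ?case by (simp add: twist_def rotv_def)
next
  case (Suc k)
  let ?K = "Suc k"
  let ?E = "join_chain p k"
  let ?h' = "\<lambda>vs. h (vs @ [(Suc ?K, 0)])"
  \<comment> \<open>The cycle condition. Both products telescope, and the ends agree because
    \<open>p\<close> rotations are the identity on these simplices.\<close>
  have z: "twist p ?K (join_chain p ?K) (cobd g) = 0" for g
  proof -
    have c: "join_chain p ?K (\<lambda>vs. cobd g (map r vs)) = twist p k ?E (\<lambda>vs. g (map r vs))" for r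
      by (simp only: cobd_map Suc.IH)
    have per: "?E (\<lambda>vs. g (map (rotv p ^^ p) vs)) = ?E g"
      by (rule join_chain_cong[OF p]) (simp add: map_rotv_period[OF p] join_simplex_def)
    define a where "a i = ?E (\<lambda>vs. g (map (rotv p ^^ i) vs))" for i
    have tel: "(\<Sum>i<p. a (Suc i)) = (\<Sum>i<p. a i)"
    proof -
      have "(\<Sum>i<p. a (Suc i)) - (\<Sum>i<p. a i) = a p - a 0"
        by (simp add: sum_lessThan_telescope flip: sum_subtractf)
      also have "\<dots> = 0" using per by (simp add: a_def)
      finally show ?thesis by simp
    qed
    have a1: "?E (\<lambda>vs. g (map (rotv p) (map (rotv p ^^ i) vs))) = a (Suc i)"
      "?E (\<lambda>vs. g (map (rotv p ^^ i) (map (rotv p) vs))) = a (Suc i)" for i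
      by (simp_all only: map_rotv_funpow_Suc a_def)
    show ?thesis
    proof (cases "even k")
      case True
      have "twist p ?K (join_chain p ?K) (cobd g) = (\<Sum>i<p. twist p k ?E (\<lambda>vs. g (map (rotv p ^^ i) vs)))"
        unfolding twist_def[of p ?K] using True by (simp only: c) simp
      also have "\<dots> = (\<Sum>i<p. a (Suc i) - a i)"
        unfolding twist_def using True by (simp only: a1) (simp add: a_def)
      also have "\<dots> = 0" using tel by (simp add: sum_subtractf)
      finally show ?thesis .
    next
      case False
      have "twist p ?K (join_chain p ?K) (cobd g) = twist p k ?E (\<lambda>vs. g (map (rotv p) vs)) - twist p k ?E g"
        unfolding twist_def[of p ?K] using False by (simp add: c Suc.IH del: join_chain.simps)
      also have "\<dots> = (\<Sum>i<p. a (Suc i)) - (\<Sum>i<p. a i)"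
        unfolding twist_def using False by (simp only: a1) (simp add: a_def)
      finally show ?thesis using tel by simp
    qed
  qed
  have "join_chain p (Suc ?K) (cobd h) = (-1) ^ Suc ?K * twist p ?K (join_chain p ?K)
      (\<lambda>vs. cobd ?h' vs + (-1) ^ length vs * h vs)"
    by (subst join_chain.simps(2)) (simp only: cobd_snoc)
  also have "twist p ?K (join_chain p ?K) (\<lambda>vs. cobd ?h' vs + (-1) ^ length vs * h vs)
     = twist p ?K (join_chain p ?K) (\<lambda>vs. cobd ?h' vs + (-1) ^ Suc ?K * h vs)"
  proof (rule twist_cong[where P="join_simplex p ?K"])
    show "cobd ?h' vs + (-1) ^ length vs * h vs = cobd ?h' vs + (-1) ^ Suc ?K * h vs" if "join_simplex p ?K vs" for vs
    proof -
      have "length (map fst vs) = Suc ?K" using that unfolding join_simplex_def by simp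
      then show ?thesis by simp
    qed
    show "join_chain p ?K f = join_chain p ?K g" if "\<And>vs. join_simplex p ?K vs \<Longrightarrow> f vs = g vs" for f g
      using that by (rule join_chain_cong[OF p])
  qed (use join_simplex_rotv[OF p] in auto)
  also have "\<dots> = twist p ?K (join_chain p ?K) (\<lambda>vs. (-1) ^ Suc ?K * h vs)"
    by (simp only: twist_join_chain_add z add_0)
  also have "\<dots> = (-1) ^ Suc ?K * twist p ?K (join_chain p ?K) h"
  proof (cases "even k")
    case True then show ?thesis by (simp del: join_chain.simps)
  next
    case False then show ?thesis
      by (simp add: twist_def join_chain_minus sum_negf del: join_chain.simps)
  qed
  finally show ?case by (simp del: join_chain.simps)
qed

text \<open>A pairing of the resolution with a dual family of cochains. Let \<open>u k i\<close> be
  the value of \<open>H k\<close>, rotated \<open>i\<close> times, on the \<open>k\<close>-th chain.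
  The boundary formula of the chain and the formula for \<open>cobd (H k)\<close> compute the same
  number. For even \<open>k\<close> this makes \<open>u (Suc k) i - u k i\<close> independent of
  \<open>i\<close>, so that summing over \<open>i\<close> gives a multiple of \<open>p\<close>; for
  odd \<open>k\<close> the two sums are equal.\<close>

lemma join_chain_pairing_mod:
  fixes H :: "nat \<Rightarrow> (nat \<times> nat) list \<Rightarrow> int"
  assumes p: "p > 0"
    and even: "\<And>k vs. k < n \<Longrightarrow> even k \<Longrightarrow> join_simplex p (Suc k) vs \<Longrightarrow>
        cobd (H k) vs = H (Suc k) (map (rotv p) vs) - H (Suc k) vs"
    and odd: "\<And>k vs. k < n \<Longrightarrow> odd k \<Longrightarrow> join_simplex p (Suc k) vs \<Longrightarrow>
        cobd (H k) vs = (\<Sum>i<p. H (Suc k) (map (rotv p ^^ i) vs))"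
  shows "k \<le> n \<Longrightarrow> int p dvd (\<Sum>i<p. join_chain p k (\<lambda>vs. H k (map (rotv p ^^ i) vs)))
                    - (\<Sum>i<p. H 0 [(0, i)])"
proof (induction k)
  case 0
  have "(rotv p ^^ i) (0, 0) = (0, i)" if "i < p" for i
    using that p by (simp add: rotv_funpow rot_funpow_eq)
  then show ?case by simp
next
  case (Suc k)
  define u where "u k i = join_chain p k (\<lambda>vs. H k (map (rotv p ^^ i) vs))" for k i
  have k: "k < n" using Suc.prems by simp
  have tw: "join_chain p (Suc k) (\<lambda>vs. cobd (H k) (map (rotv p ^^ i) vs))
     = twist p k (join_chain p k) (\<lambda>vs. H k (map (rotv p ^^ i) vs))" for i
    by (simp only: cobd_map join_chain_cobd[OF p])
  have "int p dvd (\<Sum>i<p. u (Suc k) i) - (\<Sum>i<p. u k i)"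
  proof (cases "even k")
    case True
    have step: "u (Suc k) (Suc i) - u (Suc k) i = u k (Suc i) - u k i" for i
    proof -
      have "join_chain p (Suc k) (\<lambda>vs. cobd (H k) (map (rotv p ^^ i) vs))
        = join_chain p (Suc k) (\<lambda>vs. H (Suc k) (map (rotv p) (map (rotv p ^^ i) vs)) - H (Suc k) (map (rotv p ^^ i) vs))"
        by (rule join_chain_cong[OF p]) (use even[OF k True] join_simplex_rotv[OF p] in blast)
      also have "\<dots> = u (Suc k) (Suc i) - u (Suc k) i"
        by (simp only: join_chain_diff map_rotv_funpow_Suc u_def)
      finally show ?thesis unfolding tw twist_def using True
        by (simp only: map_rotv_funpow_Suc u_def if_True)
    qed
    have "u (Suc k) i - u k i = u (Suc k) 0 - u k 0" for i
    proof (induction i)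
      case (Suc i) then show ?case using step[of i] by linarith
    qed simp
    then have "(\<Sum>i<p. u (Suc k) i) - (\<Sum>i<p. u k i) = int p * (u (Suc k) 0 - u k 0)"
      by (subst sum_subtractf[symmetric], subst sum.cong[OF refl, of _ _ "\<lambda>_. u (Suc k) 0 - u k 0"]) auto
    then show ?thesis by simp
  next
    case False
    have "join_chain p (Suc k) (cobd (H k))
        = join_chain p (Suc k) (\<lambda>vs. \<Sum>i<p. H (Suc k) (map (rotv p ^^ i) vs))"
      by (rule join_chain_cong[OF p]) (use odd[OF k False] in blast)
    also have "\<dots> = (\<Sum>i<p. u (Suc k) i)" by (simp only: join_chain_sum[OF finite_lessThan] u_def)
    finally have "(\<Sum>i<p. u (Suc k) i) = (\<Sum>i<p. u k i)"
      unfolding join_chain_cobd[OF p] twist_def using False by (simp add: u_def del: join_chain.simps)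
    then show ?thesis by simp
  qed
  then show ?case using Suc.IH k dvd_add[of "int p" "(\<Sum>i<p. u (Suc k) i) - (\<Sum>i<p. u k i)"]
    unfolding u_def by (fastforce simp del: join_chain.simps)
qed

section \<open>Cochains on label lists\<close>

text \<open>The mean of \<open>T\<close> in the field with \<open>p\<close> elements. A rotation
  adds \<open>card T\<close> to the sum modulo \<open>p\<close>, hence 1 to the mean, whenever
  \<open>card T\<close> is invertible.\<close>

definition center :: "nat \<Rightarrow> nat set \<Rightarrow> nat" where
  "center p T = ((SOME z. [card T * z = 1] (mod p)) * \<Sum>T) mod p"

definition proper_nonempty :: "nat \<Rightarrow> nat set \<Rightarrow> bool" where
  "proper_nonempty p T \<longleftrightarrow> T \<noteq> {} \<and> T \<subset> {..<p}"

lemma center_rot: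
  assumes p: "prime p" and T: "proper_nonempty p T"
  shows "center p (rot p ` T) = rot p (center p T)"
proof -
  have p0: "p > 0" using p prime_gt_0_nat by blast
  have sub: "T \<subseteq> {..<p}" and fin: "finite T" and ne: "T \<noteq> {}"
    using T by (auto simp: proper_nonempty_def intro: finite_subset)
  have inj: "inj_on (rot p) T" using inj_on_rot[OF p0] sub by (rule inj_on_subset)
  have cT: "card (rot p ` T) = card T" by (rule card_image[OF inj])
  have "card T < p" using T psubset_card_mono[of "{..<p}" T] by (simp add: proper_nonempty_def)
  moreover have "card T > 0" using fin ne by (simp add: card_gt_0_iff)
  ultimately have cop: "coprime (card T) p"
    using p by (metis coprime_commute nat_dvd_not_less prime_imp_coprime)
  define z where "z = (SOME z. [card T * z = 1] (mod p))"
  have z: "[card T * z = 1] (mod p)"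
    unfolding z_def by (rule someI_ex) (use cong_solve_coprime_nat[OF cop] in simp)
  have "[\<Sum>(rot p ` T) = (\<Sum>s\<in>T. Suc s)] (mod p)"
    unfolding sum.reindex[OF inj] o_def by (rule cong_sum) (simp add: rot_def cong_def)
  also have "(\<Sum>s\<in>T. Suc s) = \<Sum>T + card T"
    by (subst Suc_eq_plus1, subst sum.distrib) simp
  finally have "[z * \<Sum>(rot p ` T) = z * (\<Sum>T + card T)] (mod p)" by (rule cong_scalar_left)
  also have "z * (\<Sum>T + card T) = z * \<Sum>T + card T * z" by (simp add: algebra_simps)
  also have "[\<dots> = z * \<Sum>T + 1] (mod p)" using z by (intro cong_add cong_refl)
  finally show ?thesis
    unfolding center_def rot_def cT z_def[symmetric] by (simp add: cong_def mod_Suc_eq)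
qed

lemma center_less: "p > 0 \<Longrightarrow> center p T < p"
  by (simp add: center_def)

text \<open>The mean need not belong to \<open>T\<close>. The first element of \<open>T\<close> met
  when rotating on from it does, and this choice still commutes with the rotation.\<close>

definition equiv_elem :: "nat \<Rightarrow> nat set \<Rightarrow> nat" where
  "equiv_elem p T = (rot p ^^ (LEAST i. (rot p ^^ i) (center p T) \<in> T)) (center p T)"

lemma equiv_elem:
  assumes p: "prime p" and T: "proper_nonempty p T"
  shows "equiv_elem p T \<in> T" "equiv_elem p (rot p ` T) = rot p (equiv_elem p T)"
proof -
  have p0: "p > 0" using p prime_gt_0_nat by blast
  have sub: "T \<subseteq> {..<p}" using T by (auto simp: proper_nonempty_def)
  obtain s where s: "s \<in> T" using T by (auto simp: proper_nonempty_def)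
  let ?c = "center p T"
  have c: "?c < p" by (rule center_less[OF p0])
  have "(rot p ^^ (p - ?c + s)) ?c = s"
    using s sub c by (auto simp: rot_funpow_eq[OF p0 c])
  then have ex: "(rot p ^^ (p - ?c + s)) ?c \<in> T" using s by simp
  then show "equiv_elem p T \<in> T" unfolding equiv_elem_def by (rule LeastI)
  have mem: "rot p x \<in> rot p ` T \<longleftrightarrow> x \<in> T" if "x < p" for x
    using inj_on_image_mem_iff[OF inj_on_rot[OF p0], of x T] that sub by auto
  have "(rot p ^^ i) (rot p ?c) \<in> rot p ` T \<longleftrightarrow> (rot p ^^ i) ?c \<in> T" for i
    using mem[of "(rot p ^^ i) ?c"] p0 by (simp add: rot_funpow_eq[OF p0 c] funpow_swap1[symmetric])
  then show "equiv_elem p (rot p ` T) = rot p (equiv_elem p T)"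
    unfolding equiv_elem_def center_rot[OF p T] by (simp add: funpow_swap1)
qed

lemma add_mod_eq_0_iff:
  fixes c i p :: nat
  assumes "c < p" "i < p"
  shows "(c + i) mod p = 0 \<longleftrightarrow> i = (p - c) mod p"
proof (cases "c = 0")
  case False
  have "(c + i) mod p = 0 \<longleftrightarrow> c + i = p" using assms False
    by (cases "c + i < p") (auto simp: mod_if)
  then show ?thesis using False assms by auto
qed (use assms in auto)

section \<open>The free complex of admissible label sets\<close>

definition column :: "(nat \<times> nat) set \<Rightarrow> nat \<Rightarrow> nat set" where
  "column S j = {s. (j, s) \<in> S}"

text \<open>The simplices of the \<open>M\<close>-fold join of the boundary of a (p - 1)-simplex: no
  measure shows all its labels. For prime \<open>p\<close> the rotation acts freely on this complex,
  which has dimension \<open>M * (p - 1) - 1\<close>.\<close>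

definition valid_labels :: "nat \<Rightarrow> nat \<Rightarrow> (nat \<times> nat) set \<Rightarrow> bool" where
  "valid_labels p M S \<longleftrightarrow> S \<subseteq> {..<M} \<times> {..<p} \<and> (\<forall>j<M. \<not> {..<p} \<subseteq> column S j)"

text \<open>An equivariant map to \<int>/p. Every orbit of nonempty valid sets contains exactly one
  set of color 0, so equations between cochains can be solved orbit by orbit.\<close>

definition color :: "nat \<Rightarrow> (nat \<times> nat) set \<Rightarrow> nat" where
  "color p S = center p (column S (LEAST j. column S j \<noteq> {}))"

lemma column_rotv: "column (rotv p ` S) j = rot p ` column S j"
  by (force simp: column_def rotv_def image_iff)

lemma valid_labels_subset: "valid_labels p M S \<Longrightarrow> S' \<subseteq> S \<Longrightarrow> valid_labels p M S'"
  unfolding valid_labels_def column_def by blast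

lemma valid_labels_rotv:
  assumes p: "p > 0" and "valid_labels p M S"
  shows "valid_labels p M (rotv p ` S)"
  unfolding valid_labels_def
proof (intro conjI allI impI)
  show "rotv p ` S \<subseteq> {..<M} \<times> {..<p}"
    using assms by (force simp: valid_labels_def rotv_def)
  fix j assume j: "j < M"
  have sub: "column S j \<subseteq> {..<p}" using assms(2) by (auto simp: valid_labels_def column_def)
  then have "column S j \<subset> {..<p}" using assms(2) j by (auto simp: valid_labels_def)
  then have "card (column S j) < p" using psubset_card_mono[of "{..<p}"] by simp
  moreover have "card (rot p ` column S j) \<le> card (column S j)"
    by (rule card_image_le) (use sub finite_subset in blast)
  ultimately have "card (rot p ` column S j) < p" by simp
  then show "\<not> {..<p} \<subseteq> column (rotv p ` S) j"
    unfolding column_rotv using card_mono[of "rot p ` column S j" "{..<p}"] finite_subset[OF sub] by fastforce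
qed

lemma color_rotv:
  assumes p: "prime p" and "valid_labels p M S" "S \<noteq> {}"
  shows "color p (rotv p ` S) = rot p (color p S)"
proof -
  let ?j = "LEAST j. column S j \<noteq> {}"
  have "\<exists>j. column S j \<noteq> {}" using assms(3) by (auto simp: column_def)
  then have ne: "column S ?j \<noteq> {}" by (rule LeastI_ex)
  then have "?j < M" using assms(2) by (auto simp: valid_labels_def column_def)
  then have "proper_nonempty p (column S ?j)"
    using assms(2) ne unfolding proper_nonempty_def valid_labels_def by (auto simp: column_def)
  moreover have "(LEAST j. column (rotv p ` S) j \<noteq> {}) = ?j" by (simp add: column_rotv)
  ultimately show ?thesis unfolding color_def column_rotv by (simp add: column_rotv center_rot[OF p])
qed

lemma card_valid_labels:
  assumes "valid_labels p M S"
  shows "card S \<le> M * (p - 1)"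
proof -
  have S: "S = (\<Union>j<M. {j} \<times> column S j)"
    using assms by (auto simp: valid_labels_def column_def)
  have c: "card (column S j) \<le> p - 1" if "j < M" for j
  proof -
    have "column S j \<subset> {..<p}" using assms that by (auto simp: valid_labels_def column_def)
    then have "card (column S j) < p" using psubset_card_mono[of "{..<p}"] by simp
    then show ?thesis by simp
  qed
  have "card S \<le> (\<Sum>j<M. card ({j} \<times> column S j))"
    by (subst S) (rule card_UN_le, simp)
  also have "\<dots> \<le> (\<Sum>j<M. p - 1)"
    by (rule sum_mono) (use c in \<open>simp add: card_cartesian_product\<close>)
  finally show ?thesis by simp
qed

text \<open>Write \<open>b\<close> for the coboundary of the previous cochain. For even
  \<open>k\<close> the equation to solve is \<open>h (\<rho> l) - h l = b l\<close>, where
  \<open>b\<close> has norm 0: put \<open>h = 0\<close> at color 0 and add up \<open>b\<close> along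
  the orbit, from the rotation of \<open>l\<close> with color 0 (reached by \<open>p - color\<close>
  steps) up to the one just before \<open>l\<close>. For odd \<open>k\<close> the norm of
  \<open>h\<close> has to be the invariant cochain \<open>b\<close>, which is achieved by
  concentrating \<open>b\<close> at color 0.\<close>

primrec label_cochain :: "nat \<Rightarrow> nat \<Rightarrow> (nat \<times> nat) list \<Rightarrow> int" where
  "label_cochain p 0 l = (if length l = 1 \<and> color p (set l) = 0 then 1 else 0)"
| "label_cochain p (Suc k) l =
    (if even k then \<Sum>j<color p (set l). cobd (label_cochain p k) (map (rotv p ^^ (p - color p (set l) + j)) l)
     else if color p (set l) = 0 then cobd (label_cochain p k) l else 0)"

lemma alternating_label_cochain: "alternating (label_cochain p k)"
proof (induction k)
  case 0
  show ?case by (auto simp: alternating_def)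
next
  case (Suc k)
  let ?b = "cobd (label_cochain p k)"
  have "alternating ?b" by (rule alternating_cobd[OF Suc])
  then have swap: "?b (us @ a # b # vs) = - ?b (us @ b # a # vs)" and zero: "?b (us @ a # a # vs) = 0" for us a b vs
    unfolding alternating_def by blast+
  have mswap: "?b (map f us @ f a # f b # map f vs) = - ?b (map f us @ f b # f a # map f vs)" for f us a b vs
    by (rule swap)
  show ?case unfolding alternating_def
  proof (intro conjI allI)
    fix us :: "(nat \<times> nat) list" and a b vs
    have st: "set (us @ a # b # vs) = set (us @ b # a # vs)" by auto
    show "label_cochain p (Suc k) (us @ a # b # vs) = - label_cochain p (Suc k) (us @ b # a # vs)"
      unfolding label_cochain.simps(2) st using swap[of us a b vs]
      by (simp add: mswap[of _ us a b vs] sum_negf)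
    show "label_cochain p (Suc k) (us @ a # a # vs) = 0"
      by (simp add: zero)
  qed
qed

lemma label_cochain_eq_0:
  assumes "valid_labels p M (set l)" "length l > M * (p - 1)"
  shows "label_cochain p k l = 0"
proof -
  have "card (set l) < length l" using card_valid_labels[OF assms(1)] assms(2) by simp
  then have "\<not> distinct l" using distinct_card by fastforce
  then show ?thesis by (rule alternating_not_distinct[OF alternating_label_cochain])
qed

context
  fixes p M :: nat
  assumes p: "prime p"
begin

lemma valid_labels_rotv_funpow:
  "valid_labels p M (set l) \<Longrightarrow> valid_labels p M (set (map (rotv p ^^ i) l))"
proof (induction i)
  case (Suc i)
  have "set (map (rotv p ^^ Suc i) l) = rotv p ` set (map (rotv p ^^ i) l)" by auto
  then show ?case using Suc valid_labels_rotv[of p M] p prime_gt_0_nat by presburger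
qed simp

lemma color_rotv_funpow:
  assumes "valid_labels p M (set l)" "l \<noteq> []"
  shows "color p (set (map (rotv p ^^ i) l)) = (color p (set l) + i) mod p"
proof -
  have p0: "p > 0" using p prime_gt_0_nat by blast
  have "color p (set (map (rotv p ^^ i) l)) = (rot p ^^ i) (color p (set l))"
  proof (induction i)
    case (Suc i)
    have "set (map (rotv p ^^ Suc i) l) = rotv p ` set (map (rotv p ^^ i) l)" by auto
    then show ?case
      using color_rotv[OF p valid_labels_rotv_funpow[OF assms(1), of i]] assms(2) Suc by simp
  qed simp
  also have "\<dots> = (color p (set l) + i) mod p"
    by (rule rot_funpow_eq[OF p0]) (simp add: color_def center_less[OF p0])
  finally show ?thesis .
qed

lemma label_cochain_0:
  assumes "valid_labels p M (set l)" "length l = 1"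
  shows "(\<Sum>i<p. label_cochain p 0 (map (rotv p ^^ i) l)) = 1"
proof -
  have p0: "p > 0" using p prime_gt_0_nat by blast
  have lne: "l \<noteq> []" using assms(2) by auto
  let ?c = "color p (set l)"
  have c: "?c < p" by (simp add: color_def center_less[OF p0])
  have "label_cochain p 0 (map (rotv p ^^ i) l) = (if i = (p - ?c) mod p then 1 else 0)" if "i < p" for i
  proof -
    show ?thesis using color_rotv_funpow[OF assms(1) lne, of i] assms(2) add_mod_eq_0_iff[OF c that] by simp
  qed
  then have "(\<Sum>i<p. label_cochain p 0 (map (rotv p ^^ i) l)) = (\<Sum>i<p. if i = (p - ?c) mod p then 1 else 0)"
    by (intro sum.cong) auto
  then show ?thesis using p0 by simp
qed

text \<open>The two cases support each other: that the coboundary has norm 0 for even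
  \<open>k\<close>, and is invariant for odd \<open>k\<close>, follows from the formula one degree
  below and \<open>cobd_cobd\<close>.\<close>

lemma label_cochain_Suc:
  assumes "valid_labels p M (set l)" "length l = Suc (Suc k)"
  shows "even k \<Longrightarrow> cobd (label_cochain p k) l = label_cochain p (Suc k) (map (rotv p) l) - label_cochain p (Suc k) l"
    and "odd k \<Longrightarrow> cobd (label_cochain p k) l = (\<Sum>i<p. label_cochain p (Suc k) (map (rotv p ^^ i) l))"
  using assms
proof (induction k arbitrary: l rule: less_induct)
  case (less k)
  have p0: "p > 0" using p prime_gt_0_nat by blast
  let ?b = "cobd (label_cochain p k)"
  have sub: "valid_labels p M (set ys)" if "valid_labels p M (set l)" "subseq ys l" for ys l
    by (rule valid_labels_subset[OF that(1)]) (use that(2) in \<open>auto elim!: list_emb_set\<close>)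
  have E: "cobd (label_cochain p k) l = label_cochain p (Suc k) (map (rotv p) l) - label_cochain p (Suc k) l"
    if ev: "even k" and v: "valid_labels p M (set l)" and len: "length l = Suc (Suc k)" for l
  proof -
    have N: "(\<Sum>i<p. ?b (map (rotv p ^^ i) l)) = 0"
    proof -
      have "(\<Sum>i<p. ?b (map (rotv p ^^ i) l)) = cobd (\<lambda>ys. \<Sum>i<p. label_cochain p k (map (rotv p ^^ i) ys)) l"
        by (simp only: cobd_map cobd_sum)
      \<comment> \<open>In degree 0 the sum over the rotations is the constant 1, whose coboundary
        vanishes on lists of length 2.\<close>
      also have "\<dots> = 0"
      proof (cases "k = 0")
        case True
        show ?thesis
        proof (rule cobd_const[where c=1])
          fix ys assume "Suc (length ys) = length l" "subseq ys l"
          then show "(\<Sum>i<p. label_cochain p k (map (rotv p ^^ i) ys)) = 1"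
            unfolding True by (intro label_cochain_0 sub[OF v]) (auto simp: len True)
        qed (auto simp: len True)
      next
        case False
        then obtain k' where k': "k = Suc k'" by (cases k) auto
        have "cobd (\<lambda>ys. \<Sum>i<p. label_cochain p k (map (rotv p ^^ i) ys)) l = cobd (cobd (label_cochain p k')) l"
          unfolding k'
          by (rule cobd_cong, rule less.IH(2)[symmetric]) (use ev k' sub[OF v] len in auto)
        then show ?thesis by (simp only: cobd_cobd)
      qed
      finally show ?thesis .
    qed
    have lne: "l \<noteq> []" using len by auto
    let ?c = "color p (set l)"
    have c: "?c < p" by (simp add: color_def center_less[OF p0])
    have c': "color p (set (map (rotv p) l)) = Suc ?c mod p"
      using color_rotv_funpow[OF v lne, of 1] by simp
    have per: "map (rotv p ^^ p) l = l"
      by (rule map_rotv_period[OF p0]) (use v in \<open>auto simp: valid_labels_def\<close>)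
    \<comment> \<open>Unless the color wraps around, the sum for the rotated list has one more term,
      \<open>b\<close> after \<open>p\<close> rotations, which is \<open>b l\<close>. At the
      wrap-around the sum restarts at 0, and \<open>N\<close> identifies the lost terms with
      \<open>- b l\<close>.\<close>
    show ?thesis
    proof (cases "Suc ?c < p")
      case True
      have "label_cochain p (Suc k) (map (rotv p) l) = (\<Sum>j<Suc ?c. ?b (map (rotv p ^^ (p - Suc ?c + j)) (map (rotv p) l)))"
        unfolding label_cochain.simps(2) c' using ev True by simp
      also have "\<dots> = (\<Sum>j<Suc ?c. ?b (map (rotv p ^^ (p - ?c + j)) l))"
        using True by (intro sum.cong refl arg_cong[where f="?b"]) (simp only: map_rotv_funpow_Suc, simp add: Suc_diff_Suc flip: add_Suc)
      also have "\<dots> = label_cochain p (Suc k) l + ?b l"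
        using ev c per by simp
      finally show ?thesis by simp
    next
      case False
      then have cp: "Suc ?c = p" using c by simp
      then have pc: "p - ?c = 1" by simp
      have "label_cochain p (Suc k) (map (rotv p) l) = 0"
        unfolding label_cochain.simps(2) c' using ev cp by simp
      moreover have "label_cochain p (Suc k) l = (\<Sum>j<?c. ?b (map (rotv p ^^ Suc j) l))"
        unfolding label_cochain.simps(2) pc using ev by simp
      moreover have "(\<Sum>i<p. ?b (map (rotv p ^^ i) l)) = ?b l + (\<Sum>j<?c. ?b (map (rotv p ^^ Suc j) l))"
        using sum.lessThan_Suc_shift[of "\<lambda>i. ?b (map (rotv p ^^ i) l)" ?c] cp by simp
      ultimately show ?thesis using N by simp
    qed
  qed
  {
    case 1 then show ?case using E by blast
  next
    case 2
    then have k: "k > 0" "odd k" and v: "valid_labels p M (set l)" and len: "length l = Suc (Suc k)" by (auto intro: odd_pos)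
    then obtain k' where k': "k = Suc k'" by (cases k) auto
    have inv1: "?b (map (rotv p) l) = ?b l" if v: "valid_labels p M (set l)" and len: "length l = Suc (Suc k)" for l
    proof -
      have "?b (map (rotv p) l) - ?b l = cobd (\<lambda>ys. label_cochain p k (map (rotv p) ys) - label_cochain p k ys) l"
        by (simp only: cobd_map cobd_diff)
      also have "\<dots> = cobd (cobd (label_cochain p k')) l"
        unfolding k' by (rule cobd_cong, rule less.IH(1)[symmetric]) (use k k' sub[OF v] len in auto)
      finally show ?thesis by (simp add: cobd_cobd)
    qed
    have inv: "?b (map (rotv p ^^ i) l) = ?b l" for i
    proof (induction i)
      case (Suc i)
      have "?b (map (rotv p) (map (rotv p ^^ i) l)) = ?b (map (rotv p ^^ i) l)"
        by (rule inv1) (use valid_labels_rotv_funpow[OF v] len in auto)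
      then show ?case using Suc by (simp only: map_rotv_funpow_Suc)
    qed simp
    have lne: "l \<noteq> []" using len by auto
    let ?c = "color p (set l)"
    have c: "?c < p" by (simp add: color_def center_less[OF p0])
    have "label_cochain p (Suc k) (map (rotv p ^^ i) l) = (if i = (p - ?c) mod p then ?b l else 0)" if "i < p" for i
    proof -
      show ?thesis unfolding label_cochain.simps(2) color_rotv_funpow[OF v lne] inv add_mod_eq_0_iff[OF c that] using k by simp
    qed
    then have "(\<Sum>i<p. label_cochain p (Suc k) (map (rotv p ^^ i) l)) = (\<Sum>i<p. if i = (p - ?c) mod p then ?b l else 0)"
      by (intro sum.cong) auto
    then show ?case using p0 by (simp del: label_cochain.simps)
  }
qed

end

section \<open>Signed weights on linear orders\<close>

definition index_of :: "'v list \<Rightarrow> 'v \<Rightarrow> nat" where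
  "index_of w i = length (takeWhile (\<lambda>x. x \<noteq> i) w)"

text \<open>An integer for positions below \<open>p\<close>, because \<open>(p - 1) choose j\<close>
  is congruent to \<open>(-1) ^ j\<close>. In sums over the shuffles of two nonempty words of total
  length \<open>p\<close> the subtracted term cancels, so there the weight behaves like the constant
  \<open>1 / p\<close>.\<close>

definition order_weight :: "nat \<Rightarrow> 'v \<Rightarrow> 'v list \<Rightarrow> int" where
  "order_weight p i w = (1 - (-1) ^ index_of w i * int ((p - 1) choose index_of w i)) div int p"

text \<open>By Pascal's rule neighbouring entries of row \<open>p - 1\<close> add up to an inner
  entry of row \<open>p\<close>, a multiple of \<open>p\<close>.\<close>

lemma prime_dvd_signed_choose:
  assumes p: "prime p" and "j < p"
  shows "int p dvd 1 - (-1) ^ j * int ((p - 1) choose j)"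
  using assms(2)
proof (induction j)
  case (Suc j)
  have "p dvd p choose Suc j" using Suc.prems p by (intro dvd_choose_prime) auto
  moreover have "p choose Suc j = ((p - 1) choose j) + ((p - 1) choose Suc j)"
    using choose_reduce_nat[of p "Suc j"] Suc.prems by simp
  ultimately have "int p dvd int ((p - 1) choose j) + int ((p - 1) choose Suc j)"
    by (metis int_dvd_int_iff of_nat_add)
  then have "int p dvd (-1) ^ j * (int ((p - 1) choose j) + int ((p - 1) choose Suc j))" by (rule dvd_mult)
  moreover have "int p dvd 1 - (-1) ^ j * int ((p - 1) choose j)" using Suc by simp
  ultimately have "int p dvd (1 - (-1) ^ j * int ((p - 1) choose j)) + (-1) ^ j * (int ((p - 1) choose j) + int ((p - 1) choose Suc j))"
    by (rule dvd_add[rotated])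
  then show ?case by (simp add: algebra_simps)
qed simp

section \<open>Positions in shuffles\<close>

lemma index_of_Cons: "index_of (x # w) i = (if x = i then 0 else Suc (index_of w i))"
  by (simp add: index_of_def)

lemma index_of_less: "i \<in> set w \<Longrightarrow> index_of w i < length w"
  by (induction w) (auto simp: index_of_Cons)

lemma index_of_map: "inj_on f (insert i (set w)) \<Longrightarrow> index_of (map f w) (f i) = index_of w i"
  by (induction w) (auto simp: index_of_Cons index_of_def inj_on_def)

lemma finite_shuffles [simp]: "finite (shuffles xs ys)"
  by (induction xs ys rule: shuffles.induct) auto

lemma sum_shuffles_Cons:
  assumes "x \<noteq> y"
  shows "(\<Sum>w\<in>shuffles (x # xs) (y # ys). f w) =
     (\<Sum>w\<in>shuffles xs (y # ys). f (x # w)) + (\<Sum>w\<in>shuffles (x # xs) ys. (f (y # w) :: int))"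
proof -
  have "(\<Sum>w\<in>shuffles (x # xs) (y # ys). f w) = (\<Sum>w\<in>(#) x ` shuffles xs (y # ys). f w) + (\<Sum>w\<in>(#) y ` shuffles (x # xs) ys. f w)"
    unfolding shuffles.simps by (rule sum.union_disjoint) (use assms in auto)
  then show ?thesis by (simp add: sum.reindex)
qed

text \<open>The shuffles are counted by the number \<open>l\<close> of entries of \<open>ys\<close>
  before \<open>i\<close>: these are interleaved with \<open>us\<close> and the others with
  \<open>vs\<close>, independently. The induction splits off the first letter of the
  shuffle.\<close>

lemma sum_shuffles_index_of:
  assumes "i \<notin> set us" "i \<notin> set ys" "set (us @ i # vs) \<inter> set ys = {}"
  shows "(\<Sum>w\<in>shuffles (us @ i # vs) ys. F (index_of w i)) =
    (\<Sum>l\<le>length ys. int ((length us + l) choose l) * int ((length vs + length ys - l) choose length vs) * F (length us + l))"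
  using assms
proof (induction "length us + length ys" arbitrary: us ys F)
  case 0
  then show ?case by (simp add: index_of_Cons)
next
  case (Suc n)
  show ?case
  proof (cases ys)
    case Nil
    have "index_of (us @ i # vs) i = length us" using Suc.prems(1)
      by (induction us) (auto simp: index_of_Cons)
    then show ?thesis using Nil by simp
  next
    case (Cons y ys')
    have yi: "y \<noteq> i" using Suc.prems Cons by auto
    show ?thesis
    proof (cases us)
      case Nil
      have fst: "(\<Sum>w\<in>shuffles vs ys. F (index_of (i # w) i)) = int ((length vs + length ys) choose length vs) * F 0"
        using card_disjoint_shuffles[of vs ys] Suc.prems(3) by (simp add: index_of_Cons Int_Un_distrib2)
      have "(\<Sum>w\<in>shuffles ([] @ i # vs) ys'. (F \<circ> Suc) (index_of w i)) =
        (\<Sum>l\<le>length ys'. int ((length ([]::'a list) + l) choose l) * int ((length vs + length ys' - l) choose length vs) * (F \<circ> Suc) (length ([]::'a list) + l))"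
        by (rule Suc.hyps(1)) (use Suc.hyps(2) Suc.prems Nil Cons in auto)
      then have snd: "(\<Sum>w\<in>shuffles (i # vs) ys'. F (index_of (y # w) i)) =
          (\<Sum>l\<le>length ys'. int ((length vs + length ys' - l) choose length vs) * F (Suc l))"
        using yi by (simp add: index_of_Cons)
      have "(\<Sum>w\<in>shuffles (us @ i # vs) ys. F (index_of w i)) =
         int ((length vs + length ys) choose length vs) * F 0 + (\<Sum>l\<le>length ys'. int ((length vs + length ys' - l) choose length vs) * F (Suc l))"
        unfolding Nil Cons append_Nil sum_shuffles_Cons[OF yi[symmetric]] snd using fst unfolding Cons by simp
      also have "\<dots> = (\<Sum>l\<le>length ys. int ((length vs + length ys - l) choose length vs) * F l)"
        unfolding Cons by (simp add: sum.atMost_Suc_shift del: sum.atMost_Suc)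
      finally show ?thesis unfolding Nil by simp
    next
      case (Cons u us')
      note us = this
      have ui: "u \<noteq> i" "u \<noteq> y" using Suc.prems us \<open>ys = y # ys'\<close> by auto
      let ?a = "length us'" and ?m = "length vs" and ?n = "length ys'"
      have A: "(\<Sum>w\<in>shuffles (us' @ i # vs) ys. (F \<circ> Suc) (index_of w i)) =
        (\<Sum>l\<le>Suc ?n. int ((?a + l) choose l) * int ((?m + Suc ?n - l) choose ?m) * (F \<circ> Suc) (?a + l))"
        using Suc.hyps(1)[of us' ys "F \<circ> Suc"] Suc.hyps(2) Suc.prems us \<open>ys = y # ys'\<close> by simp
      have B: "(\<Sum>w\<in>shuffles (us @ i # vs) ys'. (F \<circ> Suc) (index_of w i)) =
        (\<Sum>l\<le>?n. int ((Suc ?a + l) choose l) * int ((?m + ?n - l) choose ?m) * (F \<circ> Suc) (Suc ?a + l))"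
        using Suc.hyps(1)[of us ys' "F \<circ> Suc"] Suc.hyps(2) Suc.prems us \<open>ys = y # ys'\<close> by auto
      have "(\<Sum>w\<in>shuffles (us @ i # vs) ys. F (index_of w i)) =
        (\<Sum>w\<in>shuffles (us' @ i # vs) ys. (F \<circ> Suc) (index_of w i)) + (\<Sum>w\<in>shuffles (us @ i # vs) ys'. (F \<circ> Suc) (index_of w i))"
        unfolding us \<open>ys = y # ys'\<close> append_Cons sum_shuffles_Cons[OF ui(2)] using ui yi by (simp add: index_of_Cons)
      also have "\<dots> = (\<Sum>l\<le>Suc ?n. int ((Suc ?a + l) choose l) * int ((?m + Suc ?n - l) choose ?m) * F (Suc ?a + l))"
        unfolding A B sum.atMost_Suc_shift[of _ ?n]
        by (simp add: sum.distrib[symmetric] algebra_simps)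
      finally show ?thesis unfolding us \<open>ys = y # ys'\<close> by simp
    qed
  qed
qed

text \<open>Multiplied by the binomial coefficient of the position, the count of the shuffles
  becomes a constant times \<open>length ys choose l\<close>. What remains is an alternating row sum
  of Pascal's triangle, zero because \<open>ys\<close> is not empty.\<close>

lemma sum_shuffles_signed_choose:
  assumes "i \<in> set xs" "distinct xs" "set xs \<inter> set ys = {}" "ys \<noteq> []" "length xs + length ys = p"
  shows "(\<Sum>w\<in>shuffles xs ys. (-1) ^ index_of w i * int ((p - 1) choose index_of w i)) = 0"
proof -
  obtain us vs where xs: "xs = us @ i # vs" using assms(1) by (meson split_list)
  let ?a = "length us" and ?m = "length vs" and ?n = "length ys"
  have p1: "p - 1 = ?a + ?m + ?n" using assms(5) xs by simp
  let ?C = "((p - 1) choose ?m) * ((?a + ?n) choose ?a)"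
  have c: "((?a + l) choose l) * ((?m + ?n - l) choose ?m) * ((p - 1) choose (?a + l)) = ?C * (?n choose l)" if "l \<le> ?n" for l
  proof -
    have f1: "fact l * fact ?a * ((?a + l) choose l) = (fact (?a + l) :: nat)"
      using binomial_fact_lemma[of l "?a + l"] by simp
    have f2: "fact ?m * fact (?n - l) * ((?m + ?n - l) choose ?m) = (fact (?m + ?n - l) :: nat)"
      using binomial_fact_lemma[of ?m "?m + ?n - l"] that by simp
    have f3: "fact (?a + l) * fact (?m + ?n - l) * ((p - 1) choose (?a + l)) = (fact (p - 1) :: nat)"
    proof -
      have "p - 1 - (?a + l) = ?m + ?n - l" using p1 by simp
      moreover have "?a + l \<le> p - 1" using p1 that by simp
      ultimately show ?thesis using binomial_fact_lemma[of "?a + l" "p - 1"] by metis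
    qed
    have f4: "fact ?m * fact (?a + ?n) * ((p - 1) choose ?m) = (fact (p - 1) :: nat)"
    proof -
      have "p - 1 - ?m = ?a + ?n" "?m \<le> p - 1" using p1 by simp_all
      then show ?thesis using binomial_fact_lemma[of ?m "p - 1"] by metis
    qed
    have f5: "fact ?a * fact ?n * ((?a + ?n) choose ?a) = (fact (?a + ?n) :: nat)"
      using binomial_fact_lemma[of ?a "?a + ?n"] by simp
    have f6: "fact l * fact (?n - l) * (?n choose l) = (fact ?n :: nat)"
      using binomial_fact_lemma[OF that] by simp
    \<comment> \<open>Compared as multinomial coefficients: multiplied by \<open>?P\<close>, both
      sides are \<open>fact (p - 1)\<close>.\<close>
    let ?P = "fact l * fact ?a * fact ?m * fact (?n - l) :: nat"
    have "?P * (((?a + l) choose l) * ((?m + ?n - l) choose ?m) * ((p - 1) choose (?a + l))) = fact (p - 1)"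
      unfolding f3[symmetric] f1[symmetric] f2[symmetric] by (simp add: algebra_simps)
    moreover have "?P * (?C * (?n choose l)) = fact (p - 1)"
      unfolding f4[symmetric] f5[symmetric] f6[symmetric] by (simp add: algebra_simps)
    moreover have "?P > 0" by simp
    ultimately show ?thesis by (metis mult_left_cancel less_numeral_extra(3))
  qed
  have "(\<Sum>w\<in>shuffles xs ys. (-1) ^ index_of w i * int ((p - 1) choose index_of w i)) =
    (\<Sum>l\<le>?n. int ((?a + l) choose l) * int ((?m + ?n - l) choose ?m) * ((-1) ^ (?a + l) * int ((p - 1) choose (?a + l))))"
    unfolding xs by (rule sum_shuffles_index_of[where F="\<lambda>j. (-1) ^ j * int ((p - 1) choose j)"])
      (use assms xs in auto)
  also have "\<dots> = (\<Sum>l\<le>?n. (-1) ^ ?a * int ?C * ((-1) ^ l * int (?n choose l)))"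
  proof (rule sum.cong[OF refl])
    fix l assume "l \<in> {..?n}"
    then have "int (((?a + l) choose l) * ((?m + ?n - l) choose ?m) * ((p - 1) choose (?a + l))) = int (?C * (?n choose l))"
      using c by simp
    then show "int ((?a + l) choose l) * int ((?m + ?n - l) choose ?m) * ((-1) ^ (?a + l) * int ((p - 1) choose (?a + l)))
      = (-1) ^ ?a * int ?C * ((-1) ^ l * int (?n choose l))"
      by (simp add: power_add algebra_simps)
  qed
  also have "\<dots> = (-1) ^ ?a * int ?C * (\<Sum>l\<le>?n. (-1) ^ l * int (?n choose l))"
    by (simp add: sum_distrib_left)
  also have "(\<Sum>l\<le>?n. (-1) ^ l * int (?n choose l)) = 0"
    using choose_alternating_sum[of ?n, where 'a=int] assms(4) by simp
  finally show ?thesis by simp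
qed

lemma sum_shuffles_order_weight:
  assumes p: "prime p" and "i \<in> set xs \<union> set ys" "distinct xs" "distinct ys" "set xs \<inter> set ys = {}"
    "xs \<noteq> []" "ys \<noteq> []" "length xs + length ys = p"
  shows "int p * (\<Sum>w\<in>shuffles xs ys. order_weight p i w) = int (p choose length xs)"
proof -
  have z: "(\<Sum>w\<in>shuffles xs ys. (-1) ^ index_of w i * int ((p - 1) choose index_of w i)) = 0"
  proof (cases "i \<in> set xs")
    case True
    then show ?thesis using assms by (intro sum_shuffles_signed_choose) auto
  next
    case False
    then show ?thesis using assms
      by (subst shuffles_commutes, intro sum_shuffles_signed_choose) (auto simp: add.commute)
  qed
  have "int p * order_weight p i w = 1 - (-1) ^ index_of w i * int ((p - 1) choose index_of w i)" if "w \<in> shuffles xs ys" for w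
  proof -
    have "index_of w i < p"
      using index_of_less[of i w] set_shuffles[OF that] length_shuffles[OF that] assms by simp
    then show ?thesis unfolding order_weight_def using prime_dvd_signed_choose[OF p] by simp
  qed
  then have "int p * (\<Sum>w\<in>shuffles xs ys. order_weight p i w) = (\<Sum>w\<in>shuffles xs ys. 1 - (-1) ^ index_of w i * int ((p - 1) choose index_of w i))"
    by (simp add: sum_distrib_left)
  also have "\<dots> = int (card (shuffles xs ys))" using z by (simp add: sum_subtractf)
  also have "card (shuffles xs ys) = p choose length xs"
    using card_disjoint_shuffles[OF assms(5)] assms(8) by simp
  finally show ?thesis .
qed

section \<open>Orders of the labels and their restrictions to two groups\<close>

definition orders :: "nat \<Rightarrow> nat list set" where
  "orders p = permutations_of_set {..<p}"

lemma finite_orders [simp]: "finite (orders p)"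
  by (simp add: orders_def)

lemma ordersD: "w \<in> orders p \<Longrightarrow> set w = {..<p}" "w \<in> orders p \<Longrightarrow> distinct w" "w \<in> orders p \<Longrightarrow> length w = p"
  using distinct_card[of w] by (auto simp: orders_def permutations_of_set_def)

text \<open>A normal form for the pair of restrictions of \<open>w\<close> to \<open>A\<close> and
  to its complement. Two orders have the same normal form if and only if both restrictions agree, so
  the fibers are sets of shuffles.\<close>

definition unshuffle :: "nat set \<Rightarrow> nat list \<Rightarrow> nat list" where
  "unshuffle A w = filter (\<lambda>s. s \<in> A) w @ filter (\<lambda>s. s \<notin> A) w"

lemma filter_unshuffle:
  "filter (\<lambda>s. s \<in> A) (unshuffle A w) = filter (\<lambda>s. s \<in> A) w"
  "filter (\<lambda>s. s \<notin> A) (unshuffle A w) = filter (\<lambda>s. s \<notin> A) w"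
  by (auto simp: unshuffle_def cong: filter_cong)

lemma sum_order_weight_fiber:
  assumes p: "prime p" and A: "A \<subseteq> {..<p}" "A \<noteq> {}" "A \<noteq> {..<p}" and i: "i < p" and v: "v \<in> unshuffle A ` orders p"
  shows "int p * (\<Sum>w\<in>{w \<in> orders p. unshuffle A w = v}. order_weight p i w) = int (p choose card A)"
proof -
  let ?xs = "filter (\<lambda>s. s \<in> A) v" and ?ys = "filter (\<lambda>s. s \<notin> A) v"
  obtain u where u: "u \<in> orders p" "v = unshuffle A u" using v by blast
  have v': "?xs = filter (\<lambda>s. s \<in> A) u" "?ys = filter (\<lambda>s. s \<notin> A) u" using u filter_unshuffle by auto
  have sx: "set ?xs = A" "set ?ys = {..<p} - A" "distinct ?xs" "distinct ?ys"
    unfolding v' using ordersD[OF u(1)] A by auto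
  have len: "length ?xs + length ?ys = p"
    unfolding v' using ordersD(3)[OF u(1)] sum_length_filter_compl[of "\<lambda>s. s \<in> A" u] by simp
  have cA: "length ?xs = card A" using sx distinct_card by metis
  have "{w \<in> orders p. unshuffle A w = v} = shuffles ?xs ?ys"
  proof (intro equalityI subsetI)
    fix w assume w: "w \<in> {w \<in> orders p. unshuffle A w = v}"
    then have "filter (\<lambda>s. s \<in> A) w = ?xs" "filter (\<lambda>s. s \<notin> A) w = ?ys" using filter_unshuffle by auto
    then show "w \<in> shuffles ?xs ?ys" using partition_in_shuffles[of w "\<lambda>s. s \<in> A"] by simp
  next
    fix w assume w: "w \<in> shuffles ?xs ?ys"
    have d: "distinct w" using distinct_disjoint_shuffles[OF sx(3,4) _ w] sx by auto
    have s: "set w = {..<p}" using set_shuffles[OF w] sx A by auto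
    have dis: "set ?xs \<inter> set ?ys = {}" by auto
    have "filter (\<lambda>s. s \<in> set ?xs) w = ?xs" "filter (\<lambda>s. s \<notin> set ?xs) w = ?ys"
      by (rule filter_shuffles_disjoint1[OF dis w])+
    then have "unshuffle A w = ?xs @ ?ys" unfolding unshuffle_def sx(1) by (rule arg_cong2)
    also have "\<dots> = v" unfolding v' using u by (simp add: unshuffle_def)
    finally show "w \<in> {w \<in> orders p. unshuffle A w = v}"
      using d s by (simp add: orders_def permutations_of_set_def)
  qed
  moreover have "int p * (\<Sum>w\<in>shuffles ?xs ?ys. order_weight p i w) = int (p choose length ?xs)"
  proof (rule sum_shuffles_order_weight[OF p])
    show "?xs \<noteq> []" using sx A by (metis set_empty)
    show "?ys \<noteq> []" using sx A by (metis Diff_eq_empty_iff set_empty subset_antisym)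
    show "i \<in> set ?xs \<union> set ?ys" unfolding sx using i by blast
    show "set ?xs \<inter> set ?ys = {}" unfolding sx by blast
  qed (use sx len in auto)
  ultimately show ?thesis using cA by simp
qed

lemma sum_order_weight_unshuffle:
  assumes p: "prime p" and A: "A \<subseteq> {..<p}" "A \<noteq> {}" "A \<noteq> {..<p}" and i: "i < p"
    and F: "\<And>w. w \<in> orders p \<Longrightarrow> F w = F (unshuffle A w)"
  shows "int p * (\<Sum>w\<in>orders p. order_weight p i w * F w) =
    int (p choose card A) * (\<Sum>v\<in>unshuffle A ` orders p. F v)"
proof -
  have "(\<Sum>w\<in>orders p. order_weight p i w * F w) =
    (\<Sum>v\<in>unshuffle A ` orders p. \<Sum>w\<in>{w \<in> orders p. unshuffle A w = v}. order_weight p i w * F w)"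
    by (rule sum.image_gen) simp
  also have "\<dots> = (\<Sum>v\<in>unshuffle A ` orders p. F v * (\<Sum>w\<in>{w \<in> orders p. unshuffle A w = v}. order_weight p i w))"
    unfolding sum_distrib_left by (intro sum.cong refl) (use F in auto)
  finally have "int p * (\<Sum>w\<in>orders p. order_weight p i w * F w) =
     (\<Sum>v\<in>unshuffle A ` orders p. F v * (int p * (\<Sum>w\<in>{w \<in> orders p. unshuffle A w = v}. order_weight p i w)))"
    by (simp add: sum_distrib_left mult_ac)
  also have "\<dots> = (\<Sum>v\<in>unshuffle A ` orders p. F v * int (p choose card A))"
    by (intro sum.cong refl) (simp add: sum_order_weight_fiber[OF p A i])
  finally show ?thesis by (simp add: sum_distrib_left sum_distrib_right mult_ac)
qed

text \<open>The cone label disappears: times \<open>p\<close>, either side is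
  \<open>p choose card A\<close> times the unweighted sum over the normal forms.\<close>

lemma sum_order_weight_indep:
  assumes "prime p" "A \<subseteq> {..<p}" "A \<noteq> {}" "A \<noteq> {..<p}" "i < p" "i' < p"
    and "\<And>w. w \<in> orders p \<Longrightarrow> F w = F (unshuffle A w)"
  shows "(\<Sum>w\<in>orders p. order_weight p i w * F w) = (\<Sum>w\<in>orders p. order_weight p i' w * F w)"
proof -
  have "int p * (\<Sum>w\<in>orders p. order_weight p i w * F w) = int p * (\<Sum>w\<in>orders p. order_weight p i' w * F w)"
    by (simp only: sum_order_weight_unshuffle[where F=F, OF assms(1-4,5,7)] sum_order_weight_unshuffle[where F=F, OF assms(1-4,6,7)])
  then show ?thesis using prime_gt_0_nat[OF assms(1)] by simp
qed

text \<open>The fiber count for the constant 1 and \<open>A = {0}\<close>: \<open>p choose 1\<close>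
  cancels the factor \<open>p\<close>, and the normal forms are the orders that begin with
  0.\<close>

lemma sum_order_weight:
  assumes p: "prime p" and i: "i < p"
  shows "(\<Sum>w\<in>orders p. order_weight p i w) = fact (p - 1)"
proof -
  have p1: "p > 1" using p prime_gt_1_nat by blast
  have img: "unshuffle {0} ` orders p = (#) 0 ` permutations_of_set ({..<p} - {0})"
  proof (intro equalityI subsetI)
    fix v assume "v \<in> unshuffle {0} ` orders p"
    then obtain w where w: "w \<in> orders p" "v = unshuffle {0} w" by blast
    have "filter (\<lambda>s. s \<in> {0}) w = [0]"
    proof -
      let ?F = "filter (\<lambda>s. s \<in> {0}) w"
      have d: "distinct ?F" using ordersD(2)[OF w(1)] by simp
      have "0 \<in> set w" using ordersD(1)[OF w(1)] p1 by simp
      then have st: "set ?F = {0}" by auto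
      have "length ?F = card (set ?F)" by (rule distinct_card[OF d, symmetric])
      then have "length ?F = Suc 0" unfolding st by simp
      then obtain a where a: "?F = [a]" by (cases ?F) auto
      from st have "a = 0" unfolding a by simp
      with a show ?thesis by simp
    qed
    then have "v = 0 # filter (\<lambda>s. s \<notin> {0}) w" using w by (simp add: unshuffle_def)
    moreover have "filter (\<lambda>s. s \<notin> {0}) w \<in> permutations_of_set ({..<p} - {0})"
      using ordersD[OF w(1)] by (auto simp: permutations_of_set_def)
    ultimately show "v \<in> (#) 0 ` permutations_of_set ({..<p} - {0})" by blast
  next
    fix v assume "v \<in> (#) 0 ` permutations_of_set ({..<p} - {0})"
    then obtain w where w: "w \<in> permutations_of_set ({..<p} - {0})" "v = 0 # w" by blast
    have sw: "set w = {..<p} - {0}" and dw: "distinct w" using w(1) unfolding permutations_of_set_def by blast+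
    have "set v = {..<p}" unfolding w(2) list.set(2) sw by (rule insert_Diff) (use p1 in simp)
    moreover have "distinct v" unfolding w(2) using sw dw by simp
    ultimately have "v \<in> orders p" unfolding orders_def permutations_of_set_def by blast
    moreover have "unshuffle {0} v = v"
    proof -
      have "filter (\<lambda>s. s \<in> {0}) w = []" "filter (\<lambda>s. s \<notin> {0}) w = w"
        by (rule filter_False filter_True, simp add: sw)+
      then show ?thesis unfolding unshuffle_def w(2) by simp
    qed
    ultimately show "v \<in> unshuffle {0} ` orders p" by (metis imageI)
  qed
  have "card (unshuffle {0} ` orders p) = fact (p - 1)"
    unfolding img using p1 by (simp add: card_image)
  moreover have "int p * (\<Sum>w\<in>orders p. order_weight p i w * 1) = int (p choose card {0::nat}) * (\<Sum>v\<in>unshuffle {0} ` orders p. 1)"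
    by (rule sum_order_weight_unshuffle[OF p]) (use p1 i in auto)
  ultimately have "int p * (\<Sum>w\<in>orders p. order_weight p i w) = int p * fact (p - 1)" by simp
  then show ?thesis using p1 by simp
qed

section \<open>Equivariant labellings\<close>

lemma subdiv_iterate_diff:
  "(subdiv ^^ m) (\<lambda>ys. f ys - g ys) = (\<lambda>xs. (subdiv ^^ m) f xs - (subdiv ^^ m) g xs)"
proof (induction m)
  case (Suc m)
  show ?case by (rule ext) (simp add: Suc subdiv_diff)
qed simp

lemma subdiv_iterate_sum:
  "(subdiv ^^ m) (\<lambda>ys. \<Sum>i\<in>I. f i ys) = (\<lambda>xs. \<Sum>i\<in>I. (subdiv ^^ m) (f i) xs)"
proof (induction m)
  case (Suc m)
  show ?case by (rule ext) (simp add: Suc subdiv_sum)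
qed simp

lemma subdiv_iterate_zero: "(subdiv ^^ m) (\<lambda>ys. 0) xs = 0"
  using fun_cong[OF subdiv_iterate_diff[of m "\<lambda>_. 0" "\<lambda>_. 0"], of xs] by simp

lemma subdiv_iterate_const_singleton: "(subdiv ^^ m) (\<lambda>ys. c) [x] = c"
proof (induction m arbitrary: x)
  case (Suc m)
  then show ?case by (simp add: subdiv_def[of "(subdiv ^^ m) (\<lambda>ys. c)"])
qed simp

lemma mesh_le_mono: "mesh_le D xs \<Longrightarrow> D \<le> D' \<Longrightarrow> mesh_le D' xs"
  unfolding mesh_le_def by (meson order.trans)

section \<open>Weights and tuples of orders\<close>

definition simplex_points :: "nat \<Rightarrow> (nat \<Rightarrow> real) set" where
  "simplex_points T = {x. (\<forall>q. 0 \<le> x q) \<and> (\<forall>q\<ge>T. x q = 0) \<and> (\<Sum>q<T. x q) = 1}"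

definition unit_point :: "nat \<Rightarrow> nat \<Rightarrow> real" where
  "unit_point q = (\<lambda>q'. if q' = q then 1 else 0)"

lemma unit_point_simplex: "q < T \<Longrightarrow> unit_point q \<in> simplex_points T"
  by (auto simp: unit_point_def simplex_points_def)

lemma barycenter_closed_simplex: "barycenter_closed {x \<in> simplex_points T. \<forall>q\<in>Z. x q = 0}"
  unfolding barycenter_closed_def
proof (intro allI impI)
  fix xs :: "(nat \<Rightarrow> real) list"
  assume ne: "xs \<noteq> []" and sub: "set xs \<subseteq> {x \<in> simplex_points T. \<forall>q\<in>Z. x q = 0}"
  have len: "real (length xs) > 0" using ne by simp
  have zero: "barycenter xs q = 0" if "\<And>x. x \<in> set xs \<Longrightarrow> x q = 0" for q
  proof -
    have "(\<Sum>x\<leftarrow>xs. x q) = (\<Sum>x\<leftarrow>xs. 0)" using that by (intro arg_cong[where f=sum_list] map_cong) auto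
    then show ?thesis by (simp add: barycenter_def)
  qed
  have "0 \<le> barycenter xs q" for q
    unfolding barycenter_def using sub by (intro divide_nonneg_nonneg sum_list_nonneg) (auto simp: simplex_points_def)
  moreover have "(\<Sum>q<T. barycenter xs q) = 1"
  proof -
    have "(\<Sum>q<T. \<Sum>x\<leftarrow>xs. x q) = (\<Sum>x\<leftarrow>xs. \<Sum>q<T. x q)"
      by (induction xs) (auto simp: sum.distrib)
    also have "\<dots> = (\<Sum>x\<leftarrow>xs. 1)"
      using sub by (intro arg_cong[where f=sum_list] map_cong) (auto simp: simplex_points_def)
    finally show ?thesis using len by (simp add: barycenter_def sum_list_triv flip: sum_divide_distrib)
  qed
  ultimately show "barycenter xs \<in> {x \<in> simplex_points T. \<forall>q\<in>Z. x q = 0}"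
    unfolding simplex_points_def using zero sub by (fastforce simp: simplex_points_def subset_iff)
qed

definition rot_orders :: "nat \<Rightarrow> nat \<Rightarrow> (nat \<Rightarrow> nat list) \<Rightarrow> nat \<Rightarrow> nat list" where
  "rot_orders p t W = (\<lambda>k\<in>{..<t}. map (rot p) (W k))"

abbreviation order_tuples :: "nat \<Rightarrow> nat \<Rightarrow> (nat \<Rightarrow> nat list) set" where
  "order_tuples p t \<equiv> {..<t} \<rightarrow>\<^sub>E orders p"

lemma map_rot_orders: "p > 0 \<Longrightarrow> w \<in> orders p \<Longrightarrow> map (rot p) w \<in> orders p"
  using bij_betw_rot[of p] by (auto simp: orders_def permutations_of_set_def distinct_map bij_betw_def)

lemma bij_betw_rot_orders:
  assumes p: "p > 0"
  shows "bij_betw (rot_orders p t) (order_tuples p t) (order_tuples p t)"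
proof -
  have sub: "rot_orders p t ` order_tuples p t \<subseteq> order_tuples p t"
    using map_rot_orders[OF p] by (auto simp: rot_orders_def PiE_iff)
  have "inj_on (rot_orders p t) (order_tuples p t)"
  proof (rule inj_onI)
    fix V W assume V: "V \<in> order_tuples p t" and W: "W \<in> order_tuples p t" and eq: "rot_orders p t V = rot_orders p t W"
    have "V k = W k" if k: "k < t" for k
    proof -
      have o: "V k \<in> orders p" "W k \<in> orders p" using V W k by auto
      have "map (rot p) (V k) = map (rot p) (W k)" using fun_cong[OF eq, of k] k by (simp add: rot_orders_def)
      moreover have "inj_on (rot p) (set (V k) \<union> set (W k))" using inj_on_rot[OF p] ordersD(1)[OF o(1)] ordersD(1)[OF o(2)] by simp
      ultimately show ?thesis by (simp add: inj_on_map_eq_map)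
    qed
    then show "V = W" using V W by (intro PiE_ext) auto
  qed
  moreover have "finite (order_tuples p t)" by (intro finite_PiE) auto
  ultimately show ?thesis using sub by (simp add: bij_betw_def endo_inj_surj)
qed

lemma sum_order_tuples:
  "(\<Sum>W\<in>order_tuples p t. \<Prod>k<t. f k (W k)) = (\<Prod>k<t. \<Sum>w\<in>orders p. (f k w :: int))"
  by (rule prod_sum_PiE[symmetric]) auto

text \<open>All that the algebra has to know about the measures. Labels \<open>g\<close> and weights
  \<open>x\<close> form a point of the \<open>T\<close>-fold join, and \<open>W\<close> holds one
  order for each block. \<open>Lab_unshuffle\<close> expresses the separation of the sites where a
  cone weight vanishes. One set \<open>A\<close> has to serve all points of a small list, because a
  cochain is evaluated on their labels jointly.\<close>

locale equivariant_labelling =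
  fixes p t T M :: nat and cone :: "nat \<Rightarrow> nat"
    and Lab :: "(nat \<Rightarrow> nat) \<Rightarrow> (nat \<Rightarrow> nat list) \<Rightarrow> (nat \<Rightarrow> real) \<Rightarrow> nat \<times> nat" and D :: real
  assumes prime: "prime p" and cone: "\<And>k. k < t \<Longrightarrow> cone k < T" and dim: "M * (p - 1) < T" and D: "D > 0"
    and Lab_rot: "\<And>g W x. (\<And>q. g q < p) \<Longrightarrow> W \<in> order_tuples p t \<Longrightarrow> x \<in> simplex_points T \<Longrightarrow>
        Lab (rot p \<circ> g) (rot_orders p t W) x = rotv p (Lab g W x)"
    and Lab_local: "\<And>g g' W x. (\<And>q. q < T \<Longrightarrow> x q \<noteq> 0 \<Longrightarrow> g q = g' q) \<Longrightarrow> x \<in> simplex_points T \<Longrightarrow>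
        Lab g W x = Lab g' W x"
    and Lab_valid: "\<And>g W xs. (\<And>q. g q < p) \<Longrightarrow> W \<in> order_tuples p t \<Longrightarrow> set xs \<subseteq> simplex_points T \<Longrightarrow>
        mesh_le D xs \<Longrightarrow> valid_labels p M (Lab g W ` set xs)"
    and Lab_unshuffle: "\<And>g k xs. (\<And>q. g q < p) \<Longrightarrow> k < t \<Longrightarrow> set xs \<subseteq> simplex_points T \<Longrightarrow> mesh_le D xs \<Longrightarrow>
        (\<And>x. x \<in> set xs \<Longrightarrow> x (cone k) = 0) \<Longrightarrow>
        \<exists>A\<subseteq>{..<p}. A \<noteq> {} \<and> A \<noteq> {..<p} \<and> (\<forall>W\<in>order_tuples p t. \<forall>x\<in>set xs.
           Lab g W x = Lab g (W(k := unshuffle A (W k))) x)"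
begin

section \<open>Pulling cochains back along a labelling\<close>

lemma p0: "p > 0" using prime prime_gt_0_nat by blast

text \<open>All tuples of orders are used at once, with the product of the weights as coefficient.
  The coefficients involve \<open>g (cone k)\<close> even at points where the cone vertex has weight
  0, so being a function on the join is not automatic; see \<open>pull_local\<close>.\<close>

definition pull :: "((nat \<times> nat) list \<Rightarrow> int) \<Rightarrow> (nat \<Rightarrow> nat) \<Rightarrow> (nat \<Rightarrow> real) list \<Rightarrow> int" where
  "pull \<alpha> g xs = (\<Sum>W\<in>order_tuples p t. (\<Prod>k<t. order_weight p (g (cone k)) (W k)) * \<alpha> (map (Lab g W) xs))"

lemma cobd_pull: "cobd (pull \<alpha> g) xs = pull (cobd \<alpha>) g xs"
  unfolding pull_def by (simp add: cobd_sum cobd_cmult cobd_map)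

text \<open>Renaming the labels in an order changes no positions, so the coefficients are invariant
  under a simultaneous rotation of \<open>g\<close> and \<open>W\<close>. Reindexing the sum over
  \<open>W\<close> then gives equivariance.\<close>

lemma pull_rot:
  assumes g: "\<And>q. g q < p" and xs: "set xs \<subseteq> simplex_points T"
  shows "pull \<alpha> (rot p \<circ> g) xs = pull (\<lambda>l. \<alpha> (map (rotv p) l)) g xs"
proof -
  have "pull \<alpha> (rot p \<circ> g) xs = (\<Sum>W\<in>order_tuples p t. (\<Prod>k<t. order_weight p (rot p (g (cone k))) (rot_orders p t W k)) *
     \<alpha> (map (Lab (rot p \<circ> g) (rot_orders p t W)) xs))"
    unfolding pull_def by (subst sum.reindex_bij_betw[OF bij_betw_rot_orders[OF p0], symmetric]) simp
  also have "\<dots> = pull (\<lambda>l. \<alpha> (map (rotv p) l)) g xs"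
    unfolding pull_def
  proof (intro sum.cong refl arg_cong2[where f="(*)"] prod.cong)
    fix W assume W: "W \<in> order_tuples p t"
    show "\<alpha> (map (Lab (rot p \<circ> g) (rot_orders p t W)) xs) = \<alpha> (map (rotv p) (map (Lab g W) xs))"
    proof -
      have "Lab (rot p \<circ> g) (rot_orders p t W) x = rotv p (Lab g W x)" if "x \<in> set xs" for x
        by (rule Lab_rot[OF g W]) (use that xs in blast)
      then show ?thesis by (intro arg_cong[where f=\<alpha>]) (simp add: o_def)
    qed
    fix k assume k: "k \<in> {..<t}"
    have "W k \<in> orders p" using W k by auto
    then have "index_of (map (rot p) (W k)) (rot p (g (cone k))) = index_of (W k) (g (cone k))"
      using g[of "cone k"] inj_on_rot[OF p0] ordersD(1)[of "W k" p] by (intro index_of_map) (simp add: insert_absorb)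
    then show "order_weight p (rot p (g (cone k))) (rot_orders p t W k) = order_weight p (g (cone k)) (W k)"
      using k by (simp add: rot_orders_def order_weight_def)
  qed
  finally show ?thesis .
qed

lemma pull_rot_funpow:
  assumes g: "\<And>q. g q < p" and xs: "set xs \<subseteq> simplex_points T"
  shows "pull \<alpha> ((rot p ^^ i) \<circ> g) xs = pull (\<lambda>l. \<alpha> (map (rotv p ^^ i) l)) g xs"
proof (induction i arbitrary: \<alpha>)
  case (Suc i)
  have "pull \<alpha> ((rot p ^^ Suc i) \<circ> g) xs = pull \<alpha> (rot p \<circ> ((rot p ^^ i) \<circ> g)) xs" by (simp add: comp_assoc)
  also have "\<dots> = pull (\<lambda>l. \<alpha> (map (rotv p) l)) ((rot p ^^ i) \<circ> g) xs"
    by (rule pull_rot[OF _ xs]) (simp add: rot_funpow_eq[OF p0 g] p0)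
  also have "\<dots> = pull (\<lambda>l. \<alpha> (map (rotv p) (map (rotv p ^^ i) l))) g xs" by (rule Suc.IH)
  finally show ?case by (simp only: map_rotv_funpow_Suc)
qed simp

text \<open>With the orders of the other blocks fixed, the label list depends on the order of block
  \<open>k\<close> only through its restrictions to \<open>A\<close> and the complement, so
  \<open>sum_order_weight_indep\<close> applies to the inner sum.\<close>

lemma sum_cone_weight_indep:
  assumes g: "\<And>q. g q < p" and k: "k < t" and xs: "set xs \<subseteq> simplex_points T" "mesh_le D xs"
    and zero: "\<And>x. x \<in> set xs \<Longrightarrow> x (cone k) = 0"
    and c: "c k < p" "i < p"
  shows "(\<Sum>W\<in>order_tuples p t. (\<Prod>l<t. order_weight p (c l) (W l)) * \<alpha> (map (Lab g W) xs)) =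
    (\<Sum>W\<in>order_tuples p t. (\<Prod>l<t. order_weight p ((c(k := i)) l) (W l)) * \<alpha> (map (Lab g W) xs))"
proof -
  let ?L = "\<lambda>W. \<alpha> (map (Lab g W) xs)" and ?wt = "order_weight p"
  obtain A where A: "A \<subseteq> {..<p}" "A \<noteq> {}" "A \<noteq> {..<p}"
    and AL: "\<And>W x. W \<in> order_tuples p t \<Longrightarrow> x \<in> set xs \<Longrightarrow> Lab g W x = Lab g (W(k := unshuffle A (W k))) x"
  proof -
    have "\<exists>A\<subseteq>{..<p}. A \<noteq> {} \<and> A \<noteq> {..<p} \<and> (\<forall>W\<in>order_tuples p t. \<forall>x\<in>set xs.
           Lab g W x = Lab g (W(k := unshuffle A (W k))) x)"
      by (rule Lab_unshuffle[OF g k xs]) (rule zero)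
    then show thesis using that by metis
  qed
  let ?J = "{..<t} - {k}"
  have ins: "{..<t} = insert k ?J" using k by auto
  have split: "(\<Sum>W\<in>order_tuples p t. (\<Prod>l<t. ?wt (e l) (W l)) * ?L W) =
     (\<Sum>f\<in>?J \<rightarrow>\<^sub>E orders p. (\<Prod>l\<in>?J. ?wt (e l) (f l)) * (\<Sum>w\<in>orders p. ?wt (e k) w * ?L (f(k := w))))"
    for e :: "nat \<Rightarrow> nat"
  proof -
    have "(\<Sum>W\<in>order_tuples p t. (\<Prod>l<t. ?wt (e l) (W l)) * ?L W) =
      (\<Sum>W\<in>(\<lambda>(w, f). f(k := w)) ` (orders p \<times> (?J \<rightarrow>\<^sub>E orders p)). (\<Prod>l<t. ?wt (e l) (W l)) * ?L W)"
      by (subst (1) ins, subst PiE_insert_eq) simp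
    also have "\<dots> = (\<Sum>(w, f)\<in>orders p \<times> (?J \<rightarrow>\<^sub>E orders p). (\<Prod>l<t. ?wt (e l) ((f(k := w)) l)) * ?L (f(k := w)))"
      by (subst sum.reindex) (use inj_combinator[of k ?J "\<lambda>_. orders p"] in \<open>auto simp: case_prod_beta\<close>)
    also have "\<dots> = (\<Sum>f\<in>?J \<rightarrow>\<^sub>E orders p. \<Sum>w\<in>orders p. (\<Prod>l<t. ?wt (e l) ((f(k := w)) l)) * ?L (f(k := w)))"
      by (subst sum.cartesian_product[symmetric], rule sum.swap)
    also have "\<dots> = (\<Sum>f\<in>?J \<rightarrow>\<^sub>E orders p. (\<Prod>l\<in>?J. ?wt (e l) (f l)) * (\<Sum>w\<in>orders p. ?wt (e k) w * ?L (f(k := w))))"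
    proof (intro sum.cong refl)
      fix f
      have "(\<Prod>l<t. ?wt (e l) ((f(k := w)) l)) = ?wt (e k) w * (\<Prod>l\<in>?J. ?wt (e l) (f l))" for w
      proof -
        have "(\<Prod>l<t. ?wt (e l) ((f(k := w)) l)) = ?wt (e k) w * (\<Prod>l\<in>?J. ?wt (e l) ((f(k := w)) l))"
          using prod.remove[of "{..<t}" k "\<lambda>l. ?wt (e l) ((f(k := w)) l)"] k by simp
        also have "(\<Prod>l\<in>?J. ?wt (e l) ((f(k := w)) l)) = (\<Prod>l\<in>?J. ?wt (e l) (f l))"
          by (rule prod.cong) auto
        finally show ?thesis .
      qed
      then show "(\<Sum>w\<in>orders p. (\<Prod>l<t. ?wt (e l) ((f(k := w)) l)) * ?L (f(k := w))) =
        (\<Prod>l\<in>?J. ?wt (e l) (f l)) * (\<Sum>w\<in>orders p. ?wt (e k) w * ?L (f(k := w)))"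
        by (simp add: sum_distrib_left mult_ac)
    qed
    finally show ?thesis .
  qed
  show ?thesis unfolding split
  proof (rule sum.cong[OF refl], rule arg_cong2[where f="(*)"])
    fix f assume f: "f \<in> ?J \<rightarrow>\<^sub>E orders p"
    have "(\<Sum>w\<in>orders p. ?wt (c k) w * ?L (f(k := w))) =
      (\<Sum>w\<in>orders p. ?wt i w * ?L (f(k := w)))"
    proof (rule sum_order_weight_indep[where F="\<lambda>w. ?L (f(k := w))", OF prime A c])
      fix w assume w: "w \<in> orders p"
      have "f(k := w) \<in> order_tuples p t" using f w k by (auto simp: PiE_iff extensional_def)
      from AL[OF this] show "?L (f(k := w)) = ?L (f(k := unshuffle A w))"
        by (intro arg_cong[where f=\<alpha>] map_cong) auto
    qed
    then show "(\<Sum>w\<in>orders p. ?wt (c k) w * ?L (f(k := w))) =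
      (\<Sum>w\<in>orders p. ?wt ((c(k := i)) k) w * ?L (f(k := w)))" by simp
  qed (rule prod.cong; auto)
qed

text \<open>Well-definedness on the join, where the label of a vertex of weight 0 carries no
  information. \<open>Lab\<close> is local by assumption; in the coefficients the cone labels are
  exchanged one block at a time.\<close>

lemma pull_local:
  assumes g: "\<And>q. g q < p" "\<And>q. g' q < p" and xs: "set xs \<subseteq> simplex_points T" "mesh_le D xs"
    and loc: "\<And>q x. q < T \<Longrightarrow> x \<in> set xs \<Longrightarrow> x q \<noteq> 0 \<Longrightarrow> g q = g' q"
  shows "pull \<alpha> g xs = pull \<alpha> g' xs"
proof -
  have L: "map (Lab g W) xs = map (Lab g' W) xs" for W
    using Lab_local loc xs(1) by (intro map_cong) blast+
  define c where "c m l = (if l < m then g' (cone l) else g (cone l))" for m l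
  define S where "S e = (\<Sum>W\<in>order_tuples p t. (\<Prod>l<t. order_weight p (e l) (W l)) * \<alpha> (map (Lab g W) xs))" for e
  have "S (c m) = S (c 0)" if "m \<le> t" for m
    using that
  proof (induction m)
    case (Suc m)
    have cm: "c (Suc m) = (c m)(m := g' (cone m))" by (auto simp: c_def less_Suc_eq)
    have "S (c m) = S ((c m)(m := g' (cone m)))"
    proof (cases "g (cone m) = g' (cone m)")
      case True
      then have "(c m)(m := g' (cone m)) = c m" by (auto simp: c_def)
      then show ?thesis by simp
    next
      case False
      \<comment> \<open>By \<open>loc\<close>, a cone vertex whose labels differ has weight 0
        throughout \<open>xs\<close>.\<close>
      show ?thesis unfolding S_def
      proof (rule sum_cone_weight_indep[OF g(1) _ xs])
        show "m < t" using Suc.prems by simp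
        then show "x (cone m) = 0" if "x \<in> set xs" for x using loc[OF cone that] False by blast
      qed (use g in \<open>auto simp: c_def\<close>)
    qed
    then show ?case unfolding cm using Suc.IH Suc.prems by (simp del: fun_upd_apply)
  qed simp
  from this[OF order.refl] have "S (c t) = S (c 0)" .
  moreover have "S (c t) = pull \<alpha> g' xs" "S (c 0) = pull \<alpha> g xs"
    unfolding S_def pull_def L[symmetric] by (auto simp: c_def intro!: sum.cong arg_cong2[where f="(*)"] prod.cong)
  ultimately show ?thesis by simp
qed

text \<open>Extends the labels of a simplex to all vertices. The default 0 is one of many possible
  extensions, which \<open>join_cochain_eq\<close> compares.\<close>

definition labels_of :: "(nat \<times> nat) list \<Rightarrow> nat \<Rightarrow> nat" where
  "labels_of vs q = (case map_of vs q of None \<Rightarrow> 0 | Some s \<Rightarrow> s)"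

lemma labels_of_less: "(\<And>v. v \<in> set vs \<Longrightarrow> snd v < p) \<Longrightarrow> labels_of vs q < p"
  by (auto simp: labels_of_def p0 split: option.splits dest!: map_of_SomeD)

lemma labels_of_mem: "distinct (map fst vs) \<Longrightarrow> v \<in> set vs \<Longrightarrow> labels_of vs (fst v) = snd v"
  by (cases v) (auto simp: labels_of_def)

text \<open>The contraction of the mesh by one subdivision of lists of length at most
  \<open>M * (p - 1) + 1\<close>, the longest that occur.\<close>

abbreviation shrink :: real where
  "shrink \<equiv> (real (M * (p - 1) + 1) - 1) / real (M * (p - 1) + 1)"

definition depth :: nat where
  "depth = (SOME m. shrink ^ m \<le> D)"

lemma depth: "shrink ^ depth \<le> D"
proof -
  have "shrink < 1" by (subst divide_less_eq_1_pos) (auto intro: add_pos_nonneg)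
  then have "\<exists>m. shrink ^ m < D"
    by (rule real_arch_pow_inv[OF D])
  then have "\<exists>m. shrink ^ m \<le> D" using less_imp_le by blast
  then show ?thesis unfolding depth_def by (rule someI_ex)
qed

definition unit_points :: "(nat \<times> nat) list \<Rightarrow> (nat \<Rightarrow> real) list" where
  "unit_points vs = map (\<lambda>v. unit_point (fst v)) vs"

lemma subdiv_depth_cong:
  assumes "length vs \<le> M * (p - 1) + 1" "\<And>v. v \<in> set vs \<Longrightarrow> fst v < T"
    and eq: "\<And>xs. length xs = length vs \<Longrightarrow> set xs \<subseteq> simplex_points T \<Longrightarrow>
      (\<And>x q. x \<in> set xs \<Longrightarrow> x q \<noteq> 0 \<Longrightarrow> q \<in> fst ` set vs) \<Longrightarrow> mesh_le D xs \<Longrightarrow> f xs = h xs"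
  shows "(subdiv ^^ depth) f (unit_points vs) = (subdiv ^^ depth) h (unit_points vs)"
\<comment> \<open>\<open>C\<close> is the face spanned by \<open>vs\<close>; being closed under
  barycenters it contains all subdivided lists.\<close>
proof (rule subdiv_iterate_cong[where K="M * (p - 1) + 1" and D=1 and C="{x \<in> simplex_points T. \<forall>q\<in>- fst ` set vs. x q = 0}", OF barycenter_closed_simplex])
  show "set (unit_points vs) \<subseteq> {x \<in> simplex_points T. \<forall>q\<in>- fst ` set vs. x q = 0}"
  proof
    fix x assume "x \<in> set (unit_points vs)"
    then obtain v where v: "v \<in> set vs" "x = unit_point (fst v)" by (auto simp: unit_points_def)
    then show "x \<in> {x \<in> simplex_points T. \<forall>q\<in>- fst ` set vs. x q = 0}"
      using unit_point_simplex[OF assms(2)[OF v(1)]] by (auto simp: unit_point_def)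
  qed
  show "mesh_le 1 (unit_points vs)" by (auto simp: mesh_le_def unit_points_def unit_point_def)
  fix ys assume ys: "length ys = length (unit_points vs)" "set ys \<subseteq> {x \<in> simplex_points T. \<forall>q\<in>- fst ` set vs. x q = 0}"
    "mesh_le (shrink ^ depth * 1) ys"
  show "f ys = h ys"
  proof (rule eq)
    show "mesh_le D ys" by (rule mesh_le_mono[OF ys(3)]) (use depth in simp)
  qed (use ys in \<open>auto simp: unit_points_def\<close>)
qed (use assms(1) in \<open>auto simp: unit_points_def\<close>)

text \<open>The properties of \<open>pull\<close> hold on lists of mesh at most \<open>D\<close>, so
  a simplex of the join is first subdivided often enough.\<close>

definition join_cochain :: "nat \<Rightarrow> (nat \<times> nat) list \<Rightarrow> int" where
  "join_cochain k vs = (subdiv ^^ depth) (pull (label_cochain p k) (labels_of vs)) (unit_points vs)"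

lemma join_simplexD:
  assumes "join_simplex p k vs"
  shows "length vs = Suc k" "distinct (map fst vs)" "\<And>v. v \<in> set vs \<Longrightarrow> fst v \<le> k" "\<And>v. v \<in> set vs \<Longrightarrow> snd v < p"
proof -
  have m: "map fst vs = [0..<Suc k]" using assms by (simp add: join_simplex_def)
  show "length vs = Suc k" using arg_cong[OF m, of length] by simp
  show "distinct (map fst vs)" unfolding m by simp
  show "fst v \<le> k" if "v \<in> set vs" for v
  proof -
    have "fst v \<in> set (map fst vs)" using that by simp
    then show ?thesis unfolding m by auto
  qed
  show "snd v < p" if "v \<in> set vs" for v using assms that by (simp add: join_simplex_def)
qed

lemma join_cochain_eq:
  assumes vs: "length vs \<le> M * (p - 1) + 1" "distinct (map fst vs)" "\<And>v. v \<in> set vs \<Longrightarrow> fst v \<le> M * (p - 1)"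
      "\<And>v. v \<in> set vs \<Longrightarrow> snd v < p"
    and g: "\<And>q. g q < p" "\<And>v. v \<in> set vs \<Longrightarrow> g (fst v) = snd v"
  shows "join_cochain k vs = (subdiv ^^ depth) (pull (label_cochain p k) g) (unit_points vs)"
  unfolding join_cochain_def
proof (rule subdiv_depth_cong[OF vs(1)])
  show "fst v < T" if "v \<in> set vs" for v using vs(3)[OF that] dim by simp
  fix xs assume xs: "set xs \<subseteq> simplex_points T" "\<And>x q. x \<in> set xs \<Longrightarrow> x q \<noteq> 0 \<Longrightarrow> q \<in> fst ` set vs" "mesh_le D xs"
  show "pull (label_cochain p k) (labels_of vs) xs = pull (label_cochain p k) g xs"
  proof (rule pull_local[OF _ g(1) xs(1,3)])
    show "labels_of vs q < p" for q by (rule labels_of_less[OF vs(4)])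
    fix q x assume "x \<in> set xs" "x q \<noteq> 0"
    then obtain v where v: "v \<in> set vs" "q = fst v" using xs(2) by blast
    then show "labels_of vs q = g q" using g(2) labels_of_mem[OF vs(2)] by simp
  qed
qed

lemma join_cochain_rot:
  assumes "join_simplex p k vs" "k \<le> M * (p - 1)"
  shows "join_cochain k (map (rotv p ^^ i) vs) =
    (subdiv ^^ depth) (pull (\<lambda>l. label_cochain p k (map (rotv p ^^ i) l)) (labels_of vs)) (unit_points vs)"
proof -
  note v = join_simplexD[OF assms(1)]
  note v' = join_simplexD[OF join_simplex_rotv(2)[OF p0 assms(1), of i]]
  have lp: "labels_of vs q < p" for q by (rule labels_of_less[OF v(4)])
  have "join_cochain k (map (rotv p ^^ i) vs) =
     (subdiv ^^ depth) (pull (label_cochain p k) ((rot p ^^ i) \<circ> labels_of vs)) (unit_points (map (rotv p ^^ i) vs))"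
  proof (rule join_cochain_eq)
    show "((rot p ^^ i) \<circ> labels_of vs) q < p" for q using lp[of q] by (simp add: rot_funpow_eq[OF p0 lp] p0)
    show "((rot p ^^ i) \<circ> labels_of vs) (fst v) = snd v" if "v \<in> set (map (rotv p ^^ i) vs)" for v
      using that labels_of_mem[OF v(2)] by (auto simp: rotv_funpow)
    show "fst v \<le> M * (p - 1)" if "v \<in> set (map (rotv p ^^ i) vs)" for v
      using v'(3)[OF that] assms(2) by simp
    show "length (map (rotv p ^^ i) vs) \<le> M * (p - 1) + 1" using v'(1) assms(2) by simp
  qed (use v' in auto)
  also have "unit_points (map (rotv p ^^ i) vs) = unit_points vs" by (simp add: unit_points_def)
  also have "(subdiv ^^ depth) (pull (label_cochain p k) ((rot p ^^ i) \<circ> labels_of vs)) (unit_points vs) =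
    (subdiv ^^ depth) (pull (\<lambda>l. label_cochain p k (map (rotv p ^^ i) l)) (labels_of vs)) (unit_points vs)"
  proof (rule subdiv_depth_cong)
    show "length vs \<le> M * (p - 1) + 1" using v(1) assms(2) by simp
    show "fst v < T" if "v \<in> set vs" for v using v(3)[OF that] assms(2) dim by simp
  qed (use pull_rot_funpow[OF lp] in auto)
  finally show ?thesis .
qed

lemma cobd_join_cochain:
  assumes vs: "join_simplex p (Suc k) vs" and k: "k < M * (p - 1)"
  shows "cobd (join_cochain k) vs = (subdiv ^^ depth) (pull (cobd (label_cochain p k)) (labels_of vs)) (unit_points vs)"
proof -
  note v = join_simplexD[OF vs]
  let ?g = "labels_of vs"
  have lp: "?g q < p" for q by (rule labels_of_less[OF v(4)])
  \<comment> \<open>All faces are rewritten with the labels of the whole simplex; only then is the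
    alternating sum the coboundary of a single cochain.\<close>
  have "cobd (join_cochain k) vs = cobd (\<lambda>ys. (subdiv ^^ depth) (pull (label_cochain p k) ?g) (unit_points ys)) vs"
  proof (rule cobd_cong)
    fix ys assume ys: "Suc (length ys) = length vs" "subseq ys vs"
    have sub: "set ys \<subseteq> set vs" using ys(2) by (auto elim!: list_emb_set)
    show "join_cochain k ys = (subdiv ^^ depth) (pull (label_cochain p k) ?g) (unit_points ys)"
    proof (rule join_cochain_eq[OF _ _ _ _ lp])
      show "length ys \<le> M * (p - 1) + 1" using ys v(1) k by simp
      have "subseq (map fst ys) (map fst vs)" using ys(2) by (rule subseq_map)
      then show "distinct (map fst ys)" using v(2) by (metis subseq_conv_nths distinct_nthsI)
      show "fst v \<le> M * (p - 1)" if "v \<in> set ys" for v using v(3)[of v] that sub k by fastforce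
      show "snd v < p" if "v \<in> set ys" for v using v(4) that sub by blast
      show "?g (fst v) = snd v" if "v \<in> set ys" for v using labels_of_mem[OF v(2)] that sub by blast
    qed
  qed
  also have "\<dots> = cobd ((subdiv ^^ depth) (pull (label_cochain p k) ?g)) (unit_points vs)"
    unfolding unit_points_def cobd_map ..
  also have "\<dots> = (subdiv ^^ depth) (cobd (pull (label_cochain p k) ?g)) (unit_points vs)"
    by (rule subdiv_iterate_cobd[symmetric]) (use v(1) in \<open>auto simp: unit_points_def\<close>)
  also have "cobd (pull (label_cochain p k) ?g) = pull (cobd (label_cochain p k)) ?g"
    by (rule ext) (rule cobd_pull)
  finally show ?thesis .
qed

text \<open>\<open>join_cochain\<close> satisfies the relations of
  \<open>join_chain_pairing_mod\<close> up to degree \<open>M * (p - 1)\<close>, where it vanishes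
  because valid labels cannot be distinct on so long a list. The assumption \<open>dim\<close>
  provides the vertices for a chain of this degree.\<close>

theorem contradiction: False
proof -
  let ?n = "M * (p - 1)" and ?lc = "label_cochain p" and ?S = "subdiv ^^ depth"
  have lab: "valid_labels p M (set (map (Lab g W) xs))"
    if "\<And>q. g q < p" "W \<in> order_tuples p t" "set xs \<subseteq> simplex_points T" "mesh_le D xs" for g W xs
    using Lab_valid[where g=g, OF that] by simp
  have even: "cobd (join_cochain k) vs = join_cochain (Suc k) (map (rotv p) vs) - join_cochain (Suc k) vs"
    if "k < ?n" "even k" "join_simplex p (Suc k) vs" for k vs
  proof -
    note v = join_simplexD[OF that(3)]
    let ?g = "labels_of vs"
    have lp: "?g q < p" for q by (rule labels_of_less[OF v(4)])
    have "?S (pull (cobd (?lc k)) ?g) (unit_points vs) =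
      ?S (\<lambda>xs. pull (\<lambda>l. ?lc (Suc k) (map (rotv p ^^ 1) l)) ?g xs - pull (?lc (Suc k)) ?g xs) (unit_points vs)"
    proof (rule subdiv_depth_cong)
      show "length vs \<le> ?n + 1" using v(1) that(1) by simp
      show "fst v < T" if "v \<in> set vs" for v using v(3)[OF that] dim \<open>k < ?n\<close> by simp
      fix xs assume xs: "length xs = length vs" "set xs \<subseteq> simplex_points T" "mesh_le D xs"
      have "cobd (?lc k) (map (Lab ?g W) xs) =
        ?lc (Suc k) (map (rotv p) (map (Lab ?g W) xs)) - ?lc (Suc k) (map (Lab ?g W) xs)"
        if "W \<in> order_tuples p t" for W
        by (rule label_cochain_Suc(1)[OF prime lab[OF lp that xs(2,3)]]) (use xs v(1) \<open>even k\<close> in auto)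
      then show "pull (cobd (?lc k)) ?g xs =
        pull (\<lambda>l. ?lc (Suc k) (map (rotv p ^^ 1) l)) ?g xs - pull (?lc (Suc k)) ?g xs"
        unfolding pull_def by (simp add: right_diff_distrib sum_subtractf del: label_cochain.simps map_map)
    qed
    then show ?thesis
      unfolding cobd_join_cochain[OF that(3,1)] using join_cochain_rot[OF that(3), of 1] that(1)
      by (simp add: subdiv_iterate_diff join_cochain_def del: label_cochain.simps)
  qed
  have odd: "cobd (join_cochain k) vs = (\<Sum>i<p. join_cochain (Suc k) (map (rotv p ^^ i) vs))"
    if "k < ?n" "odd k" "join_simplex p (Suc k) vs" for k vs
  proof -
    note v = join_simplexD[OF that(3)]
    let ?g = "labels_of vs"
    have lp: "?g q < p" for q by (rule labels_of_less[OF v(4)])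
    have "?S (pull (cobd (?lc k)) ?g) (unit_points vs) =
      ?S (\<lambda>xs. \<Sum>i<p. pull (\<lambda>l. ?lc (Suc k) (map (rotv p ^^ i) l)) ?g xs) (unit_points vs)"
    proof (rule subdiv_depth_cong)
      show "length vs \<le> ?n + 1" using v(1) that(1) by simp
      show "fst v < T" if "v \<in> set vs" for v using v(3)[OF that] dim \<open>k < ?n\<close> by simp
      fix xs assume xs: "length xs = length vs" "set xs \<subseteq> simplex_points T" "mesh_le D xs"
      have "cobd (?lc k) (map (Lab ?g W) xs) =
        (\<Sum>i<p. ?lc (Suc k) (map (rotv p ^^ i) (map (Lab ?g W) xs)))"
        if "W \<in> order_tuples p t" for W
        by (rule label_cochain_Suc(2)[OF prime lab[OF lp that xs(2,3)]]) (use xs v(1) \<open>odd k\<close> in auto)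
      then show "pull (cobd (?lc k)) ?g xs =
        (\<Sum>i<p. pull (\<lambda>l. ?lc (Suc k) (map (rotv p ^^ i) l)) ?g xs)"
        unfolding pull_def by (subst sum.swap) (simp add: sum_distrib_left del: label_cochain.simps map_map)
    qed
    then show ?thesis
      unfolding cobd_join_cochain[OF that(3,1)] using join_cochain_rot[OF that(3)] that(1)
      by (simp add: subdiv_iterate_sum del: label_cochain.simps)
  qed
  have top: "join_cochain ?n (map (rotv p ^^ i) vs) = 0" if "join_simplex p ?n vs" for vs i
  proof -
    note v = join_simplexD[OF join_simplex_rotv(2)[OF p0 that, of i]]
    let ?vs = "map (rotv p ^^ i) vs"
    have lp: "labels_of ?vs q < p" for q by (rule labels_of_less[OF v(4)])
    have "?S (pull (?lc ?n) (labels_of ?vs)) (unit_points ?vs) = ?S (\<lambda>_. 0) (unit_points ?vs)"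
    proof (rule subdiv_depth_cong)
      show "length ?vs \<le> ?n + 1" using v(1) by simp
      show "fst v < T" if "v \<in> set ?vs" for v using v(3)[OF that] dim by simp
      fix xs assume xs: "length xs = length ?vs" "set xs \<subseteq> simplex_points T" "mesh_le D xs"
      show "pull (?lc ?n) (labels_of ?vs) xs = 0"
        unfolding pull_def
        by (rule sum.neutral) (use label_cochain_eq_0[OF lab[OF lp _ xs(2,3)]] xs(1) v(1) in auto)
    qed
    then show ?thesis unfolding join_cochain_def by (simp add: subdiv_iterate_zero)
  qed
  have "int p dvd (\<Sum>i<p. join_chain p ?n (\<lambda>vs. join_cochain ?n (map (rotv p ^^ i) vs))) - (\<Sum>i<p. join_cochain 0 [(0, i)])"
    by (rule join_chain_pairing_mod[where H=join_cochain and n="M * (p - 1)", OF p0 even odd order.refl])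
  moreover have "join_chain p ?n (\<lambda>vs. join_cochain ?n (map (rotv p ^^ i) vs)) = 0" for i
    using join_chain_cong[OF p0, of ?n "\<lambda>vs. join_cochain ?n (map (rotv p ^^ i) vs)" "\<lambda>_. 0"] top
    by (simp add: join_chain_zero)
  \<comment> \<open>Summed over the rotations, \<open>label_cochain p 0\<close> gives 1 at every
    vertex, so that only the total weight of the orders remains.\<close>
  moreover have "(\<Sum>i<p. join_cochain 0 [(0, i)]) = fact (p - 1) ^ t"
  proof -
    let ?v = "[(0, 0)] :: (nat \<times> nat) list"
    let ?g = "labels_of ?v"
    have js: "join_simplex p 0 ?v" using p0 by (simp add: join_simplex_def)
    have lp: "?g q < p" for q by (rule labels_of_less) (use p0 in auto)
    have "(rotv p ^^ i) (0, 0) = (0, i)" if "i < p" for i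
      using that p0 by (simp add: rotv_funpow rot_funpow_eq)
    then have "(\<Sum>i<p. join_cochain 0 [(0, i)]) = (\<Sum>i<p. join_cochain 0 (map (rotv p ^^ i) ?v))" by simp
    also have "\<dots> = ?S (\<lambda>xs. \<Sum>i<p. pull (\<lambda>l. ?lc 0 (map (rotv p ^^ i) l)) ?g xs) (unit_points ?v)"
      using join_cochain_rot[OF js] by (simp add: subdiv_iterate_sum del: label_cochain.simps)
    also have "\<dots> = ?S (\<lambda>_. fact (p - 1) ^ t) (unit_points ?v)"
    proof (rule subdiv_depth_cong)
      show "fst v < T" if "v \<in> set ?v" for v using that dim by simp
      fix xs assume xs: "length xs = length ?v" "set xs \<subseteq> simplex_points T" "mesh_le D xs"
      have one: "(\<Sum>i<p. ?lc 0 (map (rotv p ^^ i) (map (Lab ?g W) xs))) = 1" if "W \<in> order_tuples p t" for W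
        by (rule label_cochain_0[OF prime lab[OF lp that xs(2,3)]]) (use xs in auto)
      have "(\<Sum>i<p. pull (\<lambda>l. ?lc 0 (map (rotv p ^^ i) l)) ?g xs) =
        (\<Sum>W\<in>order_tuples p t. (\<Prod>k<t. order_weight p (?g (cone k)) (W k)) * (\<Sum>i<p. ?lc 0 (map (rotv p ^^ i) (map (Lab ?g W) xs))))"
        unfolding pull_def by (subst sum.swap) (simp add: sum_distrib_left del: label_cochain.simps map_map)
      also have "\<dots> = (\<Sum>W\<in>order_tuples p t. \<Prod>k<t. order_weight p (?g (cone k)) (W k))"
        by (intro sum.cong refl) (simp only: one mult_1_right)
      also have "\<dots> = fact (p - 1) ^ t"
        using sum_order_tuples[where t=t and p=p and f="\<lambda>k. order_weight p (?g (cone k))"] by (simp add: sum_order_weight[OF prime lp])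
      finally show "(\<Sum>i<p. pull (\<lambda>l. ?lc 0 (map (rotv p ^^ i) l)) ?g xs) = fact (p - 1) ^ t" .
    qed simp
    also have "\<dots> = fact (p - 1) ^ t" by (simp add: unit_points_def subdiv_iterate_const_singleton)
    finally show ?thesis .
  qed
  ultimately have "int p dvd fact (p - 1) ^ t" by simp
  then have "p dvd fact (p - 1) ^ t" by (metis int_dvd_int_iff of_nat_fact of_nat_power)
  then have "p dvd fact (p - 1)" using prime prime_dvd_power by blast
  then show False using prime p0 by (simp add: prime_dvd_fact_iff)
qed

end

section \<open>Families of power diagrams\<close>

lemma index_of_append:
  "index_of (us @ vs) i = (if i \<in> set us then index_of us i else length us + index_of vs i)"
  by (induction us) (auto simp: index_of_Cons)

lemma index_of_filter_less_iff:
  "i \<in> set w \<Longrightarrow> j \<in> set w \<Longrightarrow> P i \<Longrightarrow> P j \<Longrightarrow>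
   index_of (filter P w) i < index_of (filter P w) j \<longleftrightarrow> index_of w i < index_of w j"
proof (induction w)
  case (Cons x w)
  show ?case
  proof (cases "x = i \<or> x = j")
    case True
    then show ?thesis using Cons.prems by (auto simp: index_of_Cons)
  next
    case False
    then show ?thesis using Cons by (auto simp: index_of_Cons)
  qed
qed simp

lemma index_of_unshuffle_less_iff:
  assumes "i \<in> set w" "j \<in> set w" "i \<in> A \<longleftrightarrow> j \<in> A"
  shows "index_of (unshuffle A w) i < index_of (unshuffle A w) j \<longleftrightarrow> index_of w i < index_of w j"
proof (cases "i \<in> A")
  case True
  then show ?thesis using assms index_of_filter_less_iff[of i w j "\<lambda>s. s \<in> A"]
    by (simp add: unshuffle_def index_of_append)
next
  case False
  then show ?thesis using assms index_of_filter_less_iff[of i w j "\<lambda>s. s \<notin> A"]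
    by (simp add: unshuffle_def index_of_append)
qed

lemma index_of_inj: "i \<in> set w \<Longrightarrow> index_of w i = index_of w j \<Longrightarrow> i = j"
  by (induction w) (auto simp: index_of_Cons split: if_splits)

definition order_sign :: "nat list \<Rightarrow> nat \<Rightarrow> nat \<Rightarrow> real" where
  "order_sign w i j = (if index_of w j < index_of w i then 1 else if index_of w i < index_of w j then -1 else 0)"

locale power_family =
  fixes p t n :: nat and bvec :: "nat \<Rightarrow> 'a::euclidean_space"
  assumes prime: "prime p" and t: "t > 0" and bvec: "bij_betw bvec {..<DIM('a)} Basis"
    and n_def: "n = DIM('a) * (p - 1)"
begin

text \<open>Block \<open>k\<close> consists of \<open>n\<close> vertices that place the sites,
  \<open>p - 1\<close> for each basis vector, followed by the cone vertex in position
  \<open>n\<close>.\<close>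

definition pos :: "nat \<Rightarrow> nat \<Rightarrow> nat" where "pos k m = k * Suc n + m"

abbreviation cone :: "nat \<Rightarrow> nat" where "cone k \<equiv> pos k n"

abbreviation T :: nat where "T \<equiv> t * Suc n"

text \<open>If a block has positive mass and cone weight 0, one of its \<open>n\<close> site
  vertices has weight at least \<open>1 / (2 * t * n)\<close>, which is \<open>p * width\<close>.
  This leaves room for \<open>p\<close> intervals of length \<open>width\<close>, as needed in
  \<open>exists_gap\<close>.\<close>

definition width :: real where "width = 1 / (2 * real t * real n * real p)"

definition site :: "(nat \<Rightarrow> nat) \<Rightarrow> (nat \<Rightarrow> real) \<Rightarrow> nat \<Rightarrow> nat \<Rightarrow> 'a" where
  "site g x k i = (\<Sum>m<n. (if g (pos k m) = i then x (pos k m) else 0) *\<^sub>R bvec (m div (p - 1)))"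

text \<open>The heights break ties between nearby sites in the order \<open>w\<close>. They make the functionals
  \<open>site \<bullet> y + height\<close> pairwise distinct, and the relative order in \<open>w\<close> of sites at distance
  at least \<open>width / 2\<close> has no effect.\<close>

definition height :: "(nat \<Rightarrow> nat) \<Rightarrow> (nat \<Rightarrow> real) \<Rightarrow> nat list \<Rightarrow> nat \<Rightarrow> nat \<Rightarrow> real" where
  "height g x w k i = (\<Sum>j<p. order_sign w i j * max 0 (width / 2 - norm (site g x k i - site g x k j)))"

definition functional :: "(nat \<Rightarrow> nat) \<Rightarrow> (nat \<Rightarrow> real) \<Rightarrow> nat list \<Rightarrow> nat \<Rightarrow> nat \<Rightarrow> 'a \<Rightarrow> real" where
  "functional g x w k i y = site g x k i \<bullet> y + height g x w k i"

text \<open>A block of weight at most \<open>1 / (2 * t)\<close> gets a slab of zero width, so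
  positive mass bounds the weight of the block from below. Some block has weight at least
  \<open>1 / t\<close>, hence the masses never vanish all together.\<close>

definition mass :: "(nat \<Rightarrow> real) \<Rightarrow> nat \<Rightarrow> real" where
  "mass x k = max 0 ((\<Sum>m<Suc n. x (pos k m)) - 1 / (2 * real t))"

definition cut :: "(nat \<Rightarrow> real) \<Rightarrow> nat \<Rightarrow> real" where
  "cut x k = (\<Sum>l<k. mass x l)"

text \<open>Maps the first coordinate to the open unit interval, so that cuts are fractions of the
  total mass and the fractions 0 and 1 become cuts at infinity. It is decreasing because
  \<open>glue\<close> puts its first argument on the side of large coordinates.\<close>

definition level :: "'a \<Rightarrow> real" where
  "level y = 1 / 2 - arctan (y \<bullet> bvec 0) / pi"

definition region :: "(nat \<Rightarrow> nat) \<Rightarrow> (nat \<Rightarrow> real) \<Rightarrow> (nat \<Rightarrow> nat list) \<Rightarrow> nat \<Rightarrow> 'a set" where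
  "region g x W s = {y. \<exists>k<t. cut x k \<le> level y * cut x t \<and> level y * cut x t \<le> cut x (Suc k) \<and>
      (\<forall>i<p. functional g x (W k) k i y \<le> functional g x (W k) k s y)}"

lemma p1: "p > 1" using prime prime_gt_1_nat by blast

lemma p0: "p > 0" using p1 by simp

lemma n0: "n > 0" using p1 by (simp add: n_def)

lemma width_pos: "width > 0" using t n0 p0 by (simp add: width_def)

lemma pos_less: "k < t \<Longrightarrow> m \<le> n \<Longrightarrow> pos k m < T"
proof -
  assume "k < t" "m \<le> n"
  then have "pos k m < Suc k * Suc n" by (simp add: pos_def)
  also have "\<dots> \<le> T" by (rule mult_le_mono1) (use \<open>k < t\<close> in simp)
  finally show ?thesis .
qed

lemma sum_pos: "(\<Sum>q<T. f q) = (\<Sum>k<t. \<Sum>m<Suc n. f (pos k m))" for f :: "nat \<Rightarrow> real"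
proof -
  have "(\<Sum>q<T. f q) = (\<Sum>k<t. sum f {k * Suc n..<k * Suc n + Suc n})" by (rule sum.nat_group[symmetric])
  also have "\<dots> = (\<Sum>k<t. \<Sum>m<Suc n. f (pos k m))"
    by (rule sum.cong[OF refl], subst sum.atLeastLessThan_shift_0)
       (simp only: pos_def o_def atLeast0LessThan add_diff_cancel_left')
  finally show ?thesis .
qed

lemma bvec_Basis: "m < DIM('a) \<Longrightarrow> bvec m \<in> Basis"
  using bvec by (auto simp: bij_betw_def)

lemma dir_less: "m < n \<Longrightarrow> m div (p - 1) < DIM('a)"
  using p1 by (simp add: n_def less_mult_imp_div_less)

lemma bvec_inner: "i < DIM('a) \<Longrightarrow> j < DIM('a) \<Longrightarrow> bvec i \<bullet> bvec j = (if i = j then 1 else 0)"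
  using bvec_Basis inner_Basis[of "bvec i" "bvec j"] bvec by (auto simp: bij_betw_def inj_on_def)

lemma site_inner:
  assumes "b < DIM('a)"
  shows "site g x k i \<bullet> bvec b = (\<Sum>m<n. if m div (p - 1) = b \<and> g (pos k m) = i then x (pos k m) else 0)"
  unfolding site_def inner_sum_left
proof (intro sum.cong refl)
  fix m assume "m \<in> {..<n}"
  then have "bvec (m div (p - 1)) \<bullet> bvec b = (if m div (p - 1) = b then 1 else 0)"
    by (intro bvec_inner dir_less assms) simp
  then show "(if g (pos k m) = i then x (pos k m) else 0) *\<^sub>R bvec (m div (p - 1)) \<bullet> bvec b =
    (if m div (p - 1) = b \<and> g (pos k m) = i then x (pos k m) else 0)" by simp
qed

text \<open>At coinciding sites the distance factors agree, so the heights are ordered like the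
  positions in \<open>w\<close>. The summand of the earlier label, with factor
  \<open>width / 2\<close>, makes the inequality strict.\<close>

lemma height_neq:
  assumes "i < p" "j < p" "i \<noteq> j" "site g x k i = site g x k j" "w \<in> orders p"
  shows "height g x w k i \<noteq> height g x w k j"
proof -
  have main: "height g x w k j < height g x w k i" if ij: "i < p" "j < p" "site g x k i = site g x k j" "index_of w j < index_of w i" for i j
    unfolding height_def
  proof (rule sum_strict_mono_ex1)
    show "\<forall>l\<in>{..<p}. order_sign w j l * max 0 (width / 2 - norm (site g x k j - site g x k l))
       \<le> order_sign w i l * max 0 (width / 2 - norm (site g x k i - site g x k l))"
      unfolding ij(3) using ij(4) by (intro ballI mult_right_mono) (auto simp: order_sign_def)
    show "\<exists>l\<in>{..<p}. order_sign w j l * max 0 (width / 2 - norm (site g x k j - site g x k l))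
       < order_sign w i l * max 0 (width / 2 - norm (site g x k i - site g x k l))"
      using ij width_pos by (intro bexI[of _ j]) (auto simp: order_sign_def)
  qed simp
  have "index_of w i \<noteq> index_of w j" using index_of_inj[of i w j] assms ordersD(1)[OF assms(5)] by auto
  then show ?thesis using main[of i j] main[of j i] assms by fastforce
qed

lemma functional_distinct:
  assumes "i < p" "j < p" "i \<noteq> j" "w \<in> orders p"
  shows "site g x k i - site g x k j \<noteq> 0 \<or> height g x w k j - height g x w k i \<noteq> 0"
  using height_neq[OF assms(1-3) _ assms(4), of g x k] by auto

lemma site_rot:
  assumes "\<And>q. g q < p" "i < p"
  shows "site (rot p \<circ> g) x k (rot p i) = site g x k i"
proof -
  have "rot p (g q) = rot p i \<longleftrightarrow> g q = i" for q
    using inj_on_rot[OF p0] assms by (auto simp: inj_on_def)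
  then show ?thesis by (simp add: site_def)
qed

lemma functional_rot:
  assumes g: "\<And>q. g q < p" and i: "i < p" and w: "w \<in> orders p"
  shows "functional (rot p \<circ> g) x (map (rot p) w) k (rot p i) y = functional g x w k i y"
proof -
  have idx: "index_of (map (rot p) w) (rot p j) = index_of w j" if "j < p" for j
    using that inj_on_rot[OF p0] ordersD(1)[OF w] by (intro index_of_map) (simp add: insert_absorb)
  have "height (rot p \<circ> g) x (map (rot p) w) k (rot p i) = height g x w k i"
    unfolding height_def
    by (subst sum.reindex_bij_betw[OF bij_betw_rot[OF p0], symmetric], intro sum.cong refl)
       (simp add: order_sign_def idx i site_rot[OF g])
  then show ?thesis by (simp add: functional_def site_rot[OF g i])
qed

lemma region_rot:
  assumes g: "\<And>q. g q < p" and W: "W \<in> order_tuples p t" and s: "s < p"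
  shows "region (rot p \<circ> g) x (rot_orders p t W) (rot p s) = region g x W s"
proof -
  have "(\<forall>i<p. functional (rot p \<circ> g) x (rot_orders p t W k) k i y \<le> functional (rot p \<circ> g) x (rot_orders p t W k) k (rot p s) y)
     \<longleftrightarrow> (\<forall>i<p. functional g x (W k) k i y \<le> functional g x (W k) k s y)" if k: "k < t" for k y
  proof -
    have Wk: "W k \<in> orders p" using W k by auto
    have r: "rot_orders p t W k = map (rot p) (W k)" using k by (simp add: rot_orders_def)
    have all: "(\<forall>i<p. Q i) \<longleftrightarrow> (\<forall>i<p. Q (rot p i))" for Q
      using bij_betw_rot[OF p0] unfolding bij_betw_def by (metis imageE imageI lessThan_iff)
    show ?thesis unfolding r by (subst all) (simp add: functional_rot[OF g _ Wk] s)
  qed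
  then show ?thesis unfolding region_def by blast
qed

lemma region_local:
  assumes "\<And>q. q < T \<Longrightarrow> x q \<noteq> 0 \<Longrightarrow> g q = g' q"
  shows "region g x W s = region g' x W s"
proof -
  have "site g x k i = site g' x k i" if "k < t" for k i
    unfolding site_def
  proof (intro sum.cong refl arg_cong2[where f="scaleR"])
    fix m assume "m \<in> {..<n}"
    then have "pos k m < T" using pos_less[OF that] by simp
    then show "(if g (pos k m) = i then x (pos k m) else 0) = (if g' (pos k m) = i then x (pos k m) else 0)"
      using assms by fastforce
  qed
  then have "functional g x w k i = functional g' x w k i" if "k < t" for k w i
    using that by (intro ext) (simp add: functional_def height_def)
  then show ?thesis unfolding region_def by auto
qed

text \<open>Between the groups the distance factors in the heights vanish; inside a group
  unshuffling preserves the order signs.\<close>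

lemma region_unshuffle:
  assumes k: "k < t" and W: "W \<in> order_tuples p t" and s: "s < p"
    and sep: "\<And>i j. i < p \<Longrightarrow> j < p \<Longrightarrow> i \<in> A \<Longrightarrow> j \<notin> A \<Longrightarrow> width / 2 \<le> norm (site g x k i - site g x k j)"
  shows "region g x (W(k := unshuffle A (W k))) s = region g x W s"
proof -
  have Wk: "set (W k) = {..<p}" using W k ordersD(1) by blast
  have "height g x (unshuffle A (W k)) k i = height g x (W k) k i" if i: "i < p" for i
    unfolding height_def
  proof (intro sum.cong refl)
    fix j assume "j \<in> {..<p}"
    then have j: "j < p" by simp
    show "order_sign (unshuffle A (W k)) i j * max 0 (width / 2 - norm (site g x k i - site g x k j)) =
      order_sign (W k) i j * max 0 (width / 2 - norm (site g x k i - site g x k j))"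
    proof (cases "i \<in> A \<longleftrightarrow> j \<in> A")
      case True
      have "order_sign (unshuffle A (W k)) i j = order_sign (W k) i j"
        unfolding order_sign_def using index_of_unshuffle_less_iff[of i "W k" j A] index_of_unshuffle_less_iff[of j "W k" i A]
          True i j Wk by simp
      then show ?thesis by simp
    next
      case False
      then have "width / 2 \<le> norm (site g x k i - site g x k j)"
        using sep[OF i j] sep[OF j i] by (auto simp: norm_minus_commute)
      then show ?thesis by simp
    qed
  qed
  then have "functional g x (unshuffle A (W k)) k i = functional g x (W k) k i" if "i < p" for i
    using that by (intro ext) (simp add: functional_def)
  then have "(\<forall>i<p. functional g x ((W(k := unshuffle A (W k))) l) l i y \<le> functional g x ((W(k := unshuffle A (W k))) l) l s y)
     \<longleftrightarrow> (\<forall>i<p. functional g x (W l) l i y \<le> functional g x (W l) l s y)" for l y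
    using s by (cases "l = k") auto
  then show ?thesis unfolding region_def by blast
qed

text \<open>Pigeonhole: of the \<open>p\<close> intervals of length \<open>w\<close> from 0 to
  \<open>p * w\<close> at most \<open>p - 1\<close> contain a value, since \<open>y i1\<close> lies
  in none of them. \<open>A\<close> consists of the labels below a missed interval.\<close>

lemma exists_gap:
  fixes y :: "nat \<Rightarrow> real"
  assumes "i1 < p" "y i1 \<le> 0" "i0 < p" "y i0 \<ge> real p * w" "w > 0"
  shows "\<exists>A\<subseteq>{..<p}. A \<noteq> {} \<and> A \<noteq> {..<p} \<and> (\<forall>i<p. \<forall>j<p. i \<in> A \<longrightarrow> j \<notin> A \<longrightarrow> y j - y i > w)"
proof -
  define P where "P l i \<longleftrightarrow> real l * w < y i \<and> y i \<le> real (Suc l) * w" for l i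
  have "\<exists>l<p. \<forall>i<p. \<not> P l i"
  proof (rule ccontr)
    assume "\<not> ?thesis"
    then have "\<forall>l\<in>{..<p}. \<exists>i. i < p \<and> P l i" by auto
    then obtain f where f: "\<And>l. l < p \<Longrightarrow> f l < p \<and> P l (f l)" by (metis lessThan_iff)
    have "inj_on f {..<p}"
    proof (rule inj_onI)
      fix l l' assume l: "l \<in> {..<p}" "l' \<in> {..<p}" and eq: "f l = f l'"
      have P: "P l (f l)" "P l' (f l)" using f[of l] f[of l'] l eq by auto
      have "real l * w < real (Suc l') * w" "real l' * w < real (Suc l) * w"
        using P unfolding P_def by linarith+
      then have "l < Suc l'" "l' < Suc l" using assms(5) by (simp_all add: mult_less_cancel_right_pos del: of_nat_Suc)
      then show "l = l'" by simp
    qed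
    moreover have "f ` {..<p} \<subseteq> {..<p} - {i1}"
    proof clarsimp
      fix l assume "l < p"
      then have "f l < p" "P l (f l)" using f by auto
      moreover have "real l * w \<ge> 0" using assms(5) by simp
      ultimately show "f l < p \<and> f l \<noteq> i1" using assms(2) by (auto simp: P_def)
    qed
    ultimately have "card {..<p} \<le> card ({..<p} - {i1})"
      by (metis card_image card_mono finite_Diff finite_lessThan)
    then show False using assms(1) by simp
  qed
  then obtain l where l: "l < p" "\<And>i. i < p \<Longrightarrow> \<not> P l i" by blast
  let ?A = "{i. i < p \<and> y i \<le> real l * w}"
  have lw: "real l * w \<ge> 0" using assms(5) by simp
  have "real l * w < real p * w" using l assms(5) by simp
  then have i0: "i0 \<notin> ?A" using assms(4) by auto
  have i1: "i1 \<in> ?A" using assms(1,2) lw order.trans by auto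
  have "y j - y i > w" if "i < p" "j < p" "i \<in> ?A" "j \<notin> ?A" for i j
  proof -
    have "y j > real (Suc l) * w" using l(2)[of j] that by (auto simp: P_def)
    moreover have "y i \<le> real l * w" using that by simp
    ultimately show ?thesis by (simp add: algebra_simps)
  qed
  then show ?thesis using i0 i1 assms(3) by (intro exI[of _ ?A]) auto
qed

text \<open>The gap is found at one point \<open>x0\<close> of positive mass and carried over to the
  others: each coordinate of a site moves by at most \<open>n * D\<close>, which is at most
  \<open>width / 4\<close>, so of a gap of \<open>width\<close> at least \<open>width / 2\<close>
  survives.\<close>

lemma exists_separation:
  assumes k: "k < t" and xs: "set xs \<subseteq> simplex_points T" "mesh_le D xs" and D: "D \<le> width / (4 * real n)"
    and g: "\<And>q. g q < p"
    and zero: "\<And>x. x \<in> set xs \<Longrightarrow> x (cone k) = 0"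
  shows "\<exists>A\<subseteq>{..<p}. A \<noteq> {} \<and> A \<noteq> {..<p} \<and> (\<forall>x\<in>set xs. mass x k > 0 \<longrightarrow>
     (\<forall>i<p. \<forall>j<p. i \<in> A \<longrightarrow> j \<notin> A \<longrightarrow> width / 2 \<le> norm (site g x k i - site g x k j)))"
proof (cases "\<exists>x\<in>set xs. mass x k > 0")
  case False
  then show ?thesis using p1 by (intro exI[of _ "{0}"]) auto
next
  case True
  then obtain x0 where x0: "x0 \<in> set xs" "mass x0 k > 0" by blast
  have nn: "real n > 0" using n0 by simp
  have sum0: "(\<Sum>m<n. x0 (pos k m)) > 1 / (2 * real t)"
    using x0(2) zero[OF x0(1)] by (simp add: mass_def)
  have "\<exists>m<n. x0 (pos k m) \<ge> real p * width"
  proof (rule ccontr)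
    assume "\<not> ?thesis"
    then have "(\<Sum>m<n. x0 (pos k m)) \<le> (\<Sum>m<n. real p * width)" by (intro sum_mono) auto
    also have "\<dots> = 1 / (2 * real t)" using nn p0 t by (simp add: width_def field_simps)
    finally show False using sum0 by simp
  qed
  then obtain m0 where m0: "m0 < n" "x0 (pos k m0) \<ge> real p * width" by blast
  define b where "b = m0 div (p - 1)"
  have b: "b < DIM('a)" unfolding b_def by (rule dir_less[OF m0(1)])
  have nonneg: "x q \<ge> 0" if "x \<in> set xs" for x q using that xs(1) by (auto simp: simplex_points_def)
  let ?y = "\<lambda>x i. site g x k i \<bullet> bvec b"
  have i0: "?y x0 (g (pos k m0)) \<ge> real p * width"
  proof -
    have "x0 (pos k m0) \<le> ?y x0 (g (pos k m0))"
      unfolding site_inner[OF b]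
      by (rule order.trans[OF _ member_le_sum[of m0]]) (use m0(1) nonneg[OF x0(1)] b_def in auto)
    then show ?thesis using m0 by simp
  qed
  let ?G = "(\<lambda>m. g (pos k m)) ` {m. m div (p - 1) = b}"
  \<comment> \<open>Exactly \<open>p - 1\<close> indices \<open>m\<close> belong to direction
    \<open>b\<close>, so some label \<open>i1\<close> is missing, and its site has coordinate
    0.\<close>
  have "card ?G < p"
  proof -
    have eq: "{m. m div (p - 1) = b} = {b * (p - 1)..<Suc b * (p - 1)}"
    proof (rule set_eqI)
      fix m
      show "m \<in> {m. m div (p - 1) = b} \<longleftrightarrow> m \<in> {b * (p - 1)..<Suc b * (p - 1)}"
        using p1 div_nat_eqI[of "p - 1" b m] dividend_less_div_times[of "p - 1" m] div_times_less_eq_dividend[of m "p - 1"]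
        by (auto simp: mult.commute)
    qed
    have "card ?G \<le> card {m. m div (p - 1) = b}" by (rule card_image_le) (unfold eq, simp)
    also have "\<dots> = p - 1" unfolding eq by simp
    finally show ?thesis using p1 by simp
  qed
  moreover have "?G \<subseteq> {..<p}" using g by auto
  ultimately have "\<exists>i1<p. i1 \<notin> ?G"
    by (metis card_lessThan lessThan_iff less_irrefl subsetI subset_antisym)
  then obtain i1 where i1: "i1 < p" "i1 \<notin> ?G" by blast
  have y1: "?y x0 i1 \<le> 0"
    unfolding site_inner[OF b] by (rule sum_nonpos) (use i1(2) in auto)
  obtain A where A: "A \<subseteq> {..<p}" "A \<noteq> {}" "A \<noteq> {..<p}"
    and gap: "\<And>i j. i < p \<Longrightarrow> j < p \<Longrightarrow> i \<in> A \<Longrightarrow> j \<notin> A \<Longrightarrow> ?y x0 j - ?y x0 i > width"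
    using exists_gap[of i1 "?y x0" "g (pos k m0)" width, OF i1(1) y1 g i0 width_pos] by blast
  have close: "\<bar>?y x i - ?y x0 i\<bar> \<le> width / 4" if x: "x \<in> set xs" for x i
  proof -
    have "?y x i - ?y x0 i = (\<Sum>m<n. if m div (p - 1) = b \<and> g (pos k m) = i then x (pos k m) - x0 (pos k m) else 0)"
      unfolding site_inner[OF b] by (auto simp: sum_subtractf[symmetric] intro!: sum.cong)
    also have "\<bar>\<dots>\<bar> \<le> (\<Sum>m<n. width / (4 * real n))"
    proof (rule order.trans[OF sum_abs], rule sum_mono)
      fix m
      have "\<bar>x (pos k m) - x0 (pos k m)\<bar> \<le> width / (4 * real n)"
        using xs(2) x x0(1) D unfolding mesh_le_def by (meson order.trans)
      then show "\<bar>if m div (p - 1) = b \<and> g (pos k m) = i then x (pos k m) - x0 (pos k m) else 0\<bar> \<le> width / (4 * real n)"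
        using width_pos by auto
    qed
    also have "\<dots> = width / 4" using nn by simp
    finally show ?thesis .
  qed
  have "width / 2 \<le> norm (site g x k i - site g x k j)" if "x \<in> set xs" "i < p" "j < p" "i \<in> A" "j \<notin> A" for x i j
  proof -
    have "width / 2 \<le> ?y x j - ?y x i" using gap[OF that(2-5)] close[OF that(1), of i] close[OF that(1), of j] by linarith
    also have "\<dots> \<le> \<bar>(site g x k j - site g x k i) \<bullet> bvec b\<bar>" by (simp add: inner_diff_left)
    also have "\<dots> \<le> norm (site g x k j - site g x k i)" by (rule Basis_le_norm[OF bvec_Basis[OF b]])
    finally show ?thesis by (simp add: norm_minus_commute)
  qed
  then show ?thesis using A by (intro exI[of _ A]) auto
qed

end

section \<open>Iterated partitions and measures\<close>

text \<open>Dominated convergence for the indicator functions.\<close>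

lemma measure_tendsto_AE:
  assumes "finite_measure M" "\<And>i. A i \<in> sets M" "B \<in> sets M"
    and "AE y in M. \<forall>\<^sub>F i in sequentially. y \<in> A i \<longleftrightarrow> y \<in> B"
  shows "(\<lambda>i. measure M (A i)) \<longlonglongrightarrow> measure M B"
proof -
  interpret finite_measure M by fact
  have "(\<lambda>i. integral\<^sup>L M (indicator (A i) :: 'a \<Rightarrow> real)) \<longlonglongrightarrow> integral\<^sup>L M (indicator B :: 'a \<Rightarrow> real)"
  proof (rule integral_dominated_convergence[where w="\<lambda>_. 1"])
    show "AE y in M. (\<lambda>i. indicator (A i) y :: real) \<longlonglongrightarrow> indicator B y"
      using assms(4)
    proof eventually_elim
      case (elim y)
      then have "\<forall>\<^sub>F i in sequentially. indicator (A i) y = (indicator B y :: real)"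
        by eventually_elim (auto simp: indicator_def)
      then show ?case by (rule tendsto_eventually)
    qed
  qed (use assms in \<open>auto simp: indicator_def\<close>)
  then show ?thesis using assms by simp
qed

lemma tendsto_imp_eventually_less:
  fixes f h :: "nat \<Rightarrow> real"
  assumes "f \<longlonglongrightarrow> a" "h \<longlonglongrightarrow> b" "a < b"
  shows "\<forall>\<^sub>F i in sequentially. f i < h i"
proof -
  obtain c where "a < c" "c < b" using dense[OF assms(3)] by blast
  then have "\<forall>\<^sub>F i in sequentially. f i < c" "\<forall>\<^sub>F i in sequentially. c < h i"
    using order_tendstoD assms by blast+
  then show ?thesis by eventually_elim simp
qed

lemma tendsto_imp_eventually_le_iff:
  fixes f h :: "nat \<Rightarrow> real"
  assumes "f \<longlonglongrightarrow> a" "h \<longlonglongrightarrow> b" "a \<noteq> b"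
  shows "\<forall>\<^sub>F i in sequentially. f i \<le> h i \<longleftrightarrow> a \<le> b"
proof (cases "a < b")
  case True
  have "\<forall>\<^sub>F i in sequentially. f i < h i" by (rule tendsto_imp_eventually_less[OF assms(1,2) True])
  then show ?thesis by eventually_elim (use True in auto)
next
  case False
  then have "b < a" using assms(3) by simp
  have "\<forall>\<^sub>F i in sequentially. h i < f i" by (rule tendsto_imp_eventually_less[OF assms(2,1) \<open>b < a\<close>])
  then show ?thesis by eventually_elim (use \<open>b < a\<close> in auto)
qed

lemma admissible_null:
  assumes "admissible_measure mu" "a \<noteq> 0 \<or> b \<noteq> 0"
  shows "{y. a \<bullet> y = b} \<in> null_sets mu"
proof -
  have "{y. a \<bullet> y = b} \<in> sets lborel"
    unfolding sets_lborel by (intro borel_closed closed_Collect_eq continuous_intros)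
  moreover have "{y. a \<bullet> y = b} \<in> null_sets lebesgue"
    using negligible_hyperplane[OF assms(2)] by (simp only: negligible_iff_null_sets)
  ultimately have "{y. a \<bullet> y = b} \<in> null_sets lborel" by (simp only: null_sets_completion_iff)
  then show ?thesis using assms(1) by (auto simp: admissible_measure_def absolutely_continuous_def)
qed

lemma admissible_sets: "admissible_measure mu \<Longrightarrow> sets mu = sets borel"
  by (simp add: admissible_measure_def)

lemma label_union_eq: "label_union P s = \<Union>{K. (K, s) \<in> set P}"
  unfolding label_union_def by (rule arg_cong[where f=Union]) (force simp: in_set_conv_nth)

lemma label_union_map: "s < p \<Longrightarrow> label_union (map (\<lambda>i. (K i, i + 1)) [0..<p]) (s + 1) = K s"
  unfolding label_union_eq by (auto simp: image_iff)

lemma label_union_glue: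
  "label_union (glue v a P Q) s = (halfplus v a \<inter> label_union P s) \<union> (halfminus v a \<inter> label_union Q s)"
  unfolding label_union_eq glue_def by auto

text \<open>The nesting is to the right: the power diagram of slab \<open>k\<close> is glued to the
  partition built from the later slabs. The conditions \<open>k < l\<close> and
  \<open>Suc l < t\<close> leave the first and the last slab unbounded on their outer sides, where
  nothing is cut. Monotonicity of \<open>c\<close> places all later slabs beyond the cut
  \<open>c (Suc k)\<close>.\<close>

lemma iterated_slab_partition:
  fixes v :: "'a::euclidean_space" and C :: "nat \<Rightarrow> nat \<Rightarrow> 'a set" and f :: "'a \<Rightarrow> real" and c :: "nat \<Rightarrow> real"
  assumes v: "norm v = 1"
    and C: "\<And>k. k < t \<Longrightarrow> \<exists>P\<in>power_diagrams p. length P = p \<and> (\<forall>s<p. label_union P (s + 1) = C k s)"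
    and half: "\<And>k. \<exists>a. halfplus v a = {y. f y \<le> c k} \<and> halfminus v a = {y. c k \<le> f y}"
    and mono: "\<And>k l. k \<le> l \<Longrightarrow> c k \<le> c l"
  shows "k + Suc m = t \<Longrightarrow> \<exists>P X. iter_space p (Suc m) X \<and> P \<in> X \<and> length P = p * Suc m \<and>
     (\<forall>s<p. label_union P (s + 1) = {y. \<exists>l. k \<le> l \<and> l < t \<and> (k < l \<longrightarrow> c l \<le> f y) \<and> (Suc l < t \<longrightarrow> f y \<le> c (Suc l)) \<and> y \<in> C l s})"
proof (induction m arbitrary: k)
  case 0
  then obtain P where P: "P \<in> power_diagrams p" "length P = p" "\<forall>s<p. label_union P (s + 1) = C k s"
    using C[of k] by auto
  have "{y. \<exists>l. k \<le> l \<and> l < t \<and> (k < l \<longrightarrow> c l \<le> f y) \<and> (Suc l < t \<longrightarrow> f y \<le> c (Suc l)) \<and> y \<in> C l s} = C k s" for s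
    using 0 by (auto intro!: exI[of _ k] dest: le_antisym)
  then show ?case using P iter_space.base[of p] by (intro exI[of _ P] exI[of _ "power_diagrams p"]) auto
next
  case (Suc m)
  obtain P where P: "P \<in> power_diagrams p" "length P = p" "\<forall>s<p. label_union P (s + 1) = C k s"
    using C[of k] Suc.prems by auto
  obtain Q X where Q: "iter_space p (Suc m) X" "Q \<in> X" "length Q = p * Suc m"
    "\<forall>s<p. label_union Q (s + 1) = {y. \<exists>l. Suc k \<le> l \<and> l < t \<and> (Suc k < l \<longrightarrow> c l \<le> f y) \<and> (Suc l < t \<longrightarrow> f y \<le> c (Suc l)) \<and> y \<in> C l s}"
    using Suc.IH[of "Suc k"] Suc.prems by auto
  obtain a where a: "halfplus v a = {y. f y \<le> c (Suc k)}" "halfminus v a = {y. c (Suc k) \<le> f y}"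
    using half by blast
  let ?X = "{glue v a P1 P2 | P1 P2 a. P1 \<in> power_diagrams p \<and> P2 \<in> X}"
  have "iter_space p (1 + Suc m) ?X" by (rule iter_space.step[OF iter_space.base Q(1) v])
  moreover have "glue v a P Q \<in> ?X" using P Q by blast
  moreover have "length (glue v a P Q) = p * Suc (Suc m)" using P Q by (simp add: glue_def)
  moreover have "label_union (glue v a P Q) (s + 1) =
    {y. \<exists>l. k \<le> l \<and> l < t \<and> (k < l \<longrightarrow> c l \<le> f y) \<and> (Suc l < t \<longrightarrow> f y \<le> c (Suc l)) \<and> y \<in> C l s}" (is "_ = ?R") if s: "s < p" for s
  proof (rule set_eqI)
    fix y
    have lu: "y \<in> label_union (glue v a P Q) (s + 1) \<longleftrightarrow> (f y \<le> c (Suc k) \<and> y \<in> C k s) \<or> (c (Suc k) \<le> f y \<and>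
       (\<exists>l. Suc k \<le> l \<and> l < t \<and> (Suc k < l \<longrightarrow> c l \<le> f y) \<and> (Suc l < t \<longrightarrow> f y \<le> c (Suc l)) \<and> y \<in> C l s))"
      unfolding label_union_glue a using P(3) Q(4) s by auto
    show "y \<in> label_union (glue v a P Q) (s + 1) \<longleftrightarrow> y \<in> ?R"
    proof
      assume "y \<in> label_union (glue v a P Q) (s + 1)"
      then consider "f y \<le> c (Suc k) \<and> y \<in> C k s"
        | l where "c (Suc k) \<le> f y" "Suc k \<le> l" "l < t" "Suc k < l \<longrightarrow> c l \<le> f y" "Suc l < t \<longrightarrow> f y \<le> c (Suc l)" "y \<in> C l s"
        unfolding lu by blast
      then show "y \<in> ?R"
      proof cases
        case 1 then show ?thesis using Suc.prems by (auto intro!: exI[of _ k])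
      next
        case 2
        have "c l \<le> f y" using 2 by (cases "Suc k < l") (auto simp: le_less)
        then show ?thesis using 2 by (auto intro!: exI[of _ l])
      qed
    next
      assume "y \<in> ?R"
      then obtain l where l: "k \<le> l" "l < t" "k < l \<longrightarrow> c l \<le> f y" "Suc l < t \<longrightarrow> f y \<le> c (Suc l)" "y \<in> C l s" by blast
      show "y \<in> label_union (glue v a P Q) (s + 1)"
      proof (cases "k = l")
        case True then show ?thesis unfolding lu using l Suc.prems by auto
      next
        case False
        then have "k < l" using l by simp
        then have "c (Suc k) \<le> f y" using l mono[of "Suc k" l] by simp
        then show ?thesis unfolding lu using l \<open>k < l\<close> by (auto intro!: exI[of _ l])
      qed
    qed
  qed
  ultimately show ?case by (intro exI[of _ "glue v a P Q"] exI[of _ ?X]) simp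
qed

section \<open>Measures of the regions and their continuity\<close>

context power_family
begin

lemma level_bounds: "0 < level y" "level y < 1"
  using arctan_lbound[of "y \<bullet> bvec 0"] arctan_ubound[of "y \<bullet> bvec 0"] by (simp_all add: level_def field_simps)

lemma cut_mono: "k \<le> l \<Longrightarrow> cut x k \<le> cut x l"
  unfolding cut_def by (rule sum_mono2) (auto simp: mass_def)

lemma cut_total_pos:
  assumes "x \<in> simplex_points T"
  shows "cut x t > 0"
proof -
  have "1 = (\<Sum>k<t. \<Sum>m<Suc n. x (pos k m))" using assms unfolding sum_pos[symmetric] simplex_points_def by simp
  have "\<exists>k<t. (\<Sum>m<Suc n. x (pos k m)) > 1 / (2 * real t)"
  proof (rule ccontr)
    assume "\<not> ?thesis"
    then have "(\<Sum>k<t. \<Sum>m<Suc n. x (pos k m)) \<le> (\<Sum>k<t. 1 / (2 * real t))" by (intro sum_mono) auto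
    also have "\<dots> = 1 / 2" using t by simp
    finally show False using \<open>1 = _\<close> by simp
  qed
  then obtain k where "k < t" "mass x k > 0" by (auto simp: mass_def)
  then show ?thesis unfolding cut_def by (intro sum_pos2[of _ k]) (auto simp: mass_def)
qed

text \<open>The points where functionals tie or which lie on a cut. It is a null set because the
  functionals are pairwise distinct; outside of it the regions are disjoint and stable under small
  changes of the weights.\<close>

definition interface :: "(nat \<Rightarrow> nat) \<Rightarrow> (nat \<Rightarrow> real) \<Rightarrow> (nat \<Rightarrow> nat list) \<Rightarrow> 'a set" where
  "interface g x W = (\<Union>k<t. \<Union>i<p. \<Union>j\<in>{..<p} - {i}. {y. functional g x (W k) k i y = functional g x (W k) k j y})
     \<union> (\<Union>k\<le>t. {y. level y * cut x t = cut x k})"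

lemma interface_null:
  assumes mu: "admissible_measure mu" and x: "x \<in> simplex_points T" and W: "W \<in> order_tuples p t"
  shows "interface g x W \<in> null_sets mu"
proof -
  have 1: "{y. functional g x (W k) k i y = functional g x (W k) k j y} \<in> null_sets mu"
    if "k < t" "i < p" "j < p" "i \<noteq> j" for k i j
  proof -
    have "W k \<in> orders p" using W that by auto
    then have "{y. (site g x k i - site g x k j) \<bullet> y = height g x (W k) k j - height g x (W k) k i} \<in> null_sets mu"
      using functional_distinct that by (intro admissible_null[OF mu]) auto
    moreover have "{y. functional g x (W k) k i y = functional g x (W k) k j y} =
       {y. (site g x k i - site g x k j) \<bullet> y = height g x (W k) k j - height g x (W k) k i}"
      by (auto simp: functional_def inner_diff_left)
    ultimately show ?thesis by simp
  qed
  have 2: "{y. level y * cut x t = cut x k} \<in> null_sets mu" for k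
  proof (rule null_sets_subset)
    have "bvec 0 \<noteq> 0" using bvec_Basis[of 0] nonzero_Basis by auto
    then show "{y. bvec 0 \<bullet> y = tan (pi * (1 / 2 - cut x k / cut x t))} \<in> null_sets mu"
      by (intro admissible_null[OF mu]) auto
    show "{y. level y * cut x t = cut x k} \<subseteq> {y. bvec 0 \<bullet> y = tan (pi * (1 / 2 - cut x k / cut x t))}"
    proof clarsimp
      fix y assume "level y * cut x t = cut x k"
      then have "level y = cut x k / cut x t" using cut_total_pos[OF x] by (simp add: field_simps)
      then have "arctan (y \<bullet> bvec 0) = pi * (1 / 2 - cut x k / cut x t)" by (simp add: level_def field_simps)
      then show "bvec 0 \<bullet> y = tan (pi * (1 / 2 - cut x k / cut x t))" by (metis tan_arctan inner_commute)
    qed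
    have "{y. level y * cut x t = cut x k} \<in> sets borel"
      unfolding level_def by (intro borel_closed closed_Collect_eq continuous_intros) auto
    then show "{y. level y * cut x t = cut x k} \<in> sets mu" using admissible_sets[OF mu] by simp
  qed
  show ?thesis unfolding interface_def
    by (intro null_sets.Un null_sets.finite_UN 2 1) auto
qed

lemma region_sets: "region g x W s \<in> sets borel"
proof -
  have "region g x W s = (\<Union>k<t. {y. cut x k \<le> level y * cut x t} \<inter> {y. level y * cut x t \<le> cut x (Suc k)} \<inter>
      (\<Inter>i\<in>{..<p}. {y. functional g x (W k) k i y \<le> functional g x (W k) k s y}))"
    by (auto simp: region_def)
  also have "\<dots> \<in> sets borel"
    unfolding level_def functional_def
    by (intro borel_closed closed_UN closed_Int closed_INT ballI closed_Collect_le continuous_intros) auto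
  finally show ?thesis .
qed

text \<open>Off the interface membership is decided by finitely many strict inequalities, besides
  the comparison of \<open>s\<close> with itself, between quantities continuous in the
  weights.\<close>

lemma eventually_region_iff:
  assumes lim: "\<And>q. q < T \<Longrightarrow> (\<lambda>i. X i q) \<longlonglongrightarrow> x q" and s: "s < p" and y: "y \<notin> interface g x W"
  shows "\<forall>\<^sub>F i in sequentially. y \<in> region g (X i) W s \<longleftrightarrow> y \<in> region g x W s"
proof -
  have site: "(\<lambda>i. site g (X i) k j) \<longlonglongrightarrow> site g x k j" if "k < t" for k j
    unfolding site_def
  proof (intro tendsto_sum tendsto_scaleR tendsto_const)
    fix m assume "m \<in> {..<n}"
    then show "(\<lambda>i. if g (pos k m) = j then X i (pos k m) else 0) \<longlonglongrightarrow> (if g (pos k m) = j then x (pos k m) else 0)"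
      using lim[OF pos_less[OF that, of m]] by simp
  qed
  have fn: "(\<lambda>i. functional g (X i) w k j y) \<longlonglongrightarrow> functional g x w k j y" if "k < t" for k j w
    unfolding functional_def height_def by (intro tendsto_intros site[OF that])
  have mass: "(\<lambda>i. mass (X i) k) \<longlonglongrightarrow> mass x k" if "k < t" for k
    unfolding mass_def by (intro tendsto_intros lim pos_less[OF that]) auto
  have cut: "(\<lambda>i. cut (X i) k) \<longlonglongrightarrow> cut x k" if "k \<le> t" for k
    unfolding cut_def by (intro tendsto_sum mass) (use that in auto)
  have lvl: "(\<lambda>i. level y * cut (X i) t) \<longlonglongrightarrow> level y * cut x t" by (intro tendsto_intros cut) simp
  have ny: "level y * cut x t \<noteq> cut x k" if "k \<le> t" for k using y that by (auto simp: interface_def)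
  have E: "\<forall>\<^sub>F i in sequentially. \<forall>k\<in>{..<t}. (cut (X i) k \<le> level y * cut (X i) t \<longleftrightarrow> cut x k \<le> level y * cut x t) \<and>
     (level y * cut (X i) t \<le> cut (X i) (Suc k) \<longleftrightarrow> level y * cut x t \<le> cut x (Suc k)) \<and>
     (\<forall>j\<in>{..<p}. functional g (X i) (W k) k j y \<le> functional g (X i) (W k) k s y \<longleftrightarrow> functional g x (W k) k j y \<le> functional g x (W k) k s y)"
  proof (intro eventually_ball_finite ballI eventually_conj)
    fix k assume k: "k \<in> {..<t}"
    show "\<forall>\<^sub>F i in sequentially. cut (X i) k \<le> level y * cut (X i) t \<longleftrightarrow> cut x k \<le> level y * cut x t"
      using ny[of k] k by (intro tendsto_imp_eventually_le_iff cut lvl) auto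
    show "\<forall>\<^sub>F i in sequentially. level y * cut (X i) t \<le> cut (X i) (Suc k) \<longleftrightarrow> level y * cut x t \<le> cut x (Suc k)"
      using ny[of "Suc k"] k by (intro tendsto_imp_eventually_le_iff cut lvl) auto
    fix j assume j: "j \<in> {..<p}"
    show "\<forall>\<^sub>F i in sequentially. functional g (X i) (W k) k j y \<le> functional g (X i) (W k) k s y \<longleftrightarrow> functional g x (W k) k j y \<le> functional g x (W k) k s y"
    proof (cases "j = s")
      case False
      then have "functional g x (W k) k j y \<noteq> functional g x (W k) k s y"
        using y k j s unfolding interface_def by blast
      then show ?thesis using k by (intro tendsto_imp_eventually_le_iff fn) auto
    qed simp
  qed auto
  then show ?thesis
  proof eventually_elim
    case (elim i)
    then show ?case unfolding region_def by auto
  qed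
qed

lemma measure_region_tendsto:
  assumes mu: "admissible_measure mu" and lim: "\<And>q. q < T \<Longrightarrow> (\<lambda>i. X i q) \<longlonglongrightarrow> x q" and s: "s < p"
    and x: "x \<in> simplex_points T" and W: "W \<in> order_tuples p t"
  shows "(\<lambda>i. measure mu (region g (X i) W s)) \<longlonglongrightarrow> measure mu (region g x W s)"
proof (rule measure_tendsto_AE)
  show "finite_measure mu" using mu by (simp add: admissible_measure_def prob_space_def)
  show "AE y in mu. \<forall>\<^sub>F i in sequentially. y \<in> region g (X i) W s \<longleftrightarrow> y \<in> region g x W s"
    using AE_not_in[OF interface_null[OF mu x W, of g]] by eventually_elim (rule eventually_region_iff[OF lim s])
qed (use region_sets admissible_sets[OF mu] in auto)

lemma region_exactly_one:
  assumes x: "x \<in> simplex_points T" and y: "y \<notin> interface g x W"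
  shows "\<exists>!s. s < p \<and> y \<in> region g x W s"
proof -
  have ny: "level y * cut x t \<noteq> cut x k" if "k \<le> t" for k using y that by (auto simp: interface_def)
  let ?l = "level y * cut x t"
  have l0: "0 < ?l" using level_bounds cut_total_pos[OF x] by simp
  have lt: "?l \<le> cut x t" using level_bounds[of y] cut_total_pos[OF x] by simp
  define k where "k = (LEAST k. ?l \<le> cut x (Suc k))"
  have ex: "?l \<le> cut x (Suc (t - 1))" using lt t by simp
  have k1: "?l \<le> cut x (Suc k)" unfolding k_def by (rule LeastI[where P="\<lambda>k. ?l \<le> cut x (Suc k)", OF ex])
  have kt: "k < t" unfolding k_def using Least_le[of "\<lambda>k. ?l \<le> cut x (Suc k)", OF ex] t by linarith
  have k2: "cut x k \<le> ?l"
  proof (cases k)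
    case 0 then show ?thesis using l0 by (simp add: cut_def)
  next
    case (Suc k')
    then have "\<not> ?l \<le> cut x (Suc k')" using not_less_Least[of k' "\<lambda>k. ?l \<le> cut x (Suc k)"] unfolding k_def by simp
    then show ?thesis using Suc by simp
  qed
  let ?f = "\<lambda>i. functional g x (W k) k i y"
  have "\<exists>s\<in>{..<p}. \<forall>i\<in>{..<p}. ?f i \<le> ?f s"
  proof -
    have "Max (?f ` {..<p}) \<in> ?f ` {..<p}" by (rule Max_in) (use p0 in auto)
    then obtain s where s: "s \<in> {..<p}" "?f s = Max (?f ` {..<p})" by auto
    then show ?thesis by (intro bexI[of _ s]) auto
  qed
  then obtain s where s: "s < p" "\<forall>i<p. ?f i \<le> ?f s" by auto
  have mem: "y \<in> region g x W s" unfolding region_def using s k1 k2 kt by blast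
  have "s' = s" if s': "s' < p" "y \<in> region g x W s'" for s'
  proof -
    obtain k' where k': "k' < t" "cut x k' \<le> ?l" "?l \<le> cut x (Suc k')" "\<forall>i<p. functional g x (W k') k' i y \<le> functional g x (W k') k' s' y"
      using s'(2) unfolding region_def by blast
    have st: "cut x k' < ?l" "?l < cut x (Suc k')" "cut x k < ?l" "?l < cut x (Suc k)"
      using k' k1 k2 kt ny[of k'] ny[of "Suc k'"] ny[of k] ny[of "Suc k"] by fastforce+
    have "k' = k"
    proof (rule ccontr)
      assume "k' \<noteq> k"
      then consider "Suc k' \<le> k" | "Suc k \<le> k'" by linarith
      then show False using cut_mono[of "Suc k'" k x] cut_mono[of "Suc k" k' x] st by cases auto
    qed
    then have "?f s = ?f s'" using k' s s'(1) by (intro order.antisym) auto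
    then show ?thesis using y kt s(1) s'(1) unfolding interface_def by blast
  qed
  then show ?thesis using s(1) mem by blast
qed

lemma sum_measure_region:
  assumes mu: "admissible_measure mu" and x: "x \<in> simplex_points T" and W: "W \<in> order_tuples p t"
  shows "(\<Sum>s<p. measure mu (region g x W s)) = 1"
proof -
  interpret prob_space mu using mu by (simp add: admissible_measure_def)
  have st: "region g x W s \<in> sets mu" for s using region_sets admissible_sets[OF mu] by simp
  have "(\<Sum>s<p. measure mu (region g x W s)) = (\<Sum>s<p. integral\<^sup>L mu (indicator (region g x W s)))" using st by simp
  also have "\<dots> = (LINT y|mu. (\<Sum>s<p. indicator (region g x W s) y))"
    by (subst Bochner_Integration.integral_sum) (use st in \<open>auto simp: emeasure_eq_measure\<close>)
  also have "\<dots> = (LINT y|mu. 1)"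
  proof (rule integral_cong_AE)
    show "AE y in mu. (\<Sum>s<p. indicator (region g x W s) y) = (1::real)"
      using AE_not_in[OF interface_null[OF mu x W, of g]]
    proof eventually_elim
      case (elim y)
      then obtain s where s: "s < p" "y \<in> region g x W s" "\<And>s'. s' < p \<Longrightarrow> y \<in> region g x W s' \<Longrightarrow> s' = s"
        using region_exactly_one[OF x, of y g W] by blast
      have "(\<Sum>s'<p. indicator (region g x W s') y) = (\<Sum>s'<p. if s' = s then 1 else (0::real))"
      proof (intro sum.cong refl)
        fix s' assume "s' \<in> {..<p}"
        then have "y \<in> region g x W s' \<longleftrightarrow> s' = s" using s(2) s(3)[of s'] by blast
        then show "indicator (region g x W s') y = (if s' = s then 1 else (0::real))" by (simp add: indicator_def)
      qed
      then show ?case using s(1) by simp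
    qed
  qed (use st in auto)
  also have "\<dots> = 1" using prob_space by simp
  finally show ?thesis .
qed

text \<open>With positive mass the sites are separated and the regions agree. Without mass the slab
  of block \<open>k\<close> has zero width, so its order affects a null set only.\<close>

lemma measure_region_unshuffle:
  assumes mu: "admissible_measure mu" and x: "x \<in> simplex_points T" and W: "W \<in> order_tuples p t" and k: "k < t" and s: "s < p"
    and sep: "mass x k > 0 \<Longrightarrow> (\<forall>i<p. \<forall>j<p. i \<in> A \<longrightarrow> j \<notin> A \<longrightarrow> width / 2 \<le> norm (site g x k i - site g x k j))"
  shows "measure mu (region g x (W(k := unshuffle A (W k))) s) = measure mu (region g x W s)"
proof (cases "mass x k > 0")
  case True
  then show ?thesis using region_unshuffle[OF k W s, of A g x] sep by simp
next
  case False
  then have "mass x k = 0" by (simp add: mass_def)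
  then have c: "cut x (Suc k) = cut x k" by (simp add: cut_def)
  show ?thesis
  proof (rule measure_eq_AE)
    show "AE y in mu. y \<in> region g x (W(k := unshuffle A (W k))) s \<longleftrightarrow> y \<in> region g x W s"
      using AE_not_in[OF interface_null[OF mu x W, of g]]
    proof eventually_elim
      case (elim y)
      then have "level y * cut x t \<noteq> cut x k" using k by (auto simp: interface_def)
      then have "\<not> (cut x k \<le> level y * cut x t \<and> level y * cut x t \<le> cut x (Suc k))" unfolding c by linarith
      then show ?case unfolding region_def by (auto split: if_splits)
    qed
  qed (use region_sets admissible_sets[OF mu] in auto)
qed

lemma region_label_union:
  assumes x: "x \<in> simplex_points T" and W: "W \<in> order_tuples p t"
  shows "\<exists>P. iterated_partition p P \<and> length P = p * t \<and> (\<forall>s<p. label_union P (s + 1) = region g x W s)"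
proof -
  define C where "C k s = {y. \<forall>i<p. functional g x (W k) k i y \<le> functional g x (W k) k s y}" for k s
  let ?f = "\<lambda>y. level y * cut x t"
  have c0: "cut x t > 0" by (rule cut_total_pos[OF x])
  have pd: "\<exists>P\<in>power_diagrams p. length P = p \<and> (\<forall>s<p. label_union P (s + 1) = C k s)" if k: "k < t" for k
  proof -
    let ?A = "map (\<lambda>i. (site g x k i, height g x (W k) k i)) [0..<p]"
    let ?P = "map (\<lambda>i. ({y. fst (?A!i) \<bullet> y + snd (?A!i) = (MAX j\<in>{..<p}. fst (?A!j) \<bullet> y + snd (?A!j))}, i + 1)) [0..<p]"
    have Wk: "W k \<in> orders p" using W k by auto
    have "distinct ?A"
      unfolding distinct_map
    proof (intro conjI inj_onI)
      fix i j assume "i \<in> set [0..<p]" "j \<in> set [0..<p]"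
        "(site g x k i, height g x (W k) k i) = (site g x k j, height g x (W k) k j)"
      then show "i = j" using functional_distinct[OF _ _ _ Wk, of i j g x k] by (cases "i = j") auto
    qed simp
    then have "?P \<in> power_diagrams p" unfolding power_diagrams_def by (intro CollectI exI[of _ ?A]) simp
    moreover have "label_union ?P (s + 1) = C k s" if s: "s < p" for s
    proof -
      have "label_union ?P (s + 1) = {y. fst (?A!s) \<bullet> y + snd (?A!s) = (MAX j\<in>{..<p}. fst (?A!j) \<bullet> y + snd (?A!j))}"
        by (rule label_union_map[OF s])
      also have "\<dots> = C k s"
      proof (rule set_eqI)
        fix y
        have "(MAX j\<in>{..<p}. fst (?A!j) \<bullet> y + snd (?A!j)) = (MAX j\<in>{..<p}. functional g x (W k) k j y)"
          by (intro arg_cong[where f=Max] image_cong) (auto simp: functional_def)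
        moreover have "functional g x (W k) k s y = (MAX j\<in>{..<p}. functional g x (W k) k j y) \<longleftrightarrow>
          (\<forall>j<p. functional g x (W k) k j y \<le> functional g x (W k) k s y)"
          using s by (subst eq_commute, subst Max_eq_iff) auto
        ultimately show "y \<in> {y. fst (?A!s) \<bullet> y + snd (?A!s) = (MAX j\<in>{..<p}. fst (?A!j) \<bullet> y + snd (?A!j))} \<longleftrightarrow> y \<in> C k s"
          using s by (simp add: C_def functional_def)
      qed
      finally show ?thesis .
    qed
    ultimately show ?thesis by (intro bexI[of _ ?P]) auto
  qed
  have half: "\<exists>a. halfplus (bvec 0) a = {y. ?f y \<le> cut x k} \<and> halfminus (bvec 0) a = {y. cut x k \<le> ?f y}" for k
  proof -
    let ?c = "cut x k / cut x t"
    have lc: "?f y \<le> cut x k \<longleftrightarrow> level y \<le> ?c" "cut x k \<le> ?f y \<longleftrightarrow> ?c \<le> level y" for y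
      using c0 by (simp_all add: field_simps)
    \<comment> \<open>Since \<open>level\<close> stays strictly between 0 and 1, the first two cases
      are the cuts at plus and minus infinity; the third is a hyperplane.\<close>
    consider "?c \<le> 0" | "?c \<ge> 1" | "0 < ?c" "?c < 1" by linarith
    then show ?thesis
    proof cases
      case 1
      have "?c < level y" for y using 1 level_bounds(1)[of y] by linarith
      then have "\<not> level y \<le> ?c" "?c \<le> level y" for y by (simp_all add: not_le less_imp_le)
      then show ?thesis unfolding lc halfplus_def halfminus_def by (intro exI[of _ \<infinity>]) auto
    next
      case 2
      have "level y < ?c" for y using 2 level_bounds(2)[of y] by linarith
      then have "\<not> ?c \<le> level y" "level y \<le> ?c" for y by (simp_all add: not_le less_imp_le)
      then show ?thesis unfolding lc halfplus_def halfminus_def by (intro exI[of _ "-\<infinity>"]) auto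
    next
      case 3
      define e where "e = ?c"
      let ?b = "pi * (1 / 2 - e)"
      have e: "0 < e" "e < 1" using 3 by (simp_all add: e_def)
      have b: "-(pi / 2) < ?b" "?b < pi / 2"
      proof -
        have "pi * e < pi * 1" using e(2) by (intro mult_strict_left_mono) auto
        moreover have "pi * e > 0" using e(1) by simp
        ultimately show "-(pi / 2) < ?b" "?b < pi / 2" by (simp_all add: right_diff_distrib)
      qed
      have "level y \<le> e \<longleftrightarrow> ?b \<le> arctan (y \<bullet> bvec 0)" "e \<le> level y \<longleftrightarrow> arctan (y \<bullet> bvec 0) \<le> ?b" for y
        by (simp_all add: level_def field_simps)
      moreover have "?b \<le> arctan z \<longleftrightarrow> tan ?b \<le> z" "arctan z \<le> ?b \<longleftrightarrow> z \<le> tan ?b" for z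
        using arctan_le_iff[of "tan ?b" z] arctan_le_iff[of z "tan ?b"] arctan_tan[OF b] by auto
      ultimately show ?thesis unfolding lc halfplus_def halfminus_def e_def[symmetric]
        by (intro exI[of _ "ereal (tan ?b)"]) auto
    qed
  qed
  have nv: "norm (bvec 0) = 1" using bvec_Basis[of 0] by simp
  have tt: "0 + Suc (t - 1) = t" using t by simp
  obtain P X where P: "iter_space p (Suc (t - 1)) X" "P \<in> X" "length P = p * Suc (t - 1)"
    "\<forall>s<p. label_union P (s + 1) = {y. \<exists>l. 0 \<le> l \<and> l < t \<and> (0 < l \<longrightarrow> cut x l \<le> ?f y) \<and> (Suc l < t \<longrightarrow> ?f y \<le> cut x (Suc l)) \<and> y \<in> C l s}"
    using iterated_slab_partition[where t=t and f="?f" and c="cut x" and C=C and m="t - 1" and k=0, OF nv pd half cut_mono tt] by blast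
  have "{y. \<exists>l. 0 \<le> l \<and> l < t \<and> (0 < l \<longrightarrow> cut x l \<le> ?f y) \<and> (Suc l < t \<longrightarrow> ?f y \<le> cut x (Suc l)) \<and> y \<in> C l s} = region g x W s" for s
  proof -
    have 0: "cut x 0 \<le> ?f y" for y using level_bounds[of y] c0 by (simp add: cut_def)
    have 1: "?f y \<le> cut x t" for y using level_bounds[of y] c0 by simp
    have F0: "(0 < l \<longrightarrow> cut x l \<le> ?f y) \<longleftrightarrow> cut x l \<le> ?f y" for l y using 0 by (cases l) auto
    have F1: "l < t \<Longrightarrow> (Suc l < t \<longrightarrow> ?f y \<le> cut x (Suc l)) \<longleftrightarrow> ?f y \<le> cut x (Suc l)" for l y
      using 1[of y] by (metis Suc_lessI)
    show ?thesis unfolding region_def C_def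
    proof (intro Collect_cong ex_cong1)
      fix y l
      show "(0 \<le> l \<and> l < t \<and> (0 < l \<longrightarrow> cut x l \<le> ?f y) \<and> (Suc l < t \<longrightarrow> ?f y \<le> cut x (Suc l)) \<and>
          y \<in> {y. \<forall>i<p. functional g x (W l) l i y \<le> functional g x (W l) l s y}) =
        (l < t \<and> cut x l \<le> ?f y \<and> ?f y \<le> cut x (Suc l) \<and> (\<forall>i<p. functional g x (W l) l i y \<le> functional g x (W l) l s y))"
        using F0[of l y] F1[of l y] by blast
    qed
  qed
  then have "\<forall>s<p. label_union P (s + 1) = region g x W s" using P(4) by simp
  moreover have "iterated_partition p P" unfolding iterated_partition_def using P(1,2) by blast
  moreover have "length P = p * t" using P(3) t by simp
  ultimately show ?thesis by blast
qed

end

section \<open>Existence of equipartitions\<close>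

text \<open>The maximum extends over all measures and labels. If all labels of \<open>j\<close>
  attain it and all sums are 1, then \<open>v j\<close> is uniform, no value exceeds
  \<open>1 / p\<close>, and every measure is equipartitioned. Otherwise the top labels of a measure
  form a proper subset, as \<open>equiv_elem\<close> requires.\<close>

definition top_set :: "nat \<Rightarrow> nat \<Rightarrow> (nat \<Rightarrow> nat \<Rightarrow> real) \<Rightarrow> nat \<Rightarrow> nat set" where
  "top_set M p v j = {s. s < p \<and> (\<forall>j'<M. \<forall>s'<p. v j' s' \<le> v j s)}"

definition top_label :: "nat \<Rightarrow> nat \<Rightarrow> (nat \<Rightarrow> nat \<Rightarrow> real) \<Rightarrow> nat \<times> nat" where
  "top_label M p v = (let j = (LEAST j. j < M \<and> top_set M p v j \<noteq> {}) in (j, equiv_elem p (top_set M p v j)))"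

lemma top_label:
  assumes p: "prime p" and M: "\<And>j. j < M \<Longrightarrow> (\<Sum>s<p. v j s) = 1" and ex: "\<exists>j<M. \<exists>s<p. v j s \<noteq> 1 / real p"
  shows "fst (top_label M p v) < M" "snd (top_label M p v) < p"
    "j' < M \<Longrightarrow> s' < p \<Longrightarrow> v j' s' \<le> v (fst (top_label M p v)) (snd (top_label M p v))"
    "proper_nonempty p (top_set M p v (fst (top_label M p v)))"
proof -
  have p0: "p > 0" using p prime_gt_0_nat by blast
  let ?V = "(\<lambda>(j, s). v j s) ` ({..<M} \<times> {..<p})"
  obtain j1 where j1: "j1 < M" using ex by blast
  have "Max ?V \<in> ?V" by (rule Max_in) (use j1 p0 in auto)
  then obtain j2 s2 where "j2 < M" "s2 < p" "Max ?V = v j2 s2" by auto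
  moreover have "v j s \<le> Max ?V" if "j < M" "s < p" for j s by (rule Max_ge) (use that in auto)
  ultimately have "j2 < M \<and> top_set M p v j2 \<noteq> {}" unfolding top_set_def by auto
  define j where "j = (LEAST j. j < M \<and> top_set M p v j \<noteq> {})"
  have j: "j < M" "top_set M p v j \<noteq> {}"
    using LeastI[of "\<lambda>j. j < M \<and> top_set M p v j \<noteq> {}", OF \<open>j2 < M \<and> _\<close>] by (auto simp: j_def)
  have "top_set M p v j \<noteq> {..<p}"
  proof
    assume full: "top_set M p v j = {..<p}"
    have le: "v j' s' \<le> v j s" if "s < p" "j' < M" "s' < p" for j' s s'
      using full that unfolding top_set_def by blast
    have vj: "v j s = 1 / real p" if "s < p" for s
    proof -
      have "v j s' = v j s" if "s' < p" for s' using le[OF that j(1) \<open>s < p\<close>] le[OF \<open>s < p\<close> j(1) that] by simp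
      then have "(\<Sum>s'<p. v j s') = real p * v j s" by simp
      then show ?thesis using M[OF j(1)] p0 by (simp add: field_simps)
    qed
    have "v j' s' = 1 / real p" if "j' < M" "s' < p" for j' s'
    proof (rule ccontr)
      assume ne: "v j' s' \<noteq> 1 / real p"
      have l: "v j' i \<le> 1 / real p" if "i < p" for i using le[OF \<open>s' < p\<close> \<open>j' < M\<close> that] vj[OF \<open>s' < p\<close>] by simp
      have "(\<Sum>i<p. v j' i) < (\<Sum>i<p. 1 / real p)"
        by (rule sum_strict_mono_ex1) (use l ne that in \<open>auto simp: less_le intro!: bexI[of _ s']\<close>)
      then show False using M[OF that(1)] p0 by simp
    qed
    then show False using ex by blast
  qed
  then have pn: "proper_nonempty p (top_set M p v j)"
    using j(2) by (auto simp: proper_nonempty_def top_set_def)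
  have mem: "equiv_elem p (top_set M p v j) \<in> top_set M p v j" by (rule equiv_elem(1)[OF p pn])
  have t: "top_label M p v = (j, equiv_elem p (top_set M p v j))" by (simp add: top_label_def j_def Let_def)
  show "fst (top_label M p v) < M" "snd (top_label M p v) < p"
    "j' < M \<Longrightarrow> s' < p \<Longrightarrow> v j' s' \<le> v (fst (top_label M p v)) (snd (top_label M p v))"
    "proper_nonempty p (top_set M p v (fst (top_label M p v)))"
    using mem pn j(1) by (simp_all add: t top_set_def)
qed

lemma top_label_rot:
  assumes p: "prime p" and M: "\<And>j. j < M \<Longrightarrow> (\<Sum>s<p. v j s) = 1" and ex: "\<exists>j<M. \<exists>s<p. v j s \<noteq> 1 / real p"
    and rot: "\<And>j s. j < M \<Longrightarrow> s < p \<Longrightarrow> v' j (rot p s) = v j s"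
  shows "top_label M p v' = rotv p (top_label M p v)"
proof -
  have p0: "p > 0" using p prime_gt_0_nat by blast
  have all: "(\<forall>i<p. Q i) \<longleftrightarrow> (\<forall>i<p. Q (rot p i))" for Q
    using bij_betw_rot[OF p0] unfolding bij_betw_def by (metis imageE imageI lessThan_iff)
  have ts: "top_set M p v' j = rot p ` top_set M p v j" if j: "j < M" for j
  proof (intro equalityI subsetI)
    fix s assume s: "s \<in> top_set M p v' j"
    then have "s \<in> rot p ` {..<p}" using bij_betw_rot[OF p0] by (simp add: bij_betw_def top_set_def)
    then obtain s0 where s0: "s0 < p" "s = rot p s0" by auto
    have "v j' s' \<le> v j s0" if "j' < M" "s' < p" for j' s'
      using s rot[OF that] rot[OF j s0(1)] that p0 s0 unfolding top_set_def by (metis (no_types, lifting) mem_Collect_eq rot_less)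
    then show "s \<in> rot p ` top_set M p v j" using s0 by (auto simp: top_set_def)
  next
    fix s assume "s \<in> rot p ` top_set M p v j"
    then obtain s0 where s0: "s0 < p" "s = rot p s0" "\<forall>j'<M. \<forall>s'<p. v j' s' \<le> v j s0" by (auto simp: top_set_def)
    have "\<forall>s'<p. v' j' s' \<le> v' j s" if "j' < M" for j'
      by (subst all) (use s0 that rot j in auto)
    then show "s \<in> top_set M p v' j" using s0 p0 by (simp add: top_set_def)
  qed
  define j where "j = (LEAST j. j < M \<and> top_set M p v j \<noteq> {})"
  have t: "top_label M p v = (j, equiv_elem p (top_set M p v j))" by (simp add: top_label_def j_def Let_def)
  have js: "j < M" "proper_nonempty p (top_set M p v j)"
    using top_label(1,4)[OF p M ex] unfolding t by simp_all
  have l: "(\<lambda>j. j < M \<and> top_set M p v' j \<noteq> {}) = (\<lambda>j. j < M \<and> top_set M p v j \<noteq> {})"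
    using ts by auto
  have "top_label M p v' = (j, equiv_elem p (top_set M p v' j))"
    unfolding top_label_def l Let_def j_def[symmetric] ..
  then show ?thesis unfolding t ts[OF js(1)] equiv_elem(2)[OF p js(2)] by (simp add: rotv_def)
qed

context power_family
begin

context
  fixes M :: nat and mu :: "nat \<Rightarrow> 'a measure"
  assumes mu: "\<And>j. j < M \<Longrightarrow> admissible_measure (mu j)"
    and no_equi: "\<And>g x W. x \<in> simplex_points T \<Longrightarrow> W \<in> order_tuples p t \<Longrightarrow>
      \<exists>j<M. \<exists>s<p. measure (mu j) (region g x W s) \<noteq> 1 / real p"
begin

definition share :: "(nat \<Rightarrow> nat) \<Rightarrow> (nat \<Rightarrow> real) \<Rightarrow> (nat \<Rightarrow> nat list) \<Rightarrow> nat \<Rightarrow> nat \<Rightarrow> real" where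
  "share g x W j s = (if j < M \<and> s < p then measure (mu j) (region g x W s) else 0)"

definition Lab :: "(nat \<Rightarrow> nat) \<Rightarrow> (nat \<Rightarrow> nat list) \<Rightarrow> (nat \<Rightarrow> real) \<Rightarrow> nat \<times> nat" where
  "Lab g W x = top_label M p (share g x W)"

lemma share_sum: "x \<in> simplex_points T \<Longrightarrow> W \<in> order_tuples p t \<Longrightarrow> j < M \<Longrightarrow> (\<Sum>s<p. share g x W j s) = 1"
  using sum_measure_region[OF mu] by (simp add: share_def)

lemma share_nonuniform: "x \<in> simplex_points T \<Longrightarrow> W \<in> order_tuples p t \<Longrightarrow> \<exists>j<M. \<exists>s<p. share g x W j s \<noteq> 1 / real p"
  using no_equi[of x W g] by (auto simp: share_def)

lemma Lab_top:
  assumes "x \<in> simplex_points T" "W \<in> order_tuples p t" "Lab g W x = (j, s)"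
  shows "j < M" "s < p" "j' < M \<Longrightarrow> s' < p \<Longrightarrow> share g x W j' s' \<le> share g x W j s"
proof -
  note t = top_label[where v="share g x W" and M=M, OF prime share_sum[OF assms(1,2)] share_nonuniform[OF assms(1,2)]]
  show "j < M" "s < p" "j' < M \<Longrightarrow> s' < p \<Longrightarrow> share g x W j' s' \<le> share g x W j s"
    using t(1-3) assms(3) unfolding Lab_def by simp_all
qed

lemma Lab_equivariant:
  assumes "\<And>q. g q < p" "W \<in> order_tuples p t" "x \<in> simplex_points T"
  shows "Lab (rot p \<circ> g) (rot_orders p t W) x = rotv p (Lab g W x)"
  unfolding Lab_def
  by (rule top_label_rot[OF prime share_sum[OF assms(3,2)] share_nonuniform[OF assms(3,2)]])
     (auto simp: share_def p0 region_rot[OF assms(1,2)])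

lemma Lab_support:
  assumes "\<And>q. q < T \<Longrightarrow> x q \<noteq> 0 \<Longrightarrow> g q = g' q"
  shows "Lab g W x = Lab g' W x"
proof -
  have "region g x W s = region g' x W s" for s by (rule region_local) (rule assms)
  then have "share g x W = share g' x W" unfolding share_def by (intro ext) simp
  then show ?thesis by (simp add: Lab_def)
qed

lemma Lab_separated:
  assumes g: "\<And>q. g q < p" and k: "k < t" and xs: "set xs \<subseteq> simplex_points T" "mesh_le D xs" and D: "D \<le> width / (4 * real n)"
    and zero: "\<And>x. x \<in> set xs \<Longrightarrow> x (cone k) = 0"
  shows "\<exists>A\<subseteq>{..<p}. A \<noteq> {} \<and> A \<noteq> {..<p} \<and> (\<forall>W\<in>order_tuples p t. \<forall>x\<in>set xs.
           Lab g W x = Lab g (W(k := unshuffle A (W k))) x)"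
proof -
  obtain A where A: "A \<subseteq> {..<p}" "A \<noteq> {}" "A \<noteq> {..<p}"
    and sep: "\<forall>x\<in>set xs. mass x k > 0 \<longrightarrow> (\<forall>i<p. \<forall>j<p. i \<in> A \<longrightarrow> j \<notin> A \<longrightarrow> width / 2 \<le> norm (site g x k i - site g x k j))"
  proof -
    have "\<exists>A\<subseteq>{..<p}. A \<noteq> {} \<and> A \<noteq> {..<p} \<and> (\<forall>x\<in>set xs. mass x k > 0 \<longrightarrow>
       (\<forall>i<p. \<forall>j<p. i \<in> A \<longrightarrow> j \<notin> A \<longrightarrow> width / 2 \<le> norm (site g x k i - site g x k j)))"
      by (rule exists_separation[OF k xs D g]) (rule zero)
    then show thesis using that by blast
  qed
  have "Lab g W x = Lab g (W(k := unshuffle A (W k))) x" if W: "W \<in> order_tuples p t" and x: "x \<in> set xs" for W x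
  proof -
    have "share g x (W(k := unshuffle A (W k))) = share g x W"
    proof (intro ext)
      fix j s
      show "share g x (W(k := unshuffle A (W k))) j s = share g x W j s"
        using measure_region_unshuffle[OF mu _ W k, of j x s A g] xs(1) x sep by (auto simp: share_def)
    qed
    then show ?thesis by (simp add: Lab_def)
  qed
  then show ?thesis using A by blast
qed

text \<open>Compactness: otherwise there are ever smaller lists on which every label of
  \<open>j\<close> is a top label. By continuity of the shares, at a limit point all shares of
  \<open>j\<close> are maximal, hence equal, and this forces an equipartition.\<close>

lemma no_full_column:
  assumes W: "W \<in> order_tuples p t" and j: "j < M"
  shows "\<exists>N. \<forall>xs. set xs \<subseteq> simplex_points T \<longrightarrow> mesh_le (1 / real (Suc N)) xs \<longrightarrow> \<not> {j} \<times> {..<p} \<subseteq> Lab g W ` set xs"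
proof (rule ccontr)
  assume "\<not> ?thesis"
  then have "\<forall>N. \<exists>xs. set xs \<subseteq> simplex_points T \<and> mesh_le (1 / real (Suc N)) xs \<and> {j} \<times> {..<p} \<subseteq> Lab g W ` set xs" by blast
  then obtain xs where xs: "\<And>N. set (xs N) \<subseteq> simplex_points T" "\<And>N. mesh_le (1 / real (Suc N)) (xs N)"
    "\<And>N. {j} \<times> {..<p} \<subseteq> Lab g W ` set (xs N)" by metis
  have "\<forall>N s. \<exists>z. s < p \<longrightarrow> z \<in> set (xs N) \<and> Lab g W z = (j, s)"
    using xs(3) by (force simp: image_iff)
  then obtain z where z: "\<And>N s. s < p \<Longrightarrow> z N s \<in> set (xs N)" "\<And>N s. s < p \<Longrightarrow> Lab g W (z N s) = (j, s)" by metis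
  have zs: "z N s \<in> simplex_points T" if "s < p" for N s using z(1)[OF that] xs(1) by blast
  have bd: "0 \<le> x q" "x q \<le> 1" if "x \<in> simplex_points T" for x q
  proof -
    show "0 \<le> x q" using that by (simp add: simplex_points_def)
    show "x q \<le> 1"
    proof (cases "q < T")
      case True
      have "x q \<le> (\<Sum>q<T. x q)" by (rule member_le_sum) (use True that in \<open>auto simp: simplex_points_def\<close>)
      then show ?thesis using that by (simp add: simplex_points_def)
    qed (use that in \<open>simp add: simplex_points_def\<close>)
  qed
  \<comment> \<open>The points are functions on \<open>nat\<close>; a subsequence is chosen that
    converges in the finitely many coordinates below \<open>T\<close>.\<close>
  have "\<forall>d\<subseteq>{..<T}. \<exists>l::nat \<Rightarrow> real. \<exists>r::nat \<Rightarrow> nat. strict_mono r \<and>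
      (\<forall>e>0. eventually (\<lambda>N. \<forall>i\<in>d. dist (z (r N) 0 i) (l i) < e) sequentially)"
  proof (rule compact_lemma_general[where unproj="\<lambda>e. e"])
    fix q
    show "bounded ((\<lambda>x. x q) ` range (\<lambda>N. z N 0))"
      by (rule boundedI[of _ 1]) (use bd[OF zs[OF p0]] in auto)
  qed auto
  then obtain l r where r: "strict_mono r"
    and l: "\<And>e. e > 0 \<Longrightarrow> eventually (\<lambda>N. \<forall>i\<in>{..<T}. dist (z (r N) 0 i) (l i) < e) sequentially" by blast
  define x where "x q = (if q < T then l q else 0)" for q
  have lim0: "(\<lambda>N. z (r N) 0 q) \<longlonglongrightarrow> x q" if "q < T" for q
    unfolding tendsto_iff
  proof (intro allI impI)
    fix e :: real assume "e > 0"
    then show "\<forall>\<^sub>F N in sequentially. dist (z (r N) 0 q) (x q) < e"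
      by (rule eventually_mono[OF l]) (use that in \<open>auto simp: x_def\<close>)
  qed
  have lim: "(\<lambda>N. z (r N) s q) \<longlonglongrightarrow> x q" if "q < T" "s < p" for q s
  proof -
    have "(\<lambda>N. z (r N) s q - z (r N) 0 q) \<longlonglongrightarrow> 0"
    proof (rule Lim_null_comparison)
      show "(\<lambda>N. 1 / real (Suc N)) \<longlonglongrightarrow> 0" by (rule LIMSEQ_Suc[OF lim_1_over_n])
      show "\<forall>\<^sub>F N in sequentially. norm (z (r N) s q - z (r N) 0 q) \<le> 1 / real (Suc N)"
      proof (rule always_eventually, rule allI)
        fix N
        have "\<bar>z (r N) s q - z (r N) 0 q\<bar> \<le> 1 / real (Suc (r N))"
          using xs(2)[of "r N"] z(1)[OF that(2)] z(1)[OF p0] unfolding mesh_le_def by blast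
        also have "\<dots> \<le> 1 / real (Suc N)"
          using seq_suble[OF r, of N] by (simp add: frac_le)
        finally show "norm (z (r N) s q - z (r N) 0 q) \<le> 1 / real (Suc N)" by simp
      qed
    qed
    from tendsto_add[OF this lim0[OF that(1)]] show ?thesis by simp
  qed
  have x: "x \<in> simplex_points T"
  proof -
    have nonneg: "0 \<le> x q" for q
    proof (cases "q < T")
      case True
      then show ?thesis by (intro LIMSEQ_le_const[OF lim0]) (use bd[OF zs[OF p0]] in auto)
    qed (simp add: x_def)
    have "(\<lambda>N. \<Sum>q<T. z (r N) 0 q) \<longlonglongrightarrow> (\<Sum>q<T. x q)" by (intro tendsto_sum lim0) auto
    moreover have "(\<lambda>N. \<Sum>q<T. z (r N) 0 q) = (\<lambda>N. 1)" using zs[OF p0] by (auto simp: simplex_points_def)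
    ultimately have "(\<lambda>N::nat. 1) \<longlonglongrightarrow> (\<Sum>q<T. x q)" by simp
    from LIMSEQ_unique[OF this tendsto_const] have "(\<Sum>q<T. x q) = 1" .
    moreover have "\<forall>q\<ge>T. x q = 0" by (simp add: x_def)
    ultimately show ?thesis using nonneg unfolding simplex_points_def by blast
  qed
  have sh: "(\<lambda>N. share g (z (r N) s) W j' s') \<longlonglongrightarrow> share g x W j' s'" if "s < p" "j' < M" "s' < p" for s j' s'
    unfolding share_def using that measure_region_tendsto[OF mu[OF that(2)] lim that(3) x W] by simp
  have le: "share g x W j' s' \<le> share g x W j s" if "s < p" "j' < M" "s' < p" for s j' s'
    by (rule LIMSEQ_le[OF sh[OF that] sh[OF that(1) j that(1)]])
       (use Lab_top(3)[OF zs[OF that(1)] W z(2)[OF that(1)] that(2,3)] in auto)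
  have eq: "share g x W j s = share g x W j 0" if "s < p" for s
    using le[OF that j p0] le[OF p0 j that] by simp
  have "share g x W j s = 1 / real p" if "s < p" for s
  proof -
    have "(\<Sum>i<p. share g x W j i) = (\<Sum>i<p. share g x W j 0)" by (rule sum.cong[OF refl], rule eq) simp
    then show ?thesis using share_sum[OF x W j, of g] eq[OF that] p0 by (simp add: field_simps)
  qed
  then have ub: "share g x W j' s' \<le> 1 / real p" if "j' < M" "s' < p" for j' s' using le[OF p0 that] p0 by simp
  obtain j' s' where ne: "j' < M" "s' < p" "share g x W j' s' \<noteq> 1 / real p" using share_nonuniform[OF x W, of g] by blast
  have "(\<Sum>i<p. share g x W j' i) < (\<Sum>i<p. 1 / real p)"
    by (rule sum_strict_mono_ex1) (use ub[OF ne(1)] ne in \<open>auto simp: less_le intro!: bexI[of _ s']\<close>)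
  then show False using share_sum[OF x W ne(1), of g] p0 by simp
qed

text \<open>A single mesh size for all \<open>g\<close> exists because \<open>Lab\<close> sees only
  the restriction of \<open>g\<close> to the \<open>T\<close> vertices, and there are finitely many
  of these.\<close>

lemma Lab_small:
  "\<exists>D>0. D \<le> width / (4 * real n) \<and> (\<forall>g W xs. (\<forall>q. g q < p) \<longrightarrow> W \<in> order_tuples p t \<longrightarrow> set xs \<subseteq> simplex_points T \<longrightarrow>
      mesh_le D xs \<longrightarrow> valid_labels p M (Lab g W ` set xs))"
proof -
  let ?G = "{..<T} \<rightarrow>\<^sub>E {..<p}"
  let ?F = "?G \<times> order_tuples p t \<times> {..<M}"
  have fin: "finite ?F" by (intro finite_cartesian_product finite_PiE) auto
  have "\<forall>f\<in>?F. \<exists>N. \<forall>xs. set xs \<subseteq> simplex_points T \<longrightarrow> mesh_le (1 / real (Suc N)) xs \<longrightarrow>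
      \<not> {snd (snd f)} \<times> {..<p} \<subseteq> Lab (fst f) (fst (snd f)) ` set xs"
    using no_full_column by auto
  then obtain N where N: "\<And>f xs. f \<in> ?F \<Longrightarrow> set xs \<subseteq> simplex_points T \<Longrightarrow> mesh_le (1 / real (Suc (N f))) xs \<Longrightarrow>
      \<not> {snd (snd f)} \<times> {..<p} \<subseteq> Lab (fst f) (fst (snd f)) ` set xs" by metis
  define D where "D = Min (insert (width / (4 * real n)) ((\<lambda>f. 1 / real (Suc (N f))) ` ?F))"
  have "D > 0" unfolding D_def using fin width_pos n0 by (subst Min_gr_iff) auto
  moreover have "D \<le> width / (4 * real n)" unfolding D_def using fin by (intro Min_le) auto
  moreover have "valid_labels p M (Lab g W ` set xs)"
    if g: "\<And>q. g q < p" and W: "W \<in> order_tuples p t" and xs: "set xs \<subseteq> simplex_points T" "mesh_le D xs" for g W xs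
    unfolding valid_labels_def
  proof (intro conjI allI impI)
    show "Lab g W ` set xs \<subseteq> {..<M} \<times> {..<p}"
    proof
      fix l assume "l \<in> Lab g W ` set xs"
      then obtain x where x: "x \<in> set xs" "l = Lab g W x" by blast
      obtain j s where l: "Lab g W x = (j, s)" by (cases "Lab g W x")
      have "x \<in> simplex_points T" using x(1) xs(1) by blast
      then show "l \<in> {..<M} \<times> {..<p}" unfolding x(2) l using Lab_top(1,2)[OF _ W l] by simp
    qed
    fix j assume j: "j < M"
    let ?g = "restrict g {..<T}"
    let ?f = "(?g, W, j)"
    have f: "?f \<in> ?F" using g W j by auto
    have "D \<le> 1 / real (Suc (N ?f))" unfolding D_def using fin f by (intro Min_le) auto
    then have "\<not> {j} \<times> {..<p} \<subseteq> Lab ?g W ` set xs" using N[OF f xs(1)] mesh_le_mono[OF xs(2)] by auto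
    moreover have "Lab ?g W x = Lab g W x" for x by (rule Lab_support) simp
    ultimately show "\<not> {..<p} \<subseteq> column (Lab g W ` set xs) j" by (auto simp: column_def)
  qed
  ultimately show ?thesis by blast
qed

lemma no_equipartition_False:
  assumes "M * (p - 1) < T"
  shows False
proof -
  obtain D where D: "D > 0" "D \<le> width / (4 * real n)"
    and valid: "\<And>g W xs. (\<And>q. g q < p) \<Longrightarrow> W \<in> order_tuples p t \<Longrightarrow> set xs \<subseteq> simplex_points T \<Longrightarrow>
      mesh_le D xs \<Longrightarrow> valid_labels p M (Lab g W ` set xs)"
    using Lab_small by blast
  interpret equivariant_labelling p t T M cone Lab D
  proof
    show "prime p" by (rule prime)
    show "cone k < T" if "k < t" for k by (rule pos_less[OF that]) simp
    show "\<exists>A\<subseteq>{..<p}. A \<noteq> {} \<and> A \<noteq> {..<p} \<and> (\<forall>W\<in>order_tuples p t. \<forall>x\<in>set xs.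
           Lab g W x = Lab g (W(k := unshuffle A (W k))) x)"
      if "\<And>q. g q < p" "k < t" "set xs \<subseteq> simplex_points T" "mesh_le D xs" "\<And>x. x \<in> set xs \<Longrightarrow> x (cone k) = 0" for g k xs
      by (rule Lab_separated[OF that(1-4) D(2)]) (rule that(5))
    show "Lab (rot p \<circ> g) (rot_orders p t W) x = rotv p (Lab g W x)"
      if "\<And>q. g q < p" "W \<in> order_tuples p t" "x \<in> simplex_points T" for g W x
      using that by (rule Lab_equivariant)
    show "Lab g W x = Lab g' W x" if "\<And>q. q < T \<Longrightarrow> x q \<noteq> 0 \<Longrightarrow> g q = g' q" for g g' W x
      using that by (rule Lab_support)
  qed (use assms D(1) valid in auto)
  show False by (rule contradiction)
qed

end

end

text \<open>The hypothesis on \<open>M\<close> says that the join has larger dimension than the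
  complex of valid labels.\<close>

theorem equip_ok_of_dim_less:
  assumes p: "prime p" and t: "t \<ge> 1" and M: "M * (p - 1) < t * Suc (DIM('a) * (p - 1))"
  shows "equip_ok TYPE('a::euclidean_space) (p * t) p M"
  unfolding equip_ok_def
proof (intro allI impI)
  fix mu :: "nat \<Rightarrow> 'a measure" assume mu: "\<forall>j<M. admissible_measure (mu j)"
  obtain bvec :: "nat \<Rightarrow> 'a" where bvec: "bij_betw bvec {..<DIM('a)} Basis"
    using ex_bij_betw_nat_finite[OF finite_Basis] by (auto simp: atLeast0LessThan)
  interpret power_family p t "DIM('a) * (p - 1)" bvec
    by standard (use p t bvec in auto)
  show "\<exists>P. iterated_partition p P \<and> length P = p * t \<and> (\<forall>j<M. \<forall>s\<in>{1..p}. measure (mu j) (label_union P s) = 1 / real p)"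
  proof (rule ccontr)
    assume none: "\<not> ?thesis"
    have "\<exists>j<M. \<exists>s<p. measure (mu j) (region g x W s) \<noteq> 1 / real p"
      if x: "x \<in> simplex_points T" and W: "W \<in> order_tuples p t" for g x W
    proof (rule ccontr)
      assume all: "\<not> ?thesis"
      obtain P where P: "iterated_partition p P" "length P = p * t" "\<forall>s<p. label_union P (s + 1) = region g x W s"
        using region_label_union[OF x W] by blast
      have "measure (mu j) (label_union P s) = 1 / real p" if j: "j < M" and s: "s \<in> {1..p}" for j s
      proof -
        have "s - 1 < p" "s - 1 + 1 = s" using s by auto
        then show ?thesis using P(3) all j by metis
      qed
      then show False using none P by blast
    qed
    then show False using no_equipartition_False[of M mu] mu M by blast
  qed
qed

section \<open>Optimality\<close>

lemma iter_space_length: "iter_space r t X \<Longrightarrow> t \<ge> 1 \<and> (\<forall>P\<in>X. length P = r * t)"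
proof (induction rule: iter_space.induct)
  case base
  then show ?case by (auto simp: power_diagrams_def)
next
  case (step t1 X1 t2 X2 v)
  then show ?case by (auto simp: glue_def algebra_simps)
qed

lemma iterated_partition_single:
  assumes "iterated_partition r P" "length P = r" "r > 0"
  shows "P \<in> power_diagrams r"
proof -
  obtain t X where X: "iter_space r t X" "P \<in> X" using assms(1) by (auto simp: iterated_partition_def)
  then have "r * t = r" using iter_space_length[OF X(1)] assms(2) by auto
  then have "t = 1" using assms(3) by simp
  with X(1) show ?thesis
  proof (cases rule: iter_space.cases)
    case base
    then show ?thesis using X(2) by simp
  next
    case (step t1 X1 t2 X2 v)
    then show ?thesis using iter_space_length[of r t1 X1] iter_space_length[of r t2 X2] \<open>t = 1\<close> by simp
  qed
qed

lemma admissible_uniform: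
  fixes A :: "'a::euclidean_space set"
  assumes "A \<in> sets borel" "emeasure lborel A \<noteq> 0" "emeasure lborel A \<noteq> \<infinity>"
  shows "admissible_measure (uniform_measure lborel A)"
  unfolding admissible_measure_def
proof (intro conjI)
  show "prob_space (uniform_measure lborel A)" by (rule prob_space_uniform_measure[OF assms(2,3)])
  show "absolutely_continuous lborel (uniform_measure lborel A)"
    unfolding absolutely_continuous_def
  proof
    fix N :: "'a set" assume N: "N \<in> null_sets lborel"
    then have "A \<inter> N \<in> null_sets lborel" using assms(1) by (intro null_set_Int1) auto
    then show "N \<in> null_sets (uniform_measure lborel A)"
      using N assms(1) by (auto simp: null_sets_def)
  qed
qed simp

lemma measure_uniform_disjoint:
  assumes "A \<in> sets borel" "A \<inter> K = {}"
  shows "measure (uniform_measure lborel A) K = 0"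
proof (cases "K \<in> sets borel")
  case True
  then show ?thesis using assms by (simp add: measure_def)
next
  case False
  then show ?thesis by (simp add: measure_notin_sets)
qed

text \<open>The balls are centered at the origin and at the basis vectors. An equipartition makes
  the first two cells meet every ball, so the difference of their functionals is small at all
  centers. The radius is such that its gradient \<open>u\<close> satisfies
  \<open>norm u \<le> norm u / 2\<close>; the two functionals then coincide.\<close>

lemma not_equip_ok_Suc_dim:
  assumes r: "r \<ge> 2"
  shows "\<not> equip_ok TYPE('a::euclidean_space) r r (DIM('a) + 1)"
proof
  let ?d = "DIM('a)"
  assume ok: "equip_ok TYPE('a) r r (?d + 1)"
  obtain e :: "nat \<Rightarrow> 'a" where e: "bij_betw e {..<?d} Basis"
    using ex_bij_betw_nat_finite[OF finite_Basis] by (auto simp: atLeast0LessThan)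
  define c where "c j = (if j < ?d then e j else 0)" for j
  define \<epsilon> :: real where "\<epsilon> = 1 / (4 * real ?d)"
  have eps: "\<epsilon> > 0" by (simp add: \<epsilon>_def)
  define mu where "mu j = uniform_measure lborel (ball (c j) \<epsilon>)" for j
  have adm: "admissible_measure (mu j)" for j
    unfolding mu_def
  proof (rule admissible_uniform)
    have "open (ball (c j) \<epsilon>)" "ball (c j) \<epsilon> \<noteq> {}" using eps by auto
    then show "emeasure lborel (ball (c j) \<epsilon>) \<noteq> 0" using open_not_negligible[of "ball (c j) \<epsilon>"]
      by (auto simp: negligible_iff_emeasure0)
    show "emeasure lborel (ball (c j) \<epsilon>) \<noteq> \<infinity>" using emeasure_lborel_ball_finite[of "c j" \<epsilon>] by simp
  qed simp
  obtain P where P: "iterated_partition r P" "length P = r"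
    "\<forall>j<?d + 1. \<forall>s\<in>{1..r}. measure (mu j) (label_union P s) = 1 / real r"
    using ok adm unfolding equip_ok_def by metis
  have "P \<in> power_diagrams r" by (rule iterated_partition_single[OF P(1,2)]) (use r in simp)
  then obtain A :: "('a \<times> real) list" where A: "length A = r" "distinct A"
    "P = map (\<lambda>i. ({x. fst (A!i) \<bullet> x + snd (A!i) = (MAX j\<in>{..<r}. fst (A!j) \<bullet> x + snd (A!j))}, i + 1)) [0..<r]"
    unfolding power_diagrams_def by blast
  have lu: "label_union P (i + 1) = {x. fst (A!i) \<bullet> x + snd (A!i) = (MAX j\<in>{..<r}. fst (A!j) \<bullet> x + snd (A!j))}" if "i < r" for i
    unfolding A(3) by (rule label_union_map[OF that])
  have ge: "fst (A!k) \<bullet> x + snd (A!k) \<le> fst (A!i) \<bullet> x + snd (A!i)" if "i < r" "k < r" "x \<in> label_union P (i + 1)" for i k x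
  proof -
    have "fst (A!k) \<bullet> x + snd (A!k) \<le> (MAX j\<in>{..<r}. fst (A!j) \<bullet> x + snd (A!j))" by (rule Max_ge) (use that in auto)
    then show ?thesis using that(3) unfolding lu[OF that(1)] by simp
  qed
  have meet: "\<exists>y. y \<in> ball (c j) \<epsilon> \<and> y \<in> label_union P (i + 1)" if "j < ?d + 1" "i < r" for i j
  proof (rule ccontr)
    assume "\<not> ?thesis"
    then have "measure (mu j) (label_union P (i + 1)) = 0"
      unfolding mu_def by (intro measure_uniform_disjoint) auto
    moreover have "measure (mu j) (label_union P (i + 1)) = 1 / real r" using P(3) that by auto
    ultimately show False using r by simp
  qed
  define u where "u = fst (A!0) - fst (A!1)"
  define \<beta> where "\<beta> = snd (A!0) - snd (A!1)"
  have near: "\<bar>u \<bullet> c j + \<beta>\<bar> \<le> norm u * \<epsilon>" if j: "j < ?d + 1" for j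
  proof -
    obtain y z where y: "y \<in> ball (c j) \<epsilon>" "y \<in> label_union P (0 + 1)" and z: "z \<in> ball (c j) \<epsilon>" "z \<in> label_union P (1 + 1)"
      using meet[OF j, of 0] meet[OF j, of 1] r by auto
    have 1: "u \<bullet> y + \<beta> \<ge> 0" using ge[OF _ _ y(2), of 1] r by (simp add: u_def \<beta>_def inner_diff_left)
    have 2: "u \<bullet> z + \<beta> \<le> 0" using ge[OF _ _ z(2), of 0] r by (simp add: u_def \<beta>_def inner_diff_left)
    have bd: "\<bar>u \<bullet> x - u \<bullet> c j\<bar> \<le> norm u * \<epsilon>" if "x \<in> ball (c j) \<epsilon>" for x
    proof -
      have "\<bar>u \<bullet> (x - c j)\<bar> \<le> norm u * norm (x - c j)" by (rule Cauchy_Schwarz_ineq2)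
      also have "\<dots> \<le> norm u * \<epsilon>" using that by (intro mult_left_mono) (auto simp: dist_norm norm_minus_commute)
      finally show ?thesis by (simp add: inner_diff_right)
    qed
    show ?thesis using 1 2 bd[OF y(1)] bd[OF z(1)] by linarith
  qed
  \<comment> \<open>The center with index \<open>?d\<close> is the origin, where the affine function
    has the value \<open>\<beta>\<close>.\<close>
  have \<beta>: "\<bar>\<beta>\<bar> \<le> norm u * \<epsilon>" using near[of ?d] by (simp add: c_def)
  have ub: "\<bar>u \<bullet> b\<bar> \<le> 2 * (norm u * \<epsilon>)" if "b \<in> Basis" for b
  proof -
    have "b \<in> e ` {..<?d}" using e that by (simp add: bij_betw_def)
    then obtain j where "j < ?d" "b = e j" by auto
    then show ?thesis using near[of j] \<beta> by (simp add: c_def)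
  qed
  have "norm u \<le> (\<Sum>b\<in>Basis. \<bar>u \<bullet> b\<bar>)" by (rule norm_le_l1)
  also have "\<dots> \<le> (\<Sum>b\<in>(Basis::'a set). 2 * (norm u * \<epsilon>))" by (rule sum_mono) (rule ub)
  also have "\<dots> = norm u / 2" by (simp add: \<epsilon>_def)
  finally have u0: "u = 0" by simp
  then have "\<beta> = 0" using \<beta> by simp
  then have "A!0 = A!1" using u0 by (simp add: u_def \<beta>_def prod_eq_iff)
  then show False using A(1,2) r by (auto simp: nth_eq_iff_index_eq)
qed

section \<open>Cut points of iterated partitions of the line\<close>

definition uncut :: "real set \<Rightarrow> real set \<Rightarrow> bool" where
  "uncut I K \<longleftrightarrow> I \<subseteq> K \<or> I \<inter> K = {}"

lemma uncut_Int: "uncut I K \<Longrightarrow> uncut I L \<Longrightarrow> uncut I (K \<inter> L)"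
  unfolding uncut_def by blast

lemma uncut_halfline:
  fixes a b c :: real
  assumes "c \<notin> {a<..<b}"
  shows "uncut {a<..<b} {x. c \<le> x}" "uncut {a<..<b} {x. x \<le> c}"
  using assms unfolding uncut_def by auto

lemma uncut_affine:
  fixes m q :: real
  shows "\<exists>C. finite C \<and> card C \<le> 1 \<and> (\<forall>a b. {a<..<b} \<inter> C = {} \<longrightarrow> uncut {a<..<b} {x. 0 \<le> m * x + q} \<and> uncut {a<..<b} {x. m * x + q \<le> 0})"
proof (cases "m = 0")
  case True
  then show ?thesis by (intro exI[of _ "{}"]) (auto simp: uncut_def)
next
  case False
  let ?c = "- q / m"
  have "{x. 0 \<le> m * x + q} = (if m > 0 then {x. ?c \<le> x} else {x. x \<le> ?c})"
    "{x. m * x + q \<le> 0} = (if m > 0 then {x. x \<le> ?c} else {x. ?c \<le> x})"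
    using False by (auto simp: field_simps split: if_splits)
  then show ?thesis using uncut_halfline[of ?c] by (intro exI[of _ "{?c}"]) auto
qed

text \<open>A power diagram with two cells has at most one cut point, and gluing adds at most one:
  \<open>(2 * t1 - 1) + (2 * t2 - 1) + 1 = 2 * (t1 + t2) - 1\<close>.\<close>

lemma iter_space_cuts:
  "iter_space 2 t X \<Longrightarrow> P \<in> X \<Longrightarrow> \<exists>C. finite C \<and> card C + 1 \<le> 2 * t \<and>
     (\<forall>a b. {a<..<b::real} \<inter> C = {} \<longrightarrow> (\<forall>(K, l)\<in>set P. uncut {a<..<b} K))"
proof (induction arbitrary: P rule: iter_space.induct)
  case base
  then obtain A :: "(real \<times> real) list" where A: "P = map (\<lambda>i. ({x. fst (A!i) \<bullet> x + snd (A!i) = (MAX j\<in>{..<2}. fst (A!j) \<bullet> x + snd (A!j))}, i + 1)) [0..<2]"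
    unfolding power_diagrams_def by blast
  let ?m = "fst (A!0) - fst (A!1)" and ?q = "snd (A!0) - snd (A!1)"
  obtain C where C: "finite C" "card C \<le> 1"
    "\<And>a b. {a<..<b} \<inter> C = {} \<Longrightarrow> uncut {a<..<b} {x. 0 \<le> ?m * x + ?q} \<and> uncut {a<..<b} {x. ?m * x + ?q \<le> 0}"
    using uncut_affine[of ?m ?q] by blast
  have two: "{..<2} = {0, 1::nat}" by auto
  have K: "{x. fst (A!0) \<bullet> x + snd (A!0) = (MAX j\<in>{..<2}. fst (A!j) \<bullet> x + snd (A!j))} = {x. 0 \<le> ?m * x + ?q}"
    "{x. fst (A!1) \<bullet> x + snd (A!1) = (MAX j\<in>{..<2}. fst (A!j) \<bullet> x + snd (A!j))} = {x. ?m * x + ?q \<le> 0}"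
    unfolding two by (auto simp: algebra_simps max_def)
  have "set P = {({x. 0 \<le> ?m * x + ?q}, 1), ({x. ?m * x + ?q \<le> 0}, 2)}"
    unfolding A K[symmetric] by (auto simp: upt_rec numeral_2_eq_2)
  then show ?case using C by (intro exI[of _ C]) auto
next
  case (step t1 X1 t2 X2 v)
  from step.prems obtain P1 P2 a where P: "P = glue v a P1 P2" "P1 \<in> X1" "P2 \<in> X2" by blast
  obtain C1 where C1: "finite C1" "card C1 + 1 \<le> 2 * t1" "\<And>a b. {a<..<b::real} \<inter> C1 = {} \<Longrightarrow> (\<forall>(K, l)\<in>set P1. uncut {a<..<b} K)"
    using step.IH(1)[OF P(2)] by blast
  obtain C2 where C2: "finite C2" "card C2 + 1 \<le> 2 * t2" "\<And>a b. {a<..<b::real} \<inter> C2 = {} \<Longrightarrow> (\<forall>(K, l)\<in>set P2. uncut {a<..<b} K)"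
    using step.IH(2)[OF P(3)] by blast
  obtain C0 where C0: "finite C0" "card C0 \<le> 1" "\<And>x y. {x<..<y} \<inter> C0 = {} \<Longrightarrow> uncut {x<..<y} (halfplus v a) \<and> uncut {x<..<y} (halfminus v a)"
  proof (cases a)
    case (real c)
    have "halfplus v a = {x. 0 \<le> v * x + - c}" "halfminus v a = {x. v * x + - c \<le> 0}"
      by (auto simp: halfplus_def halfminus_def real mult.commute)
    then show ?thesis using uncut_affine[of v "- c"] that by auto
  qed (use that[of "{}"] in \<open>auto simp: halfplus_def halfminus_def uncut_def\<close>)
  let ?C = "C0 \<union> (C1 \<union> C2)"
  have "card ?C \<le> card C0 + (card C1 + card C2)"
    using card_Un_le[of C0 "C1 \<union> C2"] card_Un_le[of C1 C2] by linarith
  then have "card ?C + 1 \<le> 2 * (t1 + t2)" using C0(2) C1(2) C2(2) by (simp add: distrib_left)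
  moreover have "\<forall>(K, l)\<in>set P. uncut {x<..<y} K" if "{x<..<y} \<inter> ?C = {}" for x y
  proof -
    have d: "{x<..<y} \<inter> C0 = {}" "{x<..<y} \<inter> C1 = {}" "{x<..<y} \<inter> C2 = {}" using that by auto
    show ?thesis unfolding P(1) glue_def using C0(3)[OF d(1)] C1(3)[OF d(2)] C2(3)[OF d(3)]
      by (auto intro: uncut_Int)
  qed
  ultimately show ?case using C0(1) C1(1) C2(1) by (intro exI[of _ ?C]) auto
qed

lemma not_equip_ok_real:
  assumes t: "t \<ge> 1"
  shows "\<not> equip_ok TYPE(real) (2 * t) 2 (2 * t)"
proof
  assume ok: "equip_ok TYPE(real) (2 * t) 2 (2 * t)"
  define I where "I j = {real j<..<real j + 1}" for j :: nat
  define mu where "mu j = uniform_measure lborel (I j)" for j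
  have Is: "I j \<in> sets borel" and Ie: "emeasure lborel (I j) = 1" for j by (auto simp: I_def)
  have "admissible_measure (mu j)" for j unfolding mu_def by (rule admissible_uniform) (simp_all add: Is Ie)
  then obtain P where P: "iterated_partition 2 P" "length P = 2 * t"
    "\<forall>j<2 * t. \<forall>s\<in>{1..2}. measure (mu j) (label_union P s) = 1 / real 2"
    using ok unfolding equip_ok_def by metis
  obtain t' X where X: "iter_space 2 t' X" "P \<in> X" using P(1) by (auto simp: iterated_partition_def)
  have "t' = t" using iter_space_length[OF X(1)] X(2) P(2) by auto
  obtain C where C: "finite C" "card C + 1 \<le> 2 * t" "\<And>a b. {a<..<b::real} \<inter> C = {} \<Longrightarrow> (\<forall>(K, l)\<in>set P. uncut {a<..<b} K)"
    using iter_space_cuts[OF X] \<open>t' = t\<close> by blast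
  have "\<exists>j<2 * t. I j \<inter> C = {}"
  proof (rule ccontr)
    assume "\<not> ?thesis"
    then have "\<forall>j\<in>{..<2 * t}. \<exists>x. x \<in> I j \<inter> C" by auto
    then obtain f where f: "\<And>j. j < 2 * t \<Longrightarrow> f j \<in> I j \<inter> C" by (metis lessThan_iff)
    have "inj_on f {..<2 * t}"
    proof (rule inj_onI)
      fix i j assume ij: "i \<in> {..<2 * t}" "j \<in> {..<2 * t}" "f i = f j"
      have "real i < f i" "f i < real i + 1" "real j < f i" "f i < real j + 1"
        using f[of i] f[of j] ij by (auto simp: I_def)
      then have "real i < real j + 1" "real j < real i + 1" by linarith+
      then show "i = j" by linarith
    qed
    then have "card {..<2 * t} \<le> card C" by (rule card_inj_on_le) (use f C(1) in auto)
    then show False using C(2) by simp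
  qed
  then obtain j where j: "j < 2 * t" "I j \<inter> C = {}" by blast
  have un: "\<forall>(K, l)\<in>set P. uncut (I j) K" using C(3) j(2) unfolding I_def by blast
  have half: "measure (mu j) (label_union P 1) = 1 / 2" using P(3) j(1) by auto
  have "I j \<subseteq> label_union P 1 \<or> I j \<inter> label_union P 1 = {}"
    using un unfolding label_union_eq uncut_def by blast
  then show False
  proof
    assume "I j \<inter> label_union P 1 = {}"
    then have "measure (mu j) (label_union P 1) = 0" unfolding mu_def by (rule measure_uniform_disjoint[OF Is])
    then show False using half by simp
  next
    assume sub: "I j \<subseteq> label_union P 1"
    \<comment> \<open>\<open>measure\<close> is 0 on sets that are not measurable, so the value
      \<open>1 / 2\<close> shows measurability.\<close>
    have "label_union P 1 \<in> sets borel" using half measure_notin_sets[of "label_union P 1" "mu j"]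
      by (auto simp: mu_def)
    then have "measure (mu j) (label_union P 1) = 1"
      using sub Is[of j] Ie[of j] by (simp add: mu_def measure_def Int_absorb2 Ie)
    then show False using half by simp
  qed
qed

theorem theorem1:
  fixes t r :: nat
  assumes "t \<ge> 1" and "prime r"
  shows "equip_ok TYPE('a::euclidean_space) (r * t) r
           (nat \<lceil>(real t * real DIM('a) * (real r - 1) + real t) / (real r - 1) - 1\<rceil>)
       \<and> equip_ok TYPE('a) r r DIM('a) \<and> \<not> equip_ok TYPE('a) r r (DIM('a) + 1)
       \<and> equip_ok TYPE(real) (2 * t) 2 (2 * t - 1) \<and> \<not> equip_ok TYPE(real) (2 * t) 2 (2 * t)"
proof (intro conjI)
  have r: "r \<ge> 2" using assms(2) by (rule prime_ge_2_nat)
  let ?z = "(real t * real DIM('a) * (real r - 1) + real t) / (real r - 1) - 1"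
  let ?M = "nat \<lceil>?z\<rceil>"
  \<comment> \<open>Positivity makes the ceiling smaller than \<open>?z + 1\<close> even after the
    truncation by \<open>nat\<close>. Multiplied by \<open>r - 1\<close>, this is the strict
    inequality between the dimensions.\<close>
  have "?z + 1 > 0" using r assms(1) by (auto intro!: divide_pos_pos add_nonneg_pos)
  then have "real ?M < ?z + 1" by linarith
  then have "real ?M * (real r - 1) < real t * real DIM('a) * (real r - 1) + real t"
    using r by (simp add: pos_less_divide_eq)
  moreover have "real (r - 1) = real r - 1" using r by simp
  ultimately have "real (?M * (r - 1)) < real (t * Suc (DIM('a) * (r - 1)))"
    unfolding of_nat_mult of_nat_Suc by (simp only: distrib_left mult_1_right mult.assoc add.commute)
  then show "equip_ok TYPE('a) (r * t) r ?M"
    using assms by (intro equip_ok_of_dim_less) (simp_all only: of_nat_less_iff)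
  show "equip_ok TYPE('a) r r DIM('a)"
    using equip_ok_of_dim_less[of r 1 "DIM('a)", where 'a='a] assms(2) by simp
  show "\<not> equip_ok TYPE('a) r r (DIM('a) + 1)" by (rule not_equip_ok_Suc_dim[OF r])
  show "equip_ok TYPE(real) (2 * t) 2 (2 * t - 1)"
    using assms(1) by (intro equip_ok_of_dim_less) auto
  show "\<not> equip_ok TYPE(real) (2 * t) 2 (2 * t)" by (rule not_equip_ok_real[OF assms(1)])
qed

end
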